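(* Let $\mathscr{E}$ be a directed graph. Then the graph inverse semigroup $S_{\mathscr{E}}$ of $\mathscr{E}$ has weak containment.
   Context: A directed graph $\mathscr{E} = (\mathscr{E}^0, \mathscr{E}^1, r, s)$ consists of countable sets $\mathscr{E}^0$ (vertices) and $\mathscr{E}^1$ (edges) and functions $r,s : \mathscr{E}^1 \to \mathscr{E}^0$ (range and source). $\mathscr{E}^*$ is the collection of finite directed paths in $\mathscr{E}$, including each vertex $v$ as a path of length zero with $r(v)=s(v)=v$. A path is written $\mu = \mu_n\mu_{n-1}\cdots\mu_1$ with $s(\mu_{i+1}) = r(\mu_i)$, and $r(\mu) = r(\mu_n)$, $s(\mu) = s(\mu_1)$. If $s(\mu) = r(\nu)$, then $\mu\nu$ denotes the concatenation $\mu_n\cdots\mu_1\nu_m\cdots\nu_1$. The graph inverse semigroup of $\mathscr{E}$ is the set $S_{\mathscr{E}} = \{(\mu,\nu) \in \mathscr{E}^*\times\mathscr{E}^* : s(\mu) = s(\nu)\} \cup \{0\}$, where $0$ is a zero element and the other products are $(\mu,\nu)(\alpha,\beta) = (\mu,\beta\nu')$ if $\nu = \alpha\nu'$; $(\mu,\nu)(\alpha,\beta) = (\mu\alpha',\beta)$ if $\alpha = \nu\alpha'$; and $(\mu,\nu)(\alpha,\beta) = 0$ otherwise. The inverse operation is $(\mu,\nu)^* = (\nu,\mu)$ (and $0^*=0$). Weak containment: For a (discrete) inverse semigroup $S$, $\mathbb{C}S$ is the complex $*$-algebra of finite formal sums over $S$, with product extending that of $S$ and involution $(\sum \alpha_s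 s)^* = \sum \overline{\alpha_s}\, s^*$. A representation of $S$ is a map $\pi$ from $S$ to the partial isometries on a Hilbert space with $\pi(st)=\pi(s)\pi(t)$ and $\pi(s^* )=\pi(s)^*$. The full $C^*$-algebra $C^*(S)$ is the completion of $\mathbb{C}S$ in the norm $\|f\|_{C^*(S)} = \sup_\pi \|\pi(f)\|$ over all representations $\pi$ of $S$. The left regular representation $\Lambda$ of $S$ on $\ell^2(S)$ is given by $\Lambda(a)\delta_b = \delta_{ab}$ if $a^*ab = b$, and $\Lambda(a)\delta_b = 0$ otherwise. It induces a $*$-homomorphism $\Lambda : C^*(S) \to \mathcal{B}(\ell^2(S))$ with image denoted $C^*_r(S)$. $S$ has weak containment if $\Lambda : C^*(S) \to C^*_r(S)$ is an isomorphism. *)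

theory Defs
  imports "HOL-Analysis.Infinite_Sum" "HOL-Algebra.Module" "Graph_Theory.Arc_Walk"
begin

section \<open>Inverse semigroups\<close>

record 's inv_semigroup = "'s partial_object" +
  sprod :: "'s \<Rightarrow> 's \<Rightarrow> 's"
  sadj :: "'s \<Rightarrow> 's"

locale inverse_semigroup =
  fixes S :: "'s inv_semigroup"
  assumes prod_closed: "s \<in> carrier S \<Longrightarrow> t \<in> carrier S \<Longrightarrow> sprod S s t \<in> carrier S"
    and prod_assoc: "s \<in> carrier S \<Longrightarrow> t \<in> carrier S \<Longrightarrow> u \<in> carrier S \<Longrightarrow>
      sprod S (sprod S s t) u = sprod S s (sprod S t u)"
    and adj_closed: "s \<in> carrier S \<Longrightarrow> sadj S s \<in> carrier S"
    and prod_adj_prod: "s \<in> carrier S \<Longrightarrow> sprod S (sprod S s (sadj S s)) s = s"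
    and adj_prod_adj: "s \<in> carrier S \<Longrightarrow> sprod S (sprod S (sadj S s) s) (sadj S s) = sadj S s"
    and adj_unique: "s \<in> carrier S \<Longrightarrow> t \<in> carrier S \<Longrightarrow>
      sprod S (sprod S s t) s = s \<Longrightarrow> sprod S (sprod S t s) t = t \<Longrightarrow> t = sadj S s"

section \<open>Hilbert spaces and bounded operators\<close>

definition complex_ring :: "complex ring" where
  "complex_ring = \<lparr>carrier = UNIV, mult = (*), one = 1, zero = 0, add = (+)\<rparr>"

lemma cring_complex_ring: "cring complex_ring"
proof (rule cringI)
  show "abelian_group complex_ring"
    by (rule abelian_groupI)
      (auto simp: complex_ring_def algebra_simps intro: exI[of _ "- x" for x] add.right_inverse)
  show "comm_monoid complex_ring"
    by (rule comm_monoidI) (auto simp: complex_ring_def)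
qed (auto simp: complex_ring_def algebra_simps)

text \<open>
  A Hilbert space is carried by a subset of a type, so that one can quantify over Hilbert spaces
  inside a formula.  The inner product is linear in its first argument.  As usual for HOL-Algebra
  modules, the ring product and the unit of the underlying record play no role.
\<close>

record 'h hilbert = "(complex, 'h) module" +
  ip :: "'h \<Rightarrow> 'h \<Rightarrow> complex"

definition hnorm :: "'h hilbert \<Rightarrow> 'h \<Rightarrow> real" where
  "hnorm H x = sqrt (Re (ip H x x))"

locale hilbert_space = module complex_ring H for H :: "'h hilbert" (structure) +
  assumes ip_add: "x \<in> carrier H \<Longrightarrow> y \<in> carrier H \<Longrightarrow> z \<in> carrier H \<Longrightarrow>
      ip H (x \<oplus>\<^bsub>H\<^esub> y) z = ip H x z + ip H y z"
    and ip_scale: "x \<in> carrier H \<Longrightarrow> z \<in> carrier H \<Longrightarrow> ip H (c \<odot>\<^bsub>H\<^esub> x) z = c * ip H x z"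
    and ip_commute: "x \<in> carrier H \<Longrightarrow> y \<in> carrier H \<Longrightarrow> ip H y x = cnj (ip H x y)"
    and ip_nonneg: "x \<in> carrier H \<Longrightarrow> 0 \<le> Re (ip H x x)"
    and ip_definite: "x \<in> carrier H \<Longrightarrow> ip H x x = 0 \<Longrightarrow> x = \<zero>\<^bsub>H\<^esub>"
    and complete: "(\<And>n. X n \<in> carrier H) \<Longrightarrow>
      (\<forall>e>0. \<exists>N::nat. \<forall>m\<ge>N. \<forall>n\<ge>N. hnorm H (X m \<ominus>\<^bsub>H\<^esub> X n) < e) \<Longrightarrow>
      \<exists>l\<in>carrier H. (\<lambda>n. hnorm H (X n \<ominus>\<^bsub>H\<^esub> l)) \<longlonglongrightarrow> 0"

text \<open>Operators are extensional functions, so that equality of operators is equality in HOL.\<close>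

definition bounded_ops :: "'h hilbert \<Rightarrow> ('h \<Rightarrow> 'h) set" where
  "bounded_ops H = {T \<in> carrier H \<rightarrow>\<^sub>E carrier H.
     (\<forall>x\<in>carrier H. \<forall>y\<in>carrier H. T (x \<oplus>\<^bsub>H\<^esub> y) = T x \<oplus>\<^bsub>H\<^esub> T y) \<and>
     (\<forall>c. \<forall>x\<in>carrier H. T (c \<odot>\<^bsub>H\<^esub> x) = c \<odot>\<^bsub>H\<^esub> T x) \<and>
     (\<exists>K. \<forall>x\<in>carrier H. hnorm H (T x) \<le> K * hnorm H x)}"

definition op_norm :: "'h hilbert \<Rightarrow> ('h \<Rightarrow> 'h) \<Rightarrow> real" where
  "op_norm H T = Sup {hnorm H (T x) |x. x \<in> carrier H \<and> hnorm H x \<le> 1}"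

definition is_adjoint :: "'h hilbert \<Rightarrow> ('h \<Rightarrow> 'h) \<Rightarrow> ('h \<Rightarrow> 'h) \<Rightarrow> bool" where
  "is_adjoint H T T' \<longleftrightarrow> (\<forall>x\<in>carrier H. \<forall>y\<in>carrier H. ip H (T x) y = ip H x (T' y))"

definition partial_isometry :: "'h hilbert \<Rightarrow> ('h \<Rightarrow> 'h) \<Rightarrow> bool" where
  "partial_isometry H T \<longleftrightarrow> T \<in> bounded_ops H \<and>
     (\<forall>x\<in>carrier H. (\<forall>z\<in>carrier H. T z = \<zero>\<^bsub>H\<^esub> \<longrightarrow> ip H x z = 0) \<longrightarrow> hnorm H (T x) = hnorm H x)"

section \<open>Star algebras\<close>

text \<open>
  The algebras below need not be unital.  The field \<open>one\<close>, which is inherited from the record of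
  rings, is left unspecified.
\<close>

record 'a star_algebra = "(complex, 'a) module" +
  star :: "'a \<Rightarrow> 'a"

definition star_isomorphism ::
    "('a \<Rightarrow> 'b) \<Rightarrow> 'a star_algebra \<Rightarrow> 'b star_algebra \<Rightarrow> bool" where
  "star_isomorphism \<phi> A B \<longleftrightarrow> bij_betw \<phi> (carrier A) (carrier B) \<and>
     (\<forall>x\<in>carrier A. \<forall>y\<in>carrier A. \<phi> (x \<oplus>\<^bsub>A\<^esub> y) = \<phi> x \<oplus>\<^bsub>B\<^esub> \<phi> y) \<and>
     (\<forall>c. \<forall>x\<in>carrier A. \<phi> (c \<odot>\<^bsub>A\<^esub> x) = c \<odot>\<^bsub>B\<^esub> \<phi> x) \<and>
     (\<forall>x\<in>carrier A. \<forall>y\<in>carrier A. \<phi> (x \<otimes>\<^bsub>A\<^esub> y) = \<phi> x \<otimes>\<^bsub>B\<^esub> \<phi> y) \<and>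
     (\<forall>x\<in>carrier A. \<phi> (star A x) = star B (\<phi> x))"

definition op_algebra :: "'h hilbert \<Rightarrow> ('h \<Rightarrow> 'h) star_algebra" where
  "op_algebra H = \<lparr>carrier = bounded_ops H,
     mult = compose (carrier H),
     one = undefined,
     zero = (\<lambda>x\<in>carrier H. \<zero>\<^bsub>H\<^esub>),
     add = (\<lambda>T U. \<lambda>x\<in>carrier H. T x \<oplus>\<^bsub>H\<^esub> U x),
     smult = (\<lambda>c T. \<lambda>x\<in>carrier H. c \<odot>\<^bsub>H\<^esub> T x),
     star = (\<lambda>T. THE T'. T' \<in> bounded_ops H \<and> is_adjoint H T T')\<rparr>"

text \<open>
  The completion of a star algebra in a seminorm \<open>N\<close>: Cauchy sequences modulo null sequences, with
  termwise operations.
\<close>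

definition cauchy_seqs :: "'a star_algebra \<Rightarrow> ('a \<Rightarrow> real) \<Rightarrow> (nat \<Rightarrow> 'a) set" where
  "cauchy_seqs A N = {F. (\<forall>n. F n \<in> carrier A) \<and>
     (\<forall>e>0. \<exists>M. \<forall>m\<ge>M. \<forall>n\<ge>M. N (F m \<ominus>\<^bsub>A\<^esub> F n) < e)}"

definition null_equiv :: "'a star_algebra \<Rightarrow> ('a \<Rightarrow> real) \<Rightarrow> (nat \<Rightarrow> 'a) rel" where
  "null_equiv A N = {(F, G). F \<in> cauchy_seqs A N \<and> G \<in> cauchy_seqs A N \<and>
     (\<lambda>n. N (F n \<ominus>\<^bsub>A\<^esub> G n)) \<longlonglongrightarrow> 0}"

definition completion :: "'a star_algebra \<Rightarrow> ('a \<Rightarrow> real) \<Rightarrow> (nat \<Rightarrow> 'a) set star_algebra" where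
  "completion A N = \<lparr>carrier = cauchy_seqs A N // null_equiv A N,
     mult = (\<lambda>X Y. \<Union>F\<in>X. \<Union>G\<in>Y. null_equiv A N `` {\<lambda>n. F n \<otimes>\<^bsub>A\<^esub> G n}),
     one = undefined,
     zero = null_equiv A N `` {\<lambda>n. \<zero>\<^bsub>A\<^esub>},
     add = (\<lambda>X Y. \<Union>F\<in>X. \<Union>G\<in>Y. null_equiv A N `` {\<lambda>n. F n \<oplus>\<^bsub>A\<^esub> G n}),
     smult = (\<lambda>c X. \<Union>F\<in>X. null_equiv A N `` {\<lambda>n. c \<odot>\<^bsub>A\<^esub> F n}),
     star = (\<lambda>X. \<Union>F\<in>X. null_equiv A N `` {\<lambda>n. star A (F n)})\<rparr>"

section \<open>The full and the reduced C*-algebra of an inverse semigroup\<close>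

definition supp :: "('s \<Rightarrow> complex) \<Rightarrow> 's set" where
  "supp f = {s. f s \<noteq> 0}"

text \<open>
  The formal sum of the \<open>f s\<close> times \<open>s\<close> is represented by its coefficient function \<open>f\<close>.  A zero
  element of the semigroup is a basis element like any other.
\<close>

definition semigroup_algebra :: "'s inv_semigroup \<Rightarrow> ('s \<Rightarrow> complex) star_algebra" where
  "semigroup_algebra S = \<lparr>carrier = {f. finite (supp f) \<and> supp f \<subseteq> carrier S},
     mult = (\<lambda>f g u. \<Sum>(s, t)\<in>{(s, t). s \<in> supp f \<and> t \<in> supp g \<and> sprod S s t = u}. f s * g t),
     one = undefined,
     zero = (\<lambda>s. 0),
     add = (\<lambda>f g s. f s + g s),
     smult = (\<lambda>c f s. c * f s),
     star = (\<lambda>f u. \<Sum>s\<in>{s \<in> supp f. sadj S s = u}. cnj (f s))\<rparr>"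

definition representation ::
    "'s inv_semigroup \<Rightarrow> 'h hilbert \<Rightarrow> ('s \<Rightarrow> 'h \<Rightarrow> 'h) \<Rightarrow> bool" where
  "representation S H \<pi> \<longleftrightarrow> hilbert_space H \<and>
     (\<forall>s\<in>carrier S. partial_isometry H (\<pi> s)) \<and>
     (\<forall>s\<in>carrier S. \<forall>t\<in>carrier S. \<pi> (sprod S s t) = compose (carrier H) (\<pi> s) (\<pi> t)) \<and>
     (\<forall>s\<in>carrier S. is_adjoint H (\<pi> s) (\<pi> (sadj S s)))"

definition extend_rep ::
    "'h hilbert \<Rightarrow> ('s \<Rightarrow> 'h \<Rightarrow> 'h) \<Rightarrow> ('s \<Rightarrow> complex) \<Rightarrow> 'h \<Rightarrow> 'h" where
  "extend_rep H \<pi> f = (\<lambda>x\<in>carrier H. \<Oplus>\<^bsub>H\<^esub>s\<in>supp f. f s \<odot>\<^bsub>H\<^esub> \<pi> s x)"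

text \<open>
  HOL has no quantifier over all types, so the Hilbert spaces in the supremum are those carried by
  a subset of the type \<open>('s \<Rightarrow> complex) + 'h\<close>, where \<open>'h\<close> is an arbitrary type.  The left summand
  makes room for the square summable functions on the semigroup whatever \<open>'h\<close> is; a statement
  that is polymorphic in \<open>'h\<close> takes every Hilbert space into account.  The supremum is over a
  set that is bounded by the sum of the \<open>cmod (f s)\<close>.
\<close>

definition full_norm :: "'h itself \<Rightarrow> 's inv_semigroup \<Rightarrow> ('s \<Rightarrow> complex) \<Rightarrow> real" where
  "full_norm (_ :: 'h itself) S f =
     Sup {op_norm H (extend_rep H \<pi> f) |(H :: (('s \<Rightarrow> complex) + 'h) hilbert) \<pi>.
       representation S H \<pi>}"

definition full_algebra ::
    "'h itself \<Rightarrow> 's inv_semigroup \<Rightarrow> (nat \<Rightarrow> 's \<Rightarrow> complex) set star_algebra" where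
  "full_algebra u S = completion (semigroup_algebra S) (full_norm u S)"

definition ell2 :: "'s set \<Rightarrow> ('s \<Rightarrow> complex) hilbert" where
  "ell2 B = \<lparr>carrier = {x. (\<forall>s. s \<notin> B \<longrightarrow> x s = 0) \<and> (\<lambda>s. (cmod (x s))\<^sup>2) summable_on B},
     mult = undefined,
     one = undefined,
     zero = (\<lambda>s. 0),
     add = (\<lambda>x y s. x s + y s),
     smult = (\<lambda>c x s. c * x s),
     ip = (\<lambda>x y. \<Sum>\<^sub>\<infinity>s\<in>B. x s * cnj (y s))\<rparr>"

definition \<delta> :: "'s \<Rightarrow> 's \<Rightarrow> complex" where
  "\<delta> b = (\<lambda>c. if c = b then 1 else 0)"

definition regular_on_basis :: "'s inv_semigroup \<Rightarrow> 's \<Rightarrow> 's \<Rightarrow> 's \<Rightarrow> complex" where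
  "regular_on_basis S a b =
     (if sprod S (sprod S (sadj S a) a) b = b then \<delta> (sprod S a b) else (\<lambda>c. 0))"

text \<open>
  The linear extension to square summable \<open>x\<close>, the sum over \<open>b\<close> of the \<open>x b\<close> times \<open>\<delta> b\<close>.  The
  sum below has at most one nonzero term for each \<open>c\<close>, since \<open>a\<close> acts injectively on the \<open>b\<close>
  with \<open>a\<^sup>*ab = b\<close>.
\<close>

definition regular_rep :: "'s inv_semigroup \<Rightarrow> 's \<Rightarrow> ('s \<Rightarrow> complex) \<Rightarrow> ('s \<Rightarrow> complex)" where
  "regular_rep S a =
     (\<lambda>x\<in>carrier (ell2 (carrier S)). \<lambda>c. \<Sum>\<^sub>\<infinity>b\<in>carrier S. x b * regular_on_basis S a b c)"

lemma delta_in_ell2: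
  assumes "b \<in> B"
  shows "\<delta> b \<in> carrier (ell2 B)"
proof -
  have "(\<lambda>s. (cmod (\<delta> b s))\<^sup>2) summable_on {b}"
    by (rule summable_on_finite) simp
  then have "(\<lambda>s. (cmod (\<delta> b s))\<^sup>2) summable_on B"
    by (rule summable_on_cong_neutral[THEN iffD1, rotated -1])
      (use assms in \<open>auto simp: \<delta>_def\<close>)
  then show ?thesis
    using assms by (auto simp: ell2_def \<delta>_def)
qed

lemma regular_rep_delta:
  assumes "b \<in> carrier S"
  shows "regular_rep S a (\<delta> b) = regular_on_basis S a b"
proof
  fix c
  have "(\<Sum>\<^sub>\<infinity>d\<in>carrier S. \<delta> b d * regular_on_basis S a d c)
      = (\<Sum>\<^sub>\<infinity>d\<in>{b}. \<delta> b d * regular_on_basis S a d c)"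
    by (rule infsum_cong_neutral) (use assms in \<open>auto simp: \<delta>_def\<close>)
  then show "regular_rep S a (\<delta> b) c = regular_on_basis S a b c"
    using delta_in_ell2[OF assms] by (simp add: regular_rep_def \<delta>_def)
qed

text \<open>
  The extension of the regular representation to the completion: the class of a Cauchy sequence is
  sent to the limit in operator norm.
\<close>

definition regular_hom ::
    "'s inv_semigroup \<Rightarrow> (nat \<Rightarrow> 's \<Rightarrow> complex) set \<Rightarrow> ('s \<Rightarrow> complex) \<Rightarrow> ('s \<Rightarrow> complex)" where
  "regular_hom S X = (let H = ell2 (carrier S) in
     THE T. T \<in> bounded_ops H \<and>
       (\<forall>F\<in>X. (\<lambda>n. op_norm H (\<lambda>x. extend_rep H (regular_rep S) (F n) x \<ominus>\<^bsub>H\<^esub> T x)) \<longlonglongrightarrow> 0))"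

definition reduced_algebra ::
    "'h itself \<Rightarrow> 's inv_semigroup \<Rightarrow> (('s \<Rightarrow> complex) \<Rightarrow> ('s \<Rightarrow> complex)) star_algebra" where
  "reduced_algebra u S =
     (op_algebra (ell2 (carrier S)))\<lparr>carrier := regular_hom S ` carrier (full_algebra u S)\<rparr>"

definition weak_containment :: "'h itself \<Rightarrow> 's inv_semigroup \<Rightarrow> bool" where
  "weak_containment u S \<longleftrightarrow> inverse_semigroup S \<and>
     star_isomorphism (regular_hom S) (full_algebra u S) (reduced_algebra u S)"

section \<open>The graph inverse semigroup\<close>

text \<open>
  The path \<open>\<mu>\<^sub>n\<dots>\<mu>\<^sub>1\<close> is the pair of the list \<open>[\<mu>\<^sub>n, \<dots>, \<mu>\<^sub>1]\<close> and its source; a vertex \<open>v\<close> is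
  \<open>([], v)\<close>.  Walks in the graph library list their arcs in the order of traversal, hence \<open>rev\<close>.
  The source of an arc is its \<open>tail\<close> and its range is its \<open>head\<close>.
\<close>

type_synonym ('v, 'e) gpath = "'e list \<times> 'v"

definition src :: "('v, 'e) gpath \<Rightarrow> 'v" where
  "src \<mu> = snd \<mu>"

definition rng :: "('v, 'e) pre_digraph \<Rightarrow> ('v, 'e) gpath \<Rightarrow> 'v" where
  "rng G \<mu> = pre_digraph.awlast G (src \<mu>) (rev (fst \<mu>))"

definition paths :: "('v, 'e) pre_digraph \<Rightarrow> ('v, 'e) gpath set" where
  "paths G = {\<mu>. pre_digraph.awalk G (src \<mu>) (rev (fst \<mu>)) (rng G \<mu>)}"

definition concat_path :: "('v, 'e) gpath \<Rightarrow> ('v, 'e) gpath \<Rightarrow> ('v, 'e) gpath" where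
  "concat_path \<mu> \<nu> = (fst \<mu> @ fst \<nu>, src \<nu>)"

definition factors :: "('v, 'e) pre_digraph \<Rightarrow>
    ('v, 'e) gpath \<Rightarrow> ('v, 'e) gpath \<Rightarrow> ('v, 'e) gpath \<Rightarrow> bool" where
  "factors G \<nu> \<alpha> \<nu>' \<longleftrightarrow> \<nu>' \<in> paths G \<and> src \<alpha> = rng G \<nu>' \<and> \<nu> = concat_path \<alpha> \<nu>'"

datatype ('v, 'e) graph_elem = Zero | Elem "('v, 'e) gpath" "('v, 'e) gpath"

fun graph_prod :: "('v, 'e) pre_digraph \<Rightarrow>
    ('v, 'e) graph_elem \<Rightarrow> ('v, 'e) graph_elem \<Rightarrow> ('v, 'e) graph_elem" where
  "graph_prod G (Elem \<mu> \<nu>) (Elem \<alpha> \<beta>) =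
     (if \<exists>\<nu>'. factors G \<nu> \<alpha> \<nu>' then Elem \<mu> (concat_path \<beta> (THE \<nu>'. factors G \<nu> \<alpha> \<nu>'))
      else if \<exists>\<alpha>'. factors G \<alpha> \<nu> \<alpha>' then Elem (concat_path \<mu> (THE \<alpha>'. factors G \<alpha> \<nu> \<alpha>')) \<beta>
      else Zero)"
| "graph_prod G Zero y = Zero"
| "graph_prod G x Zero = Zero"

fun graph_adj :: "('v, 'e) graph_elem \<Rightarrow> ('v, 'e) graph_elem" where
  "graph_adj (Elem \<mu> \<nu>) = Elem \<nu> \<mu>"
| "graph_adj Zero = Zero"

definition graph_inverse_semigroup ::
    "('v, 'e) pre_digraph \<Rightarrow> ('v, 'e) graph_elem inv_semigroup" where
  "graph_inverse_semigroup G =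
     \<lparr>carrier = {Elem \<mu> \<nu> |\<mu> \<nu>. \<mu> \<in> paths G \<and> \<nu> \<in> paths G \<and> src \<mu> = src \<nu>} \<union> {Zero},
      sprod = graph_prod G,
      sadj = graph_adj\<rparr>"

end

theory Submission
  imports Defs
begin

text \<open>
  Let \<open>\<Lambda>\<close> be the regular representation.  Weak containment amounts to \<open>\<parallel>\<pi>(f)x\<parallel> \<le> \<parallel>\<Lambda>(f)\<parallel> \<parallel>x\<parallel>\<close> for
  every representation \<open>\<pi>\<close>, every \<open>f\<close> in the semigroup algebra and every vector \<open>x\<close>.  On the range
  of \<open>\<pi>(0)\<close> the representation is trivial, hence contained in \<open>\<Lambda>\<close>, so let \<open>\<pi>(0)x = 0\<close> and
  \<open>\<phi>(s) = \<langle>\<pi>(s)x, x\<rangle>\<close>.  For a finite set \<open>F\<close> of edges, \<open>k\<^sub>0(\<mu>, \<nu>) = \<phi>(\<nu>, \<mu>)\<close> and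
  \<open>k\<^sub>1(\<mu>, \<nu>) = \<phi>(\<nu>, \<mu>) - (\<Sum>e\<in>F. \<phi>(\<nu>e, \<mu>e))\<close> are positive semidefinite kernels on paths, the
  second one by Bessel's inequality for the orthogonal range projections of the edges.  In the
  Fejer kernel \<open>(k\<^sub>0 + (N - 1 - max \<bar>\<mu>\<bar> \<bar>\<nu>\<bar>) k\<^sub>1) / N\<close>, restricted to paths in \<open>F\<close> of length less than
  \<open>N\<close>, the sum over all pairs \<open>(\<beta>\<gamma>, \<alpha>\<gamma>)\<close> telescopes to \<open>(1 - max \<bar>\<alpha>\<bar> \<bar>\<beta>\<bar> / N) \<phi>(\<alpha>, \<beta>)\<close>.  A Cholesky
  decomposition of this kernel therefore writes a function that tends to \<open>\<phi>\<close> pointwise as a sum of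
  vector functionals of \<open>\<Lambda>\<close> of total mass at most \<open>\<parallel>x\<parallel>\<^sup>2\<close>.  Evaluating at \<open>f\<^sup>*f\<close> and letting \<open>N\<close>
  tend to infinity gives the inequality.
\<close>

text \<open>On path vectors, a coefficient of \<Lambda> is a sum over all common extensions
  (\<beta>\<gamma>, \<alpha>\<gamma>), so one needs a positive kernel whose sum over extensions
  returns \<phi>(\<alpha>, \<beta>). Let \<open>\<sigma> l\<close> be the sum of \<phi> over the
  extensions by paths \<gamma> of length l. Then k1 contributes
  \<open>\<sigma> l - \<sigma> (Suc l)\<close> at length l, and k1 cut off below length L leaves
  \<open>\<sigma> 0 - \<sigma> L\<close>. The boundary term need not be small: for a single loop
  represented by a unitary, k1 vanishes identically. But one copy of k0 cut off below N supplies
  every \<open>\<sigma> L\<close> with L < N once, so together with the copies of k1 cut off at 1,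
  ..., N - 1 the total is N times \<open>\<sigma> 0\<close>. Division by N gives the kernel; the
  averaging over cut-offs is that of the Fejer kernel on the circle. Bessel's inequality holds for
  any finite set of orthogonal projections, so F may be a finite part of the edges even at a vertex
  that receives infinitely many. It consists of the edges that occur in the products t*s of support
  elements of f.\<close>

section \<open>Hilbert spaces\<close>

context hilbert_space
begin

lemma scale_closed [simp, intro]: "x \<in> carrier H \<Longrightarrow> c \<odot> x \<in> carrier H"
  using smult_closed[of c x] by (simp add: complex_ring_def)

lemma scale_scale: "x \<in> carrier H \<Longrightarrow> a \<odot> (b \<odot> x) = (a * b) \<odot> x"
  using smult_assoc1[of a b x] by (simp add: complex_ring_def)

lemma scale_one [simp]: "x \<in> carrier H \<Longrightarrow> 1 \<odot> x = x"
  using smult_one[of x] by (simp add: complex_ring_def)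

lemma scale_add_left: "x \<in> carrier H \<Longrightarrow> (a + b) \<odot> x = a \<odot> x \<oplus> b \<odot> x"
  using smult_l_distr[of a b x] by (simp add: complex_ring_def)

lemma scale_add_right: "x \<in> carrier H \<Longrightarrow> y \<in> carrier H \<Longrightarrow> c \<odot> (x \<oplus> y) = c \<odot> x \<oplus> c \<odot> y"
  using smult_r_distr[of c x y] by (simp add: complex_ring_def)

lemma scale_zero_left [simp]: "x \<in> carrier H \<Longrightarrow> 0 \<odot> x = \<zero>"
  using smult_l_null[of x] by (simp add: complex_ring_def)

lemma scale_zero_right [simp]: "c \<odot> \<zero> = \<zero>"
  using smult_r_null[of c] by (simp add: complex_ring_def)

lemma minus_eq_scale: "x \<in> carrier H \<Longrightarrow> \<ominus> x = (-1) \<odot> x"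
  using scale_add_left[of x 1 "-1"] by (intro M.minus_equality) (auto simp: M.a_comm)

lemma diff_eq: "x \<in> carrier H \<Longrightarrow> y \<in> carrier H \<Longrightarrow> x \<ominus> y = x \<oplus> (-1) \<odot> y"
  by (simp add: M.minus_eq minus_eq_scale)

lemma diff_closed [simp, intro]: "x \<in> carrier H \<Longrightarrow> y \<in> carrier H \<Longrightarrow> x \<ominus> y \<in> carrier H"
  by (rule M.minus_closed)

lemma ip_add_right:
  "x \<in> carrier H \<Longrightarrow> y \<in> carrier H \<Longrightarrow> z \<in> carrier H \<Longrightarrow> ip H z (x \<oplus> y) = ip H z x + ip H z y"
  by (metis M.a_closed complex_cnj_add ip_add ip_commute)

lemma ip_scale_right: "x \<in> carrier H \<Longrightarrow> z \<in> carrier H \<Longrightarrow> ip H z (c \<odot> x) = cnj c * ip H z x"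
  by (metis complex_cnj_mult ip_scale ip_commute scale_closed)

lemma ip_zero [simp]: "z \<in> carrier H \<Longrightarrow> ip H \<zero> z = 0" "z \<in> carrier H \<Longrightarrow> ip H z \<zero> = 0"
  using ip_scale[of \<zero> z 0] ip_scale_right[of \<zero> z 0] by simp_all

lemma ip_diff_left:
  "x \<in> carrier H \<Longrightarrow> y \<in> carrier H \<Longrightarrow> z \<in> carrier H \<Longrightarrow> ip H (x \<ominus> y) z = ip H x z - ip H y z"
  by (simp add: diff_eq ip_add ip_scale)

lemma ip_diff_right:
  "x \<in> carrier H \<Longrightarrow> y \<in> carrier H \<Longrightarrow> z \<in> carrier H \<Longrightarrow> ip H z (x \<ominus> y) = ip H z x - ip H z y"
  by (simp add: diff_eq ip_add_right ip_scale_right)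

lemmas ip_simps = ip_add ip_add_right ip_scale ip_scale_right ip_diff_left ip_diff_right

lemma ip_self: "x \<in> carrier H \<Longrightarrow> ip H x x = complex_of_real ((hnorm H x)\<^sup>2)"
  using ip_commute[of x x] ip_nonneg[of x] by (simp add: hnorm_def complex_eq_iff)

lemma hnorm_nonneg [simp]: "x \<in> carrier H \<Longrightarrow> 0 \<le> hnorm H x"
  by (simp add: hnorm_def ip_nonneg)

lemma hnorm_zero [simp]: "hnorm H \<zero> = 0"
  by (simp add: hnorm_def)

lemma hnorm_eq_zero: "x \<in> carrier H \<Longrightarrow> hnorm H x = 0 \<Longrightarrow> x = \<zero>"
  using ip_self[of x] ip_definite by simp

lemma hnorm_sq: "x \<in> carrier H \<Longrightarrow> (hnorm H x)\<^sup>2 = Re (ip H x x)"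
  by (simp add: ip_self)

lemma hnorm_scale: "x \<in> carrier H \<Longrightarrow> hnorm H (c \<odot> x) = cmod c * hnorm H x"
proof -
  assume x: "x \<in> carrier H"
  have "ip H (c \<odot> x) (c \<odot> x) = (c * cnj c) * ip H x x"
    using x by (simp add: ip_simps)
  also have "\<dots> = complex_of_real ((cmod c)\<^sup>2 * (hnorm H x)\<^sup>2)"
    using x by (simp add: ip_self complex_mult_cnj cmod_power2)
  finally have "(hnorm H (c \<odot> x))\<^sup>2 = (cmod c * hnorm H x)\<^sup>2"
    using x by (simp add: hnorm_sq power_mult_distrib flip: of_real_power)
  then show ?thesis
    using x by (simp add: power2_eq_iff_nonneg)
qed

lemma hnorm_diff_commute: "x \<in> carrier H \<Longrightarrow> y \<in> carrier H \<Longrightarrow> hnorm H (x \<ominus> y) = hnorm H (y \<ominus> x)"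
  by (simp add: hnorm_def ip_simps algebra_simps)

lemma cauchy_schwarz:
  assumes "x \<in> carrier H" "y \<in> carrier H"
  shows "cmod (ip H x y) \<le> hnorm H x * hnorm H y"
proof (cases "hnorm H y = 0")
  case True
  then have "y = \<zero>" using assms hnorm_eq_zero by blast
  then show ?thesis using assms by simp
next
  case False
  \<comment> \<open>With this c the vector x - cy is orthogonal to y; its squared norm gives the
    inequality.\<close>
  define c where "c = ip H x y / ip H y y"
  have yy: "ip H y y \<noteq> 0" using False assms by (simp add: ip_self)
  have "ip H (x \<ominus> c \<odot> y) (x \<ominus> c \<odot> y)
      = ip H x x - cnj c * ip H x y - c * (ip H y x - cnj c * ip H y y)"
    using assms by (simp add: ip_simps algebra_simps)
  also have "cnj c * ip H y y = ip H y x"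
    using assms yy by (simp add: c_def ip_commute[of x y] ip_self[OF assms(2)])
  also have "cnj c * ip H x y = complex_of_real ((cmod (ip H x y))\<^sup>2 / (hnorm H y)\<^sup>2)"
    using assms by (simp add: c_def ip_self complex_norm_square del: of_real_power)
  finally have "0 \<le> (hnorm H x)\<^sup>2 - (cmod (ip H x y))\<^sup>2 / (hnorm H y)\<^sup>2"
    using assms ip_nonneg[of "x \<ominus> c \<odot> y"] by (simp add: ip_self flip: of_real_power)
  then have "(cmod (ip H x y))\<^sup>2 \<le> (hnorm H x * hnorm H y)\<^sup>2"
    using False assms by (simp add: field_simps power_mult_distrib)
  then show ?thesis
    using assms by (auto intro: power2_le_imp_le[of _ "hnorm H x * hnorm H y"])
qed

lemma hnorm_triangle:
  assumes "x \<in> carrier H" "y \<in> carrier H"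
  shows "hnorm H (x \<oplus> y) \<le> hnorm H x + hnorm H y"
proof -
  have "(hnorm H (x \<oplus> y))\<^sup>2 = (hnorm H x)\<^sup>2 + (hnorm H y)\<^sup>2 + Re (ip H x y) + Re (ip H y x)"
    using assms by (simp add: hnorm_sq ip_simps)
  also have "Re (ip H y x) = Re (ip H x y)"
    by (subst ip_commute[OF assms]) simp
  also have "Re (ip H x y) \<le> hnorm H x * hnorm H y"
    using cauchy_schwarz[OF assms] complex_Re_le_cmod order_trans by blast
  finally have "(hnorm H (x \<oplus> y))\<^sup>2 \<le> (hnorm H x + hnorm H y)\<^sup>2"
    by (simp add: power2_eq_square algebra_simps)
  then show ?thesis
    using assms by (auto intro: power2_le_imp_le[of _ "hnorm H x + hnorm H y"])
qed

lemma diff_add_diff: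
  assumes "x \<in> carrier H" "y \<in> carrier H" "z \<in> carrier H"
  shows "x \<ominus> z = (x \<ominus> y) \<oplus> (y \<ominus> z)"
  using assms by (simp add: M.minus_eq M.a_assoc M.r_neg1)

lemma hnorm_triangle_diff:
  assumes "x \<in> carrier H" "y \<in> carrier H" "z \<in> carrier H"
  shows "hnorm H (x \<ominus> z) \<le> hnorm H (x \<ominus> y) + hnorm H (y \<ominus> z)"
  using assms diff_add_diff[OF assms] hnorm_triangle[of "x \<ominus> y" "y \<ominus> z"] by simp

lemma diff_add_cancel: "x \<in> carrier H \<Longrightarrow> y \<in> carrier H \<Longrightarrow> (x \<ominus> y) \<oplus> y = x"
  by (simp add: M.minus_eq M.a_assoc M.l_neg)

lemma hnorm_le_diff:
  assumes "x \<in> carrier H" "y \<in> carrier H"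
  shows "hnorm H x \<le> hnorm H (x \<ominus> y) + hnorm H y"
  using hnorm_triangle[of "x \<ominus> y" y] assms by (simp add: diff_add_cancel)

lemma hnorm_diff_eq_zero:
  "x \<in> carrier H \<Longrightarrow> y \<in> carrier H \<Longrightarrow> hnorm H (x \<ominus> y) = 0 \<Longrightarrow> x = y"
  using hnorm_eq_zero[of "x \<ominus> y"] diff_add_cancel[of x y] by simp

lemma diff_self [simp]: "x \<in> carrier H \<Longrightarrow> x \<ominus> x = \<zero>"
  by (simp add: M.minus_eq M.r_neg)

lemma ip_eqI:
  assumes "x \<in> carrier H" "y \<in> carrier H" "\<And>z. z \<in> carrier H \<Longrightarrow> ip H x z = ip H y z"
  shows "x = y"
proof -
  have "ip H (x \<ominus> y) (x \<ominus> y) = 0"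
    using assms by (simp add: ip_diff_left)
  then show ?thesis
    using assms ip_self[of "x \<ominus> y"] hnorm_diff_eq_zero by simp
qed

lemma ip_finsum_left:
  assumes "finite A" "w \<in> A \<rightarrow> carrier H" "z \<in> carrier H"
  shows "ip H (\<Oplus>i\<in>A. c i \<odot> w i) z = (\<Sum>i\<in>A. c i * ip H (w i) z)"
  using assms
proof (induction A rule: finite_induct)
  case (insert a A)
  then have "(\<Oplus>i\<in>insert a A. c i \<odot> w i) = c a \<odot> w a \<oplus> (\<Oplus>i\<in>A. c i \<odot> w i)"
    by (intro M.finsum_insert) auto
  moreover have "(\<Oplus>i\<in>A. c i \<odot> w i) \<in> carrier H"
    using insert by (intro M.finsum_closed) auto
  ultimately show ?case
    using insert by (simp add: ip_simps Pi_def)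
qed simp

lemma ip_finsum_right:
  assumes "finite A" "w \<in> A \<rightarrow> carrier H" "z \<in> carrier H"
  shows "ip H z (\<Oplus>i\<in>A. c i \<odot> w i) = (\<Sum>i\<in>A. cnj (c i) * ip H z (w i))"
proof -
  have "(\<Oplus>i\<in>A. c i \<odot> w i) \<in> carrier H"
    using assms by (intro M.finsum_closed) auto
  then show ?thesis
    using assms ip_finsum_left[OF assms] ip_commute[of "(\<Oplus>i\<in>A. c i \<odot> w i)" z]
    by (auto simp: Pi_def ip_commute[of _ z] intro!: sum.cong)
qed

lemma ip_finsum:
  assumes "finite A" "w \<in> A \<rightarrow> carrier H"
  shows "ip H (\<Oplus>i\<in>A. c i \<odot> w i) (\<Oplus>i\<in>A. c i \<odot> w i)
    = (\<Sum>i\<in>A. \<Sum>j\<in>A. c i * cnj (c j) * ip H (w i) (w j))"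
proof -
  have "(\<Oplus>i\<in>A. c i \<odot> w i) \<in> carrier H"
    using assms by (intro M.finsum_closed) auto
  then show ?thesis
    using assms by (simp add: ip_finsum_left ip_finsum_right Pi_def sum_distrib_left mult.assoc
        mult.left_commute[of "cnj _"] cong: sum.cong) (subst sum.swap, simp add: mult.left_commute)
qed

end

section \<open>Bounded operators\<close>

context hilbert_space
begin

lemma bounded_opsI:
  assumes "\<And>x. x \<in> carrier H \<Longrightarrow> T x \<in> carrier H"
    and "\<And>x y. x \<in> carrier H \<Longrightarrow> y \<in> carrier H \<Longrightarrow> T (x \<oplus> y) = T x \<oplus> T y"
    and "\<And>c x. x \<in> carrier H \<Longrightarrow> T (c \<odot> x) = c \<odot> T x"
    and "\<And>x. x \<in> carrier H \<Longrightarrow> hnorm H (T x) \<le> K * hnorm H x"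
    and "T \<in> extensional (carrier H)"
  shows "T \<in> bounded_ops H"
proof -
  have "\<exists>K. \<forall>x\<in>carrier H. hnorm H (T x) \<le> K * hnorm H x"
    using assms(4) by blast
  then show ?thesis
    using assms(1-3,5) unfolding bounded_ops_def by (auto simp: PiE_def)
qed

lemma
  assumes "T \<in> bounded_ops H"
  shows op_closed: "x \<in> carrier H \<Longrightarrow> T x \<in> carrier H"
    and op_add: "x \<in> carrier H \<Longrightarrow> y \<in> carrier H \<Longrightarrow> T (x \<oplus> y) = T x \<oplus> T y"
    and op_scale: "x \<in> carrier H \<Longrightarrow> T (c \<odot> x) = c \<odot> T x"
    and op_extensional: "T \<in> extensional (carrier H)"
    and op_bounded: "\<exists>K. \<forall>x\<in>carrier H. hnorm H (T x) \<le> K * hnorm H x"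
  using assms unfolding bounded_ops_def by (auto simp: PiE_def)

lemma op_zero: "T \<in> bounded_ops H \<Longrightarrow> T \<zero> = \<zero>"
  using op_scale[of T "\<zero>" 0] op_closed[of T "\<zero>"] by simp

lemma op_diff:
  "T \<in> bounded_ops H \<Longrightarrow> x \<in> carrier H \<Longrightarrow> y \<in> carrier H \<Longrightarrow> T (x \<ominus> y) = T x \<ominus> T y"
  by (simp add: diff_eq op_add op_scale op_closed)

lemma op_finsum:
  assumes T: "T \<in> bounded_ops H" and "finite A" "w \<in> A \<rightarrow> carrier H"
  shows "T (\<Oplus>i\<in>A. c i \<odot> w i) = (\<Oplus>i\<in>A. c i \<odot> T (w i))"
  using assms(2,3)
proof (induction A rule: finite_induct)
  case empty
  then show ?case using op_zero[OF T] by simp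
next
  case (insert a A)
  have "(\<Oplus>i\<in>insert a A. c i \<odot> w i) = c a \<odot> w a \<oplus> (\<Oplus>i\<in>A. c i \<odot> w i)"
    using insert by (intro M.finsum_insert) auto
  moreover have "(\<Oplus>i\<in>insert a A. c i \<odot> T (w i)) = c a \<odot> T (w a) \<oplus> (\<Oplus>i\<in>A. c i \<odot> T (w i))"
    using insert by (intro M.finsum_insert) (auto intro!: op_closed[OF T])
  moreover have "(\<Oplus>i\<in>A. c i \<odot> w i) \<in> carrier H"
    using insert by (intro M.finsum_closed) auto
  ultimately show ?case
    using insert by (simp add: op_add[OF T] op_scale[OF T] Pi_def)
qed

abbreviation op_dist :: "('h \<Rightarrow> 'h) \<Rightarrow> ('h \<Rightarrow> 'h) \<Rightarrow> real" where
  "op_dist T U \<equiv> op_norm H (\<lambda>x. T x \<ominus> U x)"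

text \<open>The difference inside \<open>op_dist\<close> need not be extensional, so it may lie
  outside \<open>bounded_ops H\<close>. The norm reads values on the carrier only, which lets that
  difference be traded for the restricted one.\<close>

lemma op_norm_cong: "(\<And>x. x \<in> carrier H \<Longrightarrow> T x = U x) \<Longrightarrow> op_norm H T = op_norm H U"
  unfolding op_norm_def by (intro arg_cong[of _ _ Sup]) force

lemma op_norm_bdd_above:
  assumes "\<And>x. x \<in> carrier H \<Longrightarrow> hnorm H (T x) \<le> K * hnorm H x"
  shows "bdd_above {hnorm H (T x) |x. x \<in> carrier H \<and> hnorm H x \<le> 1}"
proof (rule bdd_aboveI)
  fix r assume "r \<in> {hnorm H (T x) |x. x \<in> carrier H \<and> hnorm H x \<le> 1}"
  then obtain x where x: "x \<in> carrier H" "hnorm H x \<le> 1" "r = hnorm H (T x)" by blast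
  have "K * hnorm H x \<le> \<bar>K\<bar> * 1"
    using x by (intro mult_mono) auto
  then show "r \<le> \<bar>K\<bar>" using x assms[of x] by simp
qed

lemma op_norm_le:
  assumes "0 \<le> K" "\<And>x. x \<in> carrier H \<Longrightarrow> hnorm H (T x) \<le> K * hnorm H x"
  shows "op_norm H T \<le> K"
  unfolding op_norm_def
proof (rule cSup_least)
  show "{hnorm H (T x) |x. x \<in> carrier H \<and> hnorm H x \<le> 1} \<noteq> {}"
    using M.zero_closed by force
  fix r assume "r \<in> {hnorm H (T x) |x. x \<in> carrier H \<and> hnorm H x \<le> 1}"
  then obtain x where x: "x \<in> carrier H" "hnorm H x \<le> 1" "r = hnorm H (T x)" by blast
  have "K * hnorm H x \<le> K * 1"
    using x assms by (intro mult_mono) auto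
  then show "r \<le> K" using x assms(2)[of x] by simp
qed

lemma op_norm_nonneg: 
  assumes "T \<in> bounded_ops H"
  shows "0 \<le> op_norm H T"
proof -
  obtain K where "\<And>x. x \<in> carrier H \<Longrightarrow> hnorm H (T x) \<le> K * hnorm H x"
    using op_bounded[OF assms] by blast
  then have "hnorm H (T \<zero>) \<le> op_norm H T"
    unfolding op_norm_def using M.zero_closed
    by (intro cSup_upper op_norm_bdd_above[where K = K]) auto
  then show ?thesis using op_zero[OF assms] by simp
qed

lemma hnorm_op_le:
  assumes T: "T \<in> bounded_ops H" and x: "x \<in> carrier H"
  shows "hnorm H (T x) \<le> op_norm H T * hnorm H x"
proof (cases "hnorm H x = 0")
  case True
  then show ?thesis using hnorm_eq_zero[OF x] op_zero[OF T] by simp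
next
  case False
  obtain K where K: "\<And>x. x \<in> carrier H \<Longrightarrow> hnorm H (T x) \<le> K * hnorm H x"
    using op_bounded[OF T] by blast
  define y where "y = complex_of_real (inverse (hnorm H x)) \<odot> x"
  have y: "y \<in> carrier H" "hnorm H y \<le> 1"
    using x False unfolding y_def by (auto simp: hnorm_scale simp del: of_real_inverse)
  have "hnorm H (T y) \<le> op_norm H T"
    unfolding op_norm_def using y K by (intro cSup_upper op_norm_bdd_above[where K = K]) auto
  moreover have "hnorm H (T y) = inverse (hnorm H x) * hnorm H (T x)"
    using x unfolding y_def by (simp add: op_scale[OF T] op_closed[OF T] hnorm_scale del: of_real_inverse)
  ultimately show ?thesis
    using False hnorm_nonneg[OF x] by (simp add: field_simps)
qed

lemma op_eqI:
  assumes "T \<in> bounded_ops H" "U \<in> bounded_ops H" "\<And>x. x \<in> carrier H \<Longrightarrow> T x = U x"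
  shows "T = U"
  using assms by (intro extensionalityI[of _ "carrier H"]) (auto intro: op_extensional)

lemma bounded_ops_add:
  assumes "T \<in> bounded_ops H" "U \<in> bounded_ops H"
  shows "(\<lambda>x\<in>carrier H. T x \<oplus> U x) \<in> bounded_ops H"
proof (rule bounded_opsI[where K = "op_norm H T + op_norm H U"])
  fix x assume x: "x \<in> carrier H"
  show "hnorm H ((\<lambda>x\<in>carrier H. T x \<oplus> U x) x) \<le> (op_norm H T + op_norm H U) * hnorm H x"
    using x assms hnorm_triangle[of "T x" "U x"] hnorm_op_le[of T x] hnorm_op_le[of U x]
    by (simp add: op_closed algebra_simps)
qed (use assms in \<open>auto simp: op_closed op_add op_scale scale_add_right M.a_ac\<close>)

lemma bounded_ops_scale:
  assumes "T \<in> bounded_ops H"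
  shows "(\<lambda>x\<in>carrier H. c \<odot> T x) \<in> bounded_ops H"
proof (rule bounded_opsI[where K = "cmod c * op_norm H T"])
  fix x assume x: "x \<in> carrier H"
  show "hnorm H ((\<lambda>x\<in>carrier H. c \<odot> T x) x) \<le> cmod c * op_norm H T * hnorm H x"
    using x assms hnorm_op_le[of T x] by (simp add: op_closed hnorm_scale mult.assoc mult_left_mono)
qed (use assms in \<open>auto simp: op_closed op_add op_scale scale_add_right scale_scale mult.commute\<close>)

lemma bounded_ops_diff:
  assumes "T \<in> bounded_ops H" "U \<in> bounded_ops H"
  shows "(\<lambda>x\<in>carrier H. T x \<ominus> U x) \<in> bounded_ops H"
proof -
  have "(\<lambda>x\<in>carrier H. T x \<ominus> U x) = (\<lambda>x\<in>carrier H. T x \<oplus> (\<lambda>x\<in>carrier H. (-1) \<odot> U x) x)"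
    using assms by (auto simp: op_closed diff_eq)
  then show ?thesis
    using bounded_ops_add[OF assms(1) bounded_ops_scale[OF assms(2), of "-1"]] by simp
qed

lemma bounded_ops_compose:
  assumes "T \<in> bounded_ops H" "U \<in> bounded_ops H"
  shows "compose (carrier H) T U \<in> bounded_ops H"
proof (rule bounded_opsI[where K = "op_norm H T * op_norm H U"])
  fix x assume x: "x \<in> carrier H"
  have "hnorm H (T (U x)) \<le> op_norm H T * hnorm H (U x)"
    using assms x by (simp add: hnorm_op_le op_closed)
  also have "\<dots> \<le> op_norm H T * (op_norm H U * hnorm H x)"
    using assms x by (intro mult_left_mono hnorm_op_le op_norm_nonneg)
  finally show "hnorm H (compose (carrier H) T U x) \<le> op_norm H T * op_norm H U * hnorm H x"
    using x by (simp add: compose_eq mult.assoc)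
qed (use assms in \<open>auto simp: op_closed op_add op_scale compose_eq\<close>)

lemma hnorm_diff_op_le:
  assumes "T \<in> bounded_ops H" "U \<in> bounded_ops H" "x \<in> carrier H"
  shows "hnorm H (T x \<ominus> U x) \<le> op_dist T U * hnorm H x"
  using hnorm_op_le[OF bounded_ops_diff[OF assms(1,2)] assms(3)] assms(3)
    op_norm_cong[of "\<lambda>x\<in>carrier H. T x \<ominus> U x" "\<lambda>x. T x \<ominus> U x"] by simp

lemma op_norm_diff_nonneg:
  assumes "T \<in> bounded_ops H" "U \<in> bounded_ops H"
  shows "0 \<le> op_dist T U"
  using op_norm_nonneg[OF bounded_ops_diff[OF assms]]
    op_norm_cong[of "\<lambda>x\<in>carrier H. T x \<ominus> U x" "\<lambda>x. T x \<ominus> U x"] by simp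

lemma op_norm_diff_commute:
  assumes "T \<in> bounded_ops H" "U \<in> bounded_ops H"
  shows "op_dist T U = op_dist U T"
proof -
  have "hnorm H (T x \<ominus> U x) = hnorm H (U x \<ominus> T x)" if "x \<in> carrier H" for x
    using assms that by (simp add: hnorm_diff_commute op_closed)
  then show ?thesis
    unfolding op_norm_def by (intro arg_cong[of _ _ Sup]) force
qed

lemma op_norm_triangle_diff:
  assumes "T \<in> bounded_ops H" "U \<in> bounded_ops H" "V \<in> bounded_ops H"
  shows "op_dist T V \<le> op_dist T U + op_dist U V"
proof (rule op_norm_le)
  fix x assume x: "x \<in> carrier H"
  have "hnorm H (T x \<ominus> V x) \<le> hnorm H (T x \<ominus> U x) + hnorm H (U x \<ominus> V x)"
    using assms x by (intro hnorm_triangle_diff) (auto simp: op_closed)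
  also have "\<dots> \<le> (op_dist T U + op_dist U V) * hnorm H x"
    using assms x hnorm_diff_op_le[of T U x] hnorm_diff_op_le[of U V x] by (simp add: algebra_simps)
  finally show "hnorm H (T x \<ominus> V x)
    \<le> (op_dist T U + op_dist U V) * hnorm H x" .
qed (use assms in \<open>simp add: op_norm_diff_nonneg\<close>)

lemma op_norm_diff_eq_zero:
  assumes "T \<in> bounded_ops H" "U \<in> bounded_ops H" "op_dist T U = 0"
  shows "T = U"
proof (rule op_eqI[OF assms(1,2)])
  fix x assume x: "x \<in> carrier H"
  then have "hnorm H (T x \<ominus> U x) \<le> 0"
    using hnorm_diff_op_le[OF assms(1,2) x] assms(3) by simp
  moreover have "0 \<le> hnorm H (T x \<ominus> U x)"
    using assms x by (intro hnorm_nonneg diff_closed) (auto intro: op_closed)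
  ultimately show "T x = U x"
    using assms x by (intro hnorm_diff_eq_zero) (auto intro: op_closed)
qed

section \<open>Adjoints and partial isometries\<close>

lemma adjoint_unique:
  assumes "is_adjoint H T U" "is_adjoint H T V" "U \<in> bounded_ops H" "V \<in> bounded_ops H"
    and T: "T \<in> bounded_ops H"
  shows "U = V"
proof (rule op_eqI[OF assms(3,4)])
  fix y assume y: "y \<in> carrier H"
  show "U y = V y"
  proof (rule ip_eqI)
    fix x assume x: "x \<in> carrier H"
    have "ip H x (U y) = ip H x (V y)"
      using assms(1,2) x y unfolding is_adjoint_def by metis
    then show "ip H (U y) x = ip H (V y) x"
      using assms x y ip_commute by (metis op_closed)
  qed (use assms y op_closed in auto)
qed

text \<open>From |Ux|^2 = <T(Ux), x> by division by |Ux|. It applies to a mere function U, such as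
  the difference of adjoints in \<open>op_norm_star_diff_le\<close>.\<close>

lemma hnorm_adjoint_le:
  assumes adj: "is_adjoint H T U" and T: "T \<in> bounded_ops H" and x: "x \<in> carrier H"
    and U: "\<And>x. x \<in> carrier H \<Longrightarrow> U x \<in> carrier H"
  shows "hnorm H (U x) \<le> op_norm H T * hnorm H x"
proof (cases "hnorm H (U x) = 0")
  case True
  then show ?thesis using op_norm_nonneg[OF T] x by simp
next
  case False
  have "(hnorm H (U x))\<^sup>2 = Re (ip H (U x) (U x))"
    using U x by (simp add: hnorm_sq)
  also have "\<dots> = Re (ip H (T (U x)) x)"
    using adj x U by (simp add: is_adjoint_def)
  also have "\<dots> \<le> hnorm H (T (U x)) * hnorm H x"
    using cauchy_schwarz[of "T (U x)" x] complex_Re_le_cmod order_trans x U op_closed[OF T] by blast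
  also have "\<dots> \<le> op_norm H T * hnorm H (U x) * hnorm H x"
    using x U by (intro mult_right_mono hnorm_op_le T) auto
  finally show ?thesis
    using False hnorm_nonneg[OF U[OF x]]
    by (simp add: power2_eq_square)
qed

text \<open>By T U T = T the vector x - U(Tx) lies in the kernel of T for every x. If x is
  orthogonal to the kernel, then <x, x> = <x, U(Tx)> = <Tx, Tx>.\<close>

lemma partial_isometryI:
  assumes T: "T \<in> bounded_ops H" and U: "U \<in> bounded_ops H" and adj: "is_adjoint H T U"
    and TUT: "\<And>x. x \<in> carrier H \<Longrightarrow> T (U (T x)) = T x"
  shows "partial_isometry H T"
  unfolding partial_isometry_def
proof (intro conjI ballI impI T)
  fix x assume x: "x \<in> carrier H" and orth: "\<forall>z\<in>carrier H. T z = \<zero> \<longrightarrow> ip H x z = 0"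
  have Tx: "T x \<in> carrier H" and UTx: "U (T x) \<in> carrier H"
    using T U x by (auto intro: op_closed)
  have "T (x \<ominus> U (T x)) = \<zero>"
    using x UTx Tx TUT[OF x] by (simp add: op_diff[OF T])
  then have "ip H x (x \<ominus> U (T x)) = 0"
    using orth x UTx by blast
  then have "ip H x x = ip H (T x) (T x)"
    using adj x UTx Tx by (simp add: ip_diff_right is_adjoint_def)
  then show "hnorm H (T x) = hnorm H x"
    by (simp add: hnorm_def)
qed

text \<open>The limit is taken pointwise. In \<open>near\<close> the index m stays fixed while n
  tends to infinity in the Cauchy estimate; this bounds the limit operator and upgrades pointwise to
  norm convergence.\<close>

lemma bounded_ops_complete:
  assumes T: "\<And>n. T n \<in> bounded_ops H"
    and cauchy: "\<forall>e>0. \<exists>M::nat. \<forall>m\<ge>M. \<forall>n\<ge>M. op_dist (T m) (T n) < e"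
  shows "\<exists>U\<in>bounded_ops H. (\<lambda>n. op_dist (T n) U) \<longlonglongrightarrow> 0"
proof -
  have cl: "T n x \<in> carrier H" if "x \<in> carrier H" for n x
    using T that op_closed by blast
  have "\<exists>l\<in>carrier H. (\<lambda>n. hnorm H (T n x \<ominus> l)) \<longlonglongrightarrow> 0" if x: "x \<in> carrier H" for x
  proof (rule complete[where X = "\<lambda>n. T n x"])
    show "T n x \<in> carrier H" for n using cl x by blast
    show "\<forall>e>0. \<exists>N. \<forall>m\<ge>N. \<forall>n\<ge>N. hnorm H (T m x \<ominus> T n x) < e"
    proof (intro allI impI)
      fix e :: real assume e: "e > 0"
      \<comment> \<open>The summand 1 keeps the divisor positive when x = 0.\<close>
      then obtain M where M: "\<And>m n. m \<ge> M \<Longrightarrow> n \<ge> M \<Longrightarrow>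
          op_dist (T m) (T n) < e / (hnorm H x + 1)"
        using cauchy[rule_format, of "e / (hnorm H x + 1)"] hnorm_nonneg[OF x] by (auto simp: field_simps)
      have "hnorm H (T m x \<ominus> T n x) < e" if "m \<ge> M" "n \<ge> M" for m n
      proof -
        have "hnorm H (T m x \<ominus> T n x) \<le> op_dist (T m) (T n) * hnorm H x"
          by (rule hnorm_diff_op_le[OF T T x])
        also have "\<dots> \<le> e / (hnorm H x + 1) * hnorm H x"
          using M[OF that] x by (intro mult_right_mono) auto
        also have "\<dots> < e"
          using e hnorm_nonneg[OF x] by (simp add: field_simps)
        finally show ?thesis .
      qed
      then show "\<exists>N. \<forall>m\<ge>N. \<forall>n\<ge>N. hnorm H (T m x \<ominus> T n x) < e" by blast
    qed
  qed
  then obtain V where V: "\<And>x. x \<in> carrier H \<Longrightarrow> V x \<in> carrier H"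
      "\<And>x. x \<in> carrier H \<Longrightarrow> (\<lambda>n. hnorm H (T n x \<ominus> V x)) \<longlonglongrightarrow> 0"
    by metis
  define U where "U = (\<lambda>x\<in>carrier H. V x)"
  have U: "U x \<in> carrier H" "(\<lambda>n. hnorm H (T n x \<ominus> U x)) \<longlonglongrightarrow> 0" if "x \<in> carrier H" for x
    using V that by (auto simp: U_def)
  \<comment> \<open>Linearity passes from the \<open>T n\<close> to U through uniqueness of
    limits.\<close>
  have unique: "l = m" if "l \<in> carrier H" "m \<in> carrier H" "\<And>n. X n \<in> carrier H"
    "(\<lambda>n. hnorm H (X n \<ominus> l)) \<longlonglongrightarrow> 0" "(\<lambda>n. hnorm H (X n \<ominus> m)) \<longlonglongrightarrow> 0" for l m X
  proof -
    have "hnorm H (l \<ominus> m) \<le> 0"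
    proof (rule LIMSEQ_le_const)
      show "(\<lambda>n. hnorm H (X n \<ominus> l) + hnorm H (X n \<ominus> m)) \<longlonglongrightarrow> 0"
        using tendsto_add[OF that(4,5)] by simp
      have "hnorm H (l \<ominus> m) \<le> hnorm H (X n \<ominus> l) + hnorm H (X n \<ominus> m)" for n
        using hnorm_triangle_diff[of l "X n" m] hnorm_diff_commute[of l "X n"] that by simp
      then show "\<exists>N. \<forall>n\<ge>N. hnorm H (l \<ominus> m) \<le> hnorm H (X n \<ominus> l) + hnorm H (X n \<ominus> m)"
        by blast
    qed
    then show ?thesis
      using that hnorm_nonneg[OF diff_closed[OF that(1,2)]] by (intro hnorm_diff_eq_zero) simp_all
  qed
  have near: "hnorm H (T m x \<ominus> U x) \<le> e * hnorm H x"
    if M: "\<And>n. n \<ge> M \<Longrightarrow> op_dist (T m) (T n) < e" and x: "x \<in> carrier H" for e m M x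
  proof (rule LIMSEQ_le_const)
    show "(\<lambda>n. e * hnorm H x + hnorm H (T n x \<ominus> U x)) \<longlonglongrightarrow> e * hnorm H x"
      using tendsto_add[OF tendsto_const U(2)[OF x]] by simp
    have "hnorm H (T m x \<ominus> U x) \<le> e * hnorm H x + hnorm H (T n x \<ominus> U x)" if "n \<ge> M" for n
    proof -
      have "hnorm H (T m x \<ominus> U x) \<le> hnorm H (T m x \<ominus> T n x) + hnorm H (T n x \<ominus> U x)"
        using cl U x by (intro hnorm_triangle_diff) auto
      also have "hnorm H (T m x \<ominus> T n x) \<le> op_dist (T m) (T n) * hnorm H x"
        by (rule hnorm_diff_op_le[OF T T x])
      also have "\<dots> \<le> e * hnorm H x"
        using M[OF that] x by (intro mult_right_mono) auto
      finally show ?thesis by simp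
    qed
    then show "\<exists>N. \<forall>n\<ge>N. hnorm H (T m x \<ominus> U x) \<le> e * hnorm H x + hnorm H (T n x \<ominus> U x)"
      by blast
  qed
  have U_ops: "U \<in> bounded_ops H"
  proof -
    obtain M where M: "\<And>m n. m \<ge> M \<Longrightarrow> n \<ge> M \<Longrightarrow> op_dist (T m) (T n) < 1"
      using cauchy[rule_format, of 1] by auto
    show ?thesis
    proof (rule bounded_opsI[where K = "1 + op_norm H (T M)"])
      fix x assume x: "x \<in> carrier H"
      have "hnorm H (U x) \<le> hnorm H (U x \<ominus> T M x) + hnorm H (T M x)"
        by (intro hnorm_le_diff U cl x)
      also have "hnorm H (U x \<ominus> T M x) = hnorm H (T M x \<ominus> U x)"
        by (intro hnorm_diff_commute U cl x)
      also have "\<dots> \<le> 1 * hnorm H x"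
        using M x by (intro near) auto
      also have "hnorm H (T M x) \<le> op_norm H (T M) * hnorm H x"
        by (rule hnorm_op_le[OF T x])
      finally show "hnorm H (U x) \<le> (1 + op_norm H (T M)) * hnorm H x"
        by (simp add: algebra_simps)
    next
      fix x y assume xy: "x \<in> carrier H" "y \<in> carrier H"
      show "U (x \<oplus> y) = U x \<oplus> U y"
      proof (rule unique[where X = "\<lambda>n. T n (x \<oplus> y)"])
        show "(\<lambda>n. hnorm H (T n (x \<oplus> y) \<ominus> (U x \<oplus> U y))) \<longlonglongrightarrow> 0"
        proof (rule tendsto_0_le[where K = 1, OF tendsto_add_zero[OF U(2)[OF xy(1)] U(2)[OF xy(2)]]])
          have "hnorm H (T n (x \<oplus> y) \<ominus> (U x \<oplus> U y)) \<le> hnorm H (T n x \<ominus> U x) + hnorm H (T n y \<ominus> U y)"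
            for n
          proof -
            have "T n (x \<oplus> y) \<ominus> (U x \<oplus> U y) = (T n x \<ominus> U x) \<oplus> (T n y \<ominus> U y)"
              using xy cl U by (simp add: op_add[OF T] M.minus_eq M.minus_add M.a_ac)
            then show ?thesis
              using hnorm_triangle[of "T n x \<ominus> U x" "T n y \<ominus> U y"] xy cl U by simp
          qed
          then show "\<forall>\<^sub>F n in sequentially. norm (hnorm H (T n (x \<oplus> y) \<ominus> (U x \<oplus> U y)))
              \<le> norm (hnorm H (T n x \<ominus> U x) + hnorm H (T n y \<ominus> U y)) * 1"
            using xy cl U by (intro always_eventually) (simp add: abs_of_nonneg add_nonneg_nonneg)
        qed
      qed (use xy U cl in auto)
    next
      fix c x assume x: "x \<in> carrier H"
      show "U (c \<odot> x) = c \<odot> U x"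
      proof (rule unique[where X = "\<lambda>n. T n (c \<odot> x)"])
        have "T n (c \<odot> x) \<ominus> c \<odot> U x = c \<odot> (T n x \<ominus> U x)" for n
          using x cl U by (simp add: op_scale[OF T] diff_eq scale_add_right scale_scale mult.commute)
        then have "hnorm H (T n (c \<odot> x) \<ominus> c \<odot> U x) = cmod c * hnorm H (T n x \<ominus> U x)" for n
          using x cl U by (simp add: hnorm_scale)
        then show "(\<lambda>n. hnorm H (T n (c \<odot> x) \<ominus> c \<odot> U x)) \<longlonglongrightarrow> 0"
          using tendsto_mult_right_zero[OF U(2)[OF x]] by simp
      qed (use x U cl in auto)
    qed (use U in \<open>auto simp: U_def\<close>)
  qed
  have "(\<lambda>n. op_dist (T n) U) \<longlonglongrightarrow> 0"
  proof (rule LIMSEQ_I)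
    fix r :: real assume r: "0 < r"
    then obtain M where M: "\<And>m n. m \<ge> M \<Longrightarrow> n \<ge> M \<Longrightarrow> op_dist (T m) (T n) < r / 2"
      using cauchy[rule_format, of "r / 2"] by auto
    have "op_dist (T n) U \<le> r / 2" if "n \<ge> M" for n
      using M that r by (intro op_norm_le near) auto
    then have "norm (op_dist (T n) U - 0) < r" if "n \<ge> M" for n
      using that r op_norm_diff_nonneg[OF T U_ops, of n] by fastforce
    then show "\<exists>no. \<forall>n\<ge>no. norm (op_dist (T n) U - 0) < r" by blast
  qed
  then show ?thesis using U_ops by blast
qed

end

section \<open>Square summable functions\<close>

lemma ell2_simps [simp]:
  "x \<in> carrier (ell2 B) \<longleftrightarrow> (\<forall>s. s \<notin> B \<longrightarrow> x s = 0) \<and> (\<lambda>s. (cmod (x s))\<^sup>2) summable_on B"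
  "\<zero>\<^bsub>ell2 B\<^esub> = (\<lambda>s. 0)"
  "x \<oplus>\<^bsub>ell2 B\<^esub> y = (\<lambda>s. x s + y s)"
  "c \<odot>\<^bsub>ell2 B\<^esub> x = (\<lambda>s. c * x s)"
  "ip (ell2 B) x y = (\<Sum>\<^sub>\<infinity>s\<in>B. x s * cnj (y s))"
  by (simp_all add: ell2_def)

lemma summable_on_bound:
  fixes f :: "'a \<Rightarrow> complex" and g :: "'a \<Rightarrow> real"
  assumes "g summable_on A" "\<And>x. x \<in> A \<Longrightarrow> cmod (f x) \<le> g x"
  shows "f summable_on A"
  by (rule abs_summable_summable, rule summable_on_comparison_test[OF assms(1)]) (use assms in auto)

lemma ell2_ip_summable:
  assumes "(\<lambda>s. (cmod (x s))\<^sup>2) summable_on B" "(\<lambda>s. (cmod (y s))\<^sup>2) summable_on B"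
  shows "(\<lambda>s. x s * cnj (y s)) summable_on B"
proof (rule summable_on_bound)
  show "(\<lambda>s. (cmod (x s))\<^sup>2 + (cmod (y s))\<^sup>2) summable_on B"
    using assms by (rule summable_on_add)
  show "cmod (x s * cnj (y s)) \<le> (cmod (x s))\<^sup>2 + (cmod (y s))\<^sup>2" for s
    using sum_squares_bound[of "cmod (x s)" "cmod (y s)"]
      mult_nonneg_nonneg[OF norm_ge_zero[of "x s"] norm_ge_zero[of "y s"]]
    unfolding norm_mult complex_mod_cnj mult.assoc by linarith
qed

lemma ell2_add_summable:
  assumes "(\<lambda>s. (cmod (x s))\<^sup>2) summable_on B" "(\<lambda>s. (cmod (y s))\<^sup>2) summable_on B"
  shows "(\<lambda>s. (cmod (x s + y s))\<^sup>2) summable_on B"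
proof (rule summable_on_comparison_test)
  show "(\<lambda>s. 2 * (cmod (x s))\<^sup>2 + 2 * (cmod (y s))\<^sup>2) summable_on B"
    using assms by (intro summable_on_add summable_on_cmult_right)
  show "(cmod (x s + y s))\<^sup>2 \<le> 2 * (cmod (x s))\<^sup>2 + 2 * (cmod (y s))\<^sup>2" for s
  proof -
    have "(cmod (x s + y s))\<^sup>2 \<le> (cmod (x s) + cmod (y s))\<^sup>2"
      by (intro power_mono norm_triangle_ineq) auto
    then show ?thesis
      using sum_squares_bound[of "cmod (x s)" "cmod (y s)"] by (simp add: power2_sum)
  qed
qed auto

lemma abelian_group_ell2: "abelian_group (ell2 B)"
proof (rule abelian_groupI)
  fix x assume x: "x \<in> carrier (ell2 B)"
  have "(\<lambda>s. - x s) \<in> carrier (ell2 B)" "(\<lambda>s. - x s) \<oplus>\<^bsub>ell2 B\<^esub> x = \<zero>\<^bsub>ell2 B\<^esub>"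
    using x by auto
  then show "\<exists>y\<in>carrier (ell2 B). y \<oplus>\<^bsub>ell2 B\<^esub> x = \<zero>\<^bsub>ell2 B\<^esub>" by blast
qed (auto simp: ell2_add_summable algebra_simps)

lemma module_ell2: "module complex_ring (ell2 B)"
  by (rule moduleI[OF cring_complex_ring abelian_group_ell2])
    (auto simp: complex_ring_def algebra_simps norm_mult power_mult_distrib
      intro!: summable_on_cmult_right)

lemma ell2_minus:
  assumes "x \<in> carrier (ell2 B)" "y \<in> carrier (ell2 B)"
  shows "x \<ominus>\<^bsub>ell2 B\<^esub> y = (\<lambda>s. x s - y s)"
proof -
  interpret abelian_group "ell2 B" by (rule abelian_group_ell2)
  have "\<ominus>\<^bsub>ell2 B\<^esub> y = (\<lambda>s. - y s)"
    using assms by (intro minus_equality) auto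
  then show ?thesis by (simp add: a_minus_def)
qed

text \<open>If the sum diverges, both sides have the default value 0.\<close>

lemma infsum_complex_of_real:
  "(\<Sum>\<^sub>\<infinity>s\<in>A. complex_of_real (f s)) = complex_of_real (\<Sum>\<^sub>\<infinity>s\<in>A. f s)"
proof (cases "f summable_on A")
  case True
  then show ?thesis
    by (intro infsumI has_sum_of_real has_sum_infsum)
next
  case False
  then have "\<not> (\<lambda>s. complex_of_real (f s)) summable_on A"
    using summable_on_Re[of "\<lambda>s. complex_of_real (f s)" A] by auto
  then show ?thesis
    using False by (simp add: infsum_not_exists)
qed

lemma ell2_ip_self: "ip (ell2 B) x x = complex_of_real (\<Sum>\<^sub>\<infinity>s\<in>B. (cmod (x s))\<^sup>2)"
  by (simp add: complex_norm_square[symmetric] infsum_complex_of_real del: of_real_power)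

lemma ell2_hnorm: "hnorm (ell2 B) x = sqrt (\<Sum>\<^sub>\<infinity>s\<in>B. (cmod (x s))\<^sup>2)"
  by (simp add: hnorm_def del: ell2_simps add: ell2_ip_self)

lemma ell2_sum_le_hnorm:
  assumes "x \<in> carrier (ell2 B)" "finite F" "F \<subseteq> B"
  shows "(\<Sum>s\<in>F. (cmod (x s))\<^sup>2) \<le> (hnorm (ell2 B) x)\<^sup>2"
  using assms by (auto simp: ell2_hnorm infsum_nonneg intro!: finite_sum_le_infsum)

text \<open>Bounds on finite partial sums survive pointwise limits. In \<open>ell2_complete\<close>
  they yield membership and a norm estimate together, for a limit not yet known to be square
  summable.\<close>

lemma ell2_bounded_sums:
  assumes "\<And>s. s \<notin> B \<Longrightarrow> x s = 0"
    and "\<And>F. finite F \<Longrightarrow> F \<subseteq> B \<Longrightarrow> (\<Sum>s\<in>F. (cmod (x s))\<^sup>2) \<le> r\<^sup>2" and "0 \<le> r"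
  shows "x \<in> carrier (ell2 B)" "hnorm (ell2 B) x \<le> r"
proof -
  have sm: "(\<lambda>s. (cmod (x s))\<^sup>2) summable_on B"
    by (rule nonneg_bounded_partial_sums_imp_summable_on[where C = "r\<^sup>2"])
      (use assms in \<open>auto intro!: eventually_finite_subsets_at_top_weakI\<close>)
  then show "x \<in> carrier (ell2 B)" using assms by simp
  have "(\<Sum>\<^sub>\<infinity>s\<in>B. (cmod (x s))\<^sup>2) \<le> r\<^sup>2"
    using sm assms(2) by (intro infsum_le_finite_sums) auto
  then show "hnorm (ell2 B) x \<le> r"
    using assms(3) by (simp add: ell2_hnorm real_le_lsqrt)
qed

lemma ell2_complete:
  assumes X: "\<And>n. X n \<in> carrier (ell2 B)"
    and cauchy: "\<forall>e>0. \<exists>N::nat. \<forall>m\<ge>N. \<forall>n\<ge>N. hnorm (ell2 B) (X m \<ominus>\<^bsub>ell2 B\<^esub> X n) < e"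
  shows "\<exists>l\<in>carrier (ell2 B). (\<lambda>n. hnorm (ell2 B) (X n \<ominus>\<^bsub>ell2 B\<^esub> l)) \<longlonglongrightarrow> 0"
proof -
  interpret module complex_ring "ell2 B" by (rule module_ell2)
  have diff: "X m \<ominus>\<^bsub>ell2 B\<^esub> X n = (\<lambda>s. X m s - X n s)" for m n
    using X by (intro ell2_minus)
  have diff_carrier: "(\<lambda>s. X m s - X n s) \<in> carrier (ell2 B)" for m n
    using M.minus_closed[OF X X, of m n] unfolding diff .
  have "Cauchy (\<lambda>n. X n s)" for s
  proof (cases "s \<in> B")
    case True
    have le: "cmod (X m s - X n s) \<le> hnorm (ell2 B) (X m \<ominus>\<^bsub>ell2 B\<^esub> X n)" for m n
      unfolding diff using ell2_sum_le_hnorm[OF diff_carrier, of "{s}" m n] True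
      by (intro power2_le_imp_le[of "cmod _"]) (auto simp: ell2_hnorm infsum_nonneg)
    show ?thesis
      unfolding Cauchy_def dist_norm using cauchy le by (meson le_less_trans)
  next
    case False
    then show ?thesis using X by (simp add: Cauchy_def)
  qed
  then have "\<exists>L. (\<lambda>n. X n s) \<longlonglongrightarrow> L" for s
    using Cauchy_convergent_iff convergent_def by metis
  then obtain l where l: "\<And>s. (\<lambda>n. X n s) \<longlonglongrightarrow> l s" by metis
  have l0: "l s = 0" if "s \<notin> B" for s
  proof -
    have "(\<lambda>n. X n s) = (\<lambda>n. 0)" using X that by auto
    then show ?thesis using l[of s] LIMSEQ_unique[OF _ tendsto_const] by metis
  qed
  have near: "(\<lambda>s. X m s - l s) \<in> carrier (ell2 B) \<and> hnorm (ell2 B) (\<lambda>s. X m s - l s) \<le> e"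
    if e: "e > 0" and M: "m \<ge> M" "\<And>m n. m \<ge> M \<Longrightarrow> n \<ge> M \<Longrightarrow> hnorm (ell2 B) (X m \<ominus>\<^bsub>ell2 B\<^esub> X n) < e" for m M e
  proof -
    have bound: "(\<Sum>s\<in>F. (cmod (X m s - l s))\<^sup>2) \<le> e\<^sup>2" if F: "finite F" "F \<subseteq> B" for F
    proof (rule LIMSEQ_le_const2)
      show "(\<lambda>n. \<Sum>s\<in>F. (cmod (X m s - X n s))\<^sup>2) \<longlonglongrightarrow> (\<Sum>s\<in>F. (cmod (X m s - l s))\<^sup>2)"
        by (intro tendsto_sum tendsto_power tendsto_norm tendsto_diff tendsto_const l)
      have "(\<Sum>s\<in>F. (cmod (X m s - X n s))\<^sup>2) \<le> e\<^sup>2" if "n \<ge> M" for n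
      proof -
        have "(\<Sum>s\<in>F. (cmod (X m s - X n s))\<^sup>2) \<le> (hnorm (ell2 B) (X m \<ominus>\<^bsub>ell2 B\<^esub> X n))\<^sup>2"
          unfolding diff by (rule ell2_sum_le_hnorm[OF diff_carrier F])
        also have "\<dots> \<le> e\<^sup>2"
          using M(2)[OF M(1) that] by (intro power_mono) (auto simp: ell2_hnorm infsum_nonneg)
        finally show ?thesis .
      qed
      then show "\<exists>N. \<forall>n\<ge>N. (\<Sum>s\<in>F. (cmod (X m s - X n s))\<^sup>2) \<le> e\<^sup>2" by blast
    qed
    have z: "X m s - l s = 0" if "s \<notin> B" for s
      using that X l0 by simp
    show ?thesis
      using ell2_bounded_sums[of B "\<lambda>s. X m s - l s" e] bound z e by (meson less_imp_le)
  qed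
  obtain M where M: "\<And>m n. m \<ge> M \<Longrightarrow> n \<ge> M \<Longrightarrow> hnorm (ell2 B) (X m \<ominus>\<^bsub>ell2 B\<^esub> X n) < 1"
    using cauchy[rule_format, of 1] by auto
  \<comment> \<open>So far only the difference of \<open>X M\<close> and l is known to be square
    summable; l is recovered from it.\<close>
  have "X M \<ominus>\<^bsub>ell2 B\<^esub> (\<lambda>s. X M s - l s) = l"
    using near[of 1 M M] M X by (subst ell2_minus) auto
  then have lB: "l \<in> carrier (ell2 B)"
    using near[of 1 M M] M X M.minus_closed[of "X M" "\<lambda>s. X M s - l s"] by simp
  have "(\<lambda>n. hnorm (ell2 B) (X n \<ominus>\<^bsub>ell2 B\<^esub> l)) \<longlonglongrightarrow> 0"
  proof (rule LIMSEQ_I)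
    fix r :: real assume r: "0 < r"
    then obtain M where M: "\<And>m n. m \<ge> M \<Longrightarrow> n \<ge> M \<Longrightarrow> hnorm (ell2 B) (X m \<ominus>\<^bsub>ell2 B\<^esub> X n) < r / 2"
      using cauchy[rule_format, of "r / 2"] by auto
    have "hnorm (ell2 B) (X n \<ominus>\<^bsub>ell2 B\<^esub> l) \<le> r / 2" if "n \<ge> M" for n
      unfolding ell2_minus[OF X lB] using near[of "r / 2" M n] M r that by simp
    then have "norm (hnorm (ell2 B) (X n \<ominus>\<^bsub>ell2 B\<^esub> l) - 0) < r" if "n \<ge> M" for n
      using that r by (fastforce simp: ell2_hnorm infsum_nonneg)
    then show "\<exists>no. \<forall>n\<ge>no. norm (hnorm (ell2 B) (X n \<ominus>\<^bsub>ell2 B\<^esub> l) - 0) < r" by blast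
  qed
  then show ?thesis using lB by blast
qed

lemma hilbert_space_ell2: "hilbert_space (ell2 B)"
proof -
  interpret module complex_ring "ell2 B" by (rule module_ell2)
  show ?thesis
  proof
    fix x y z assume xyz: "x \<in> carrier (ell2 B)" "y \<in> carrier (ell2 B)" "z \<in> carrier (ell2 B)"
    then have "(\<lambda>s. x s * cnj (z s)) summable_on B" "(\<lambda>s. y s * cnj (z s)) summable_on B"
      by (auto intro: ell2_ip_summable)
    then show "ip (ell2 B) (x \<oplus>\<^bsub>ell2 B\<^esub> y) z = ip (ell2 B) x z + ip (ell2 B) y z"
      by (simp add: distrib_right infsum_add)
  next
    fix x z c assume "x \<in> carrier (ell2 B)" "z \<in> carrier (ell2 B)"
    then show "ip (ell2 B) (c \<odot>\<^bsub>ell2 B\<^esub> x) z = c * ip (ell2 B) x z"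
      by (simp add: mult.assoc infsum_cmult_right')
  next
    fix x y
    show "ip (ell2 B) y x = cnj (ip (ell2 B) x y)"
      by (simp add: infsum_cnj[symmetric] mult.commute)
  next
    fix x
    show "0 \<le> Re (ip (ell2 B) x x)"
      by (simp add: ell2_ip_self infsum_nonneg del: ell2_simps)
  next
    fix x assume x: "x \<in> carrier (ell2 B)" and 0: "ip (ell2 B) x x = 0"
    then have "(\<Sum>\<^sub>\<infinity>s\<in>B. (cmod (x s))\<^sup>2) = 0"
      unfolding ell2_ip_self of_real_eq_0_iff by blast
    then have "x s = 0" if "s \<in> B" for s
      using x that nonneg_infsum_le_0D[of "\<lambda>s. (cmod (x s))\<^sup>2" B s] by simp
    then show "x = \<zero>\<^bsub>ell2 B\<^esub>" using x by auto
  qed (rule ell2_complete)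
qed

section \<open>Inverse semigroups\<close>

context inverse_semigroup
begin

abbreviation mul (infixl \<open>\<cdot>\<close> 70) where "a \<cdot> b \<equiv> sprod S a b"
abbreviation adj (\<open>_\<^sup>\<star>\<close> [1000] 1000) where "a\<^sup>\<star> \<equiv> sadj S a"

abbreviation \<A> where "\<A> \<equiv> semigroup_algebra S"
abbreviation \<L> where "\<L> \<equiv> ell2 (carrier S)"

lemmas closed [simp, intro] = prod_closed adj_closed

lemma mul_adj_mul:
  assumes "a \<in> carrier S"
  shows "a \<cdot> (a\<^sup>\<star> \<cdot> a) = a" "a\<^sup>\<star> \<cdot> (a \<cdot> a\<^sup>\<star>) = a\<^sup>\<star>"
  using assms prod_adj_prod adj_prod_adj by (simp_all add: prod_assoc)

lemma adj_adj [simp]: "a \<in> carrier S \<Longrightarrow> a\<^sup>\<star>\<^sup>\<star> = a"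
  using adj_unique[of "a\<^sup>\<star>" a] prod_adj_prod adj_prod_adj by simp

lemma adj_idem:
  assumes "e \<in> carrier S" "e \<cdot> e = e"
  shows "e\<^sup>\<star> = e"
  using adj_unique[of e e] assms by simp

text \<open>Let z be the inverse of ef. The element fze is an inverse of ef too, so z = fze by
  uniqueness, and zefz = z makes fze idempotent. An idempotent is its own inverse, hence ef =
  z.\<close>

lemma idem_mul:
  assumes e: "e \<in> carrier S" "e \<cdot> e = e" and f: "f \<in> carrier S" "f \<cdot> f = f"
  shows "e \<cdot> f \<cdot> (e \<cdot> f) = e \<cdot> f"
proof -
  define z where "z = (e \<cdot> f)\<^sup>\<star>"
  have z: "z \<in> carrier S" using e f by (simp add: z_def)
  have ee: "e \<cdot> (e \<cdot> w) = e \<cdot> w" if "w \<in> carrier S" for w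
    using e that by (simp flip: prod_assoc)
  have ff: "f \<cdot> (f \<cdot> w) = f \<cdot> w" if "w \<in> carrier S" for w
    using f that by (simp flip: prod_assoc)
  have zz: "z \<cdot> (e \<cdot> (f \<cdot> z)) = z"
    using adj_prod_adj[of "e \<cdot> f"] e f z by (simp add: z_def[symmetric] prod_assoc)
  have efz: "e \<cdot> (f \<cdot> (z \<cdot> (e \<cdot> f))) = e \<cdot> f"
    using prod_adj_prod[of "e \<cdot> f"] e f z by (simp add: z_def[symmetric] prod_assoc)
  have zz': "z \<cdot> (e \<cdot> (f \<cdot> (z \<cdot> e))) = z \<cdot> e"
    using arg_cong[OF zz, of "\<lambda>w. w \<cdot> e"] e f z by (simp add: prod_assoc)
  have "f \<cdot> (z \<cdot> e) = (e \<cdot> f)\<^sup>\<star>"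
    by (rule adj_unique) (use e f z in \<open>auto simp: prod_assoc ee ff efz zz'\<close>)
  then have zfe: "f \<cdot> (z \<cdot> e) = z" by (simp add: z_def)
  have "f \<cdot> (z \<cdot> e) \<cdot> (f \<cdot> (z \<cdot> e)) = f \<cdot> (z \<cdot> e)"
    using e f z by (simp add: prod_assoc zz')
  then have "z \<cdot> z = z" by (simp add: zfe)
  then have "z\<^sup>\<star> = z" using z by (simp add: adj_idem)
  then have "z = e \<cdot> f" using e f by (simp add: z_def)
  then show ?thesis using \<open>z \<cdot> z = z\<close> by simp
qed

text \<open>Since ef and fe are idempotent by \<open>idem_mul\<close>, fe satisfies the equations of
  an inverse of ef; but ef is its own inverse.\<close>

lemma idem_commute:
  assumes e: "e \<in> carrier S" "e \<cdot> e = e" and f: "f \<in> carrier S" "f \<cdot> f = f"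
  shows "e \<cdot> f = f \<cdot> e"
proof -
  have ee: "e \<cdot> (e \<cdot> w) = e \<cdot> w" if "w \<in> carrier S" for w
    using e that by (simp flip: prod_assoc)
  have ff: "f \<cdot> (f \<cdot> w) = f \<cdot> w" if "w \<in> carrier S" for w
    using f that by (simp flip: prod_assoc)
  have ef: "e \<cdot> (f \<cdot> (e \<cdot> f)) = e \<cdot> f" "f \<cdot> (e \<cdot> (f \<cdot> e)) = f \<cdot> e"
    using idem_mul[OF e f] idem_mul[OF f e] e f by (simp_all add: prod_assoc)
  have "f \<cdot> e = (e \<cdot> f)\<^sup>\<star>"
    by (rule adj_unique) (use e f in \<open>auto simp: prod_assoc ee ff ef\<close>)
  also have "\<dots> = e \<cdot> f"
    using idem_mul[OF e f] e f by (simp add: adj_idem)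
  finally show ?thesis by simp
qed

lemma range_source_commute:
  assumes "a \<in> carrier S" "b \<in> carrier S"
  shows "b \<cdot> b\<^sup>\<star> \<cdot> (a\<^sup>\<star> \<cdot> a) = a\<^sup>\<star> \<cdot> a \<cdot> (b \<cdot> b\<^sup>\<star>)"
  by (rule idem_commute) (use assms in \<open>auto simp: prod_assoc mul_adj_mul\<close>)

lemma range_source_commute':
  assumes "a \<in> carrier S" "b \<in> carrier S" "w \<in> carrier S"
  shows "b \<cdot> (b\<^sup>\<star> \<cdot> (a\<^sup>\<star> \<cdot> (a \<cdot> w))) = a\<^sup>\<star> \<cdot> (a \<cdot> (b \<cdot> (b\<^sup>\<star> \<cdot> w)))"
  using arg_cong[OF range_source_commute[OF assms(1,2)], of "\<lambda>z. z \<cdot> w"] assms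
  by (simp add: prod_assoc)

lemma mul_adj_mul':
  assumes "a \<in> carrier S" "w \<in> carrier S"
  shows "a \<cdot> (a\<^sup>\<star> \<cdot> (a \<cdot> w)) = a \<cdot> w" "a\<^sup>\<star> \<cdot> (a \<cdot> (a\<^sup>\<star> \<cdot> w)) = a\<^sup>\<star> \<cdot> w"
  using arg_cong[OF mul_adj_mul(1)[OF assms(1)], of "\<lambda>z. z \<cdot> w"]
    arg_cong[OF mul_adj_mul(2)[OF assms(1)], of "\<lambda>z. z \<cdot> w"] assms
  by (simp_all add: prod_assoc)

text \<open>The idempotents \<open>a\<^sup>\<star> \<cdot> a\<close> and
  \<open>b \<cdot> b\<^sup>\<star>\<close> meet in the middle of the triple products and can be
  interchanged there.\<close>

lemma adj_mul:
  assumes "a \<in> carrier S" "b \<in> carrier S"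
  shows "(a \<cdot> b)\<^sup>\<star> = b\<^sup>\<star> \<cdot> a\<^sup>\<star>"
proof (rule adj_unique[symmetric])
  show "a \<cdot> b \<cdot> (b\<^sup>\<star> \<cdot> a\<^sup>\<star>) \<cdot> (a \<cdot> b) = a \<cdot> b"
    using assms range_source_commute'[of a b b] by (simp add: prod_assoc mul_adj_mul mul_adj_mul')
  show "b\<^sup>\<star> \<cdot> a\<^sup>\<star> \<cdot> (a \<cdot> b) \<cdot> (b\<^sup>\<star> \<cdot> a\<^sup>\<star>) = b\<^sup>\<star> \<cdot> a\<^sup>\<star>"
    using assms range_source_commute'[of a b "a\<^sup>\<star>", symmetric]
    by (simp add: prod_assoc mul_adj_mul mul_adj_mul')
qed (use assms in auto)

text \<open>The domain of left multiplication by a in the Wagner-Preston representation, on which it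
  is injective with inverse \<open>a\<^sup>\<star>\<close>.\<close>

definition sdom :: "'s \<Rightarrow> 's set" where
  "sdom a = {b \<in> carrier S. a\<^sup>\<star> \<cdot> (a \<cdot> b) = b}"

lemma sdom_subset: "sdom a \<subseteq> carrier S"
  by (auto simp: sdom_def)

lemma bij_betw_sdom:
  assumes "a \<in> carrier S"
  shows "bij_betw (sprod S a) (sdom a) (sdom (a\<^sup>\<star>))"
  by (rule bij_betw_byWitness[where f' = "sprod S (a\<^sup>\<star>)"])
    (use assms in \<open>auto simp: sdom_def\<close>)

text \<open>The partial bijections compose with their natural domains; this is what makes the
  regular representation multiplicative.\<close>

lemma sdom_mul:
  assumes "a \<in> carrier S" "b \<in> carrier S"
  shows "c \<in> sdom (a \<cdot> b) \<longleftrightarrow> c \<in> sdom b \<and> b \<cdot> c \<in> sdom a"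
proof
  assume "c \<in> sdom (a \<cdot> b)"
  then have c: "c \<in> carrier S" "b\<^sup>\<star> \<cdot> (a\<^sup>\<star> \<cdot> (a \<cdot> (b \<cdot> c))) = c"
    using assms by (auto simp: sdom_def adj_mul prod_assoc)
  \<comment> \<open>By the preceding fact c has the form \<open>b\<^sup>\<star> \<cdot> w\<close>,
    and such elements are fixed by \<open>b\<^sup>\<star> \<cdot> b\<close>.\<close>
  have 1: "b\<^sup>\<star> \<cdot> (b \<cdot> c) = c"
    using assms c mul_adj_mul'(2)[of b "a\<^sup>\<star> \<cdot> (a \<cdot> (b \<cdot> c))"] by simp
  have "a\<^sup>\<star> \<cdot> (a \<cdot> (b \<cdot> c)) = a\<^sup>\<star> \<cdot> (a \<cdot> (b \<cdot> (b\<^sup>\<star> \<cdot> (b \<cdot> c))))"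
    by (simp only: 1)
  also have "\<dots> = b \<cdot> (b\<^sup>\<star> \<cdot> (a\<^sup>\<star> \<cdot> (a \<cdot> (b \<cdot> c))))"
    by (rule range_source_commute'[symmetric]) (use assms c in auto)
  also have "\<dots> = b \<cdot> c"
    using c by simp
  finally show "c \<in> sdom b \<and> b \<cdot> c \<in> sdom a"
    using assms c 1 by (simp add: sdom_def)
qed (use assms in \<open>auto simp: sdom_def adj_mul prod_assoc\<close>)

end

section \<open>The regular representation\<close>

context inverse_semigroup
begin

text \<open>Only b = \<open>a\<^sup>\<star> \<cdot> c\<close> can contribute to the defining sum at
  c, and only if c is in the range of the partial bijection of a. So the operator moves coordinates
  along that bijection and no convergence question remains.\<close>

lemma regular_rep_apply:
  assumes a: "a \<in> carrier S" and x: "x \<in> carrier \<L>"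
  shows "regular_rep S a x c = (if c \<in> sdom (a\<^sup>\<star>) then x (a\<^sup>\<star> \<cdot> c) else 0)"
proof -
  let ?g = "\<lambda>b. x b * regular_on_basis S a b c"
  have eq: "regular_rep S a x c = (\<Sum>\<^sub>\<infinity>b\<in>carrier S. ?g b)"
    using x by (simp add: regular_rep_def del: ell2_simps)
  have nz: "c \<in> sdom (a\<^sup>\<star>) \<and> b = a\<^sup>\<star> \<cdot> c" if "b \<in> carrier S" "?g b \<noteq> 0" for b
    using that a by (auto simp: regular_on_basis_def \<delta>_def sdom_def prod_assoc split: if_splits)
  show ?thesis
  proof (cases "c \<in> sdom (a\<^sup>\<star>)")
    case True
    have "(\<Sum>\<^sub>\<infinity>b\<in>carrier S. ?g b) = (\<Sum>\<^sub>\<infinity>b\<in>{a\<^sup>\<star> \<cdot> c}. ?g b)"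
      using nz by (intro infsum_cong_neutral) (use a True in \<open>auto simp: sdom_def\<close>)
    also have "\<dots> = x (a\<^sup>\<star> \<cdot> c)"
      using True a by (auto simp: regular_on_basis_def \<delta>_def sdom_def prod_assoc)
    finally show ?thesis using True eq by simp
  next
    case False
    then have "(\<Sum>\<^sub>\<infinity>b\<in>carrier S. ?g b) = 0"
      using nz by (intro infsum_0) blast
    then show ?thesis using False eq by simp
  qed
qed

text \<open>The substitution c = ab. Allowing any h that vanishes at 0 serves square sums and inner
  products alike.\<close>

lemma infsum_regular_rep:
  fixes h :: "'s \<Rightarrow> complex \<Rightarrow> 'b :: {comm_monoid_add, t2_space}"
  assumes a: "a \<in> carrier S" and x: "x \<in> carrier \<L>" and h: "\<And>c. h c 0 = 0"
  shows "(\<Sum>\<^sub>\<infinity>c\<in>carrier S. h c (regular_rep S a x c)) = (\<Sum>\<^sub>\<infinity>b\<in>sdom a. h (a \<cdot> b) (x b))"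
    and "(\<lambda>c. h c (regular_rep S a x c)) summable_on carrier S
      \<longleftrightarrow> (\<lambda>b. h (a \<cdot> b) (x b)) summable_on sdom a"
proof -
  have "(\<Sum>\<^sub>\<infinity>c\<in>carrier S. h c (regular_rep S a x c)) = (\<Sum>\<^sub>\<infinity>c\<in>sdom (a\<^sup>\<star>). h c (x (a\<^sup>\<star> \<cdot> c)))"
    by (rule infsum_cong_neutral) (use sdom_subset in \<open>auto simp: regular_rep_apply[OF a x] h\<close>)
  also have "\<dots> = (\<Sum>\<^sub>\<infinity>b\<in>sdom a. h (a \<cdot> b) (x (a\<^sup>\<star> \<cdot> (a \<cdot> b))))"
    by (rule infsum_reindex_bij_betw[OF bij_betw_sdom[OF a], symmetric])
  also have "\<dots> = (\<Sum>\<^sub>\<infinity>b\<in>sdom a. h (a \<cdot> b) (x b))"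
    by (rule infsum_cong) (simp add: sdom_def)
  finally show "(\<Sum>\<^sub>\<infinity>c\<in>carrier S. h c (regular_rep S a x c)) = (\<Sum>\<^sub>\<infinity>b\<in>sdom a. h (a \<cdot> b) (x b))" .
  have "(\<lambda>c. h c (regular_rep S a x c)) summable_on carrier S
      \<longleftrightarrow> (\<lambda>c. h c (x (a\<^sup>\<star> \<cdot> c))) summable_on sdom (a\<^sup>\<star>)"
    by (rule summable_on_cong_neutral) (use sdom_subset in \<open>auto simp: regular_rep_apply[OF a x] h\<close>)
  also have "\<dots> \<longleftrightarrow> (\<lambda>b. h (a \<cdot> b) (x (a\<^sup>\<star> \<cdot> (a \<cdot> b)))) summable_on sdom a"
    by (rule summable_on_reindex_bij_betw[OF bij_betw_sdom[OF a], symmetric])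
  also have "\<dots> \<longleftrightarrow> (\<lambda>b. h (a \<cdot> b) (x b)) summable_on sdom a"
    by (rule summable_on_cong) (simp add: sdom_def)
  finally show "(\<lambda>c. h c (regular_rep S a x c)) summable_on carrier S
      \<longleftrightarrow> (\<lambda>b. h (a \<cdot> b) (x b)) summable_on sdom a" .
qed

lemma regular_rep_closed:
  assumes a: "a \<in> carrier S" and x: "x \<in> carrier \<L>"
  shows "regular_rep S a x \<in> carrier \<L>"
proof -
  have "(\<lambda>b. (cmod (x b))\<^sup>2) summable_on sdom a"
    using x sdom_subset by (auto intro: summable_on_subset_banach)
  then have "(\<lambda>c. (cmod (regular_rep S a x c))\<^sup>2) summable_on carrier S"
    using infsum_regular_rep(2)[OF a x, of "\<lambda>c z. (cmod z)\<^sup>2"] by simp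
  moreover have "regular_rep S a x c = 0" if "c \<notin> carrier S" for c
    using that sdom_subset by (auto simp: regular_rep_apply[OF a x])
  ultimately show ?thesis by simp
qed

lemma regular_rep_bounded:
  assumes a: "a \<in> carrier S"
  shows "regular_rep S a \<in> bounded_ops \<L>"
proof -
  interpret hilbert_space \<L> by (rule hilbert_space_ell2)
  show ?thesis
  proof (rule bounded_opsI[where K = 1])
    fix x assume x: "x \<in> carrier \<L>"
    show "regular_rep S a x \<in> carrier \<L>"
      by (rule regular_rep_closed[OF a x])
    have "(\<Sum>\<^sub>\<infinity>c\<in>carrier S. (cmod (regular_rep S a x c))\<^sup>2) = (\<Sum>\<^sub>\<infinity>b\<in>sdom a. (cmod (x b))\<^sup>2)"
      using infsum_regular_rep(1)[OF a x, of "\<lambda>c z. (cmod z)\<^sup>2"] by simp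
    also have "\<dots> \<le> (\<Sum>\<^sub>\<infinity>b\<in>carrier S. (cmod (x b))\<^sup>2)"
      using x sdom_subset by (intro infsum_mono2) (auto intro: summable_on_subset_banach)
    finally show "hnorm \<L> (regular_rep S a x) \<le> 1 * hnorm \<L> x"
      by (simp add: ell2_hnorm)
    show "regular_rep S a (c \<odot>\<^bsub>\<L>\<^esub> x) = c \<odot>\<^bsub>\<L>\<^esub> regular_rep S a x" for c
      using scale_closed[OF x, of c] by (auto simp: regular_rep_apply[OF a] x simp del: ell2_simps(1))
  next
    fix x y assume xy: "x \<in> carrier \<L>" "y \<in> carrier \<L>"
    show "regular_rep S a (x \<oplus>\<^bsub>\<L>\<^esub> y)
      = regular_rep S a x \<oplus>\<^bsub>\<L>\<^esub> regular_rep S a y"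
      using M.a_closed[OF xy] by (auto simp: regular_rep_apply[OF a] xy simp del: ell2_simps(1))
  qed (simp add: regular_rep_def)
qed

lemma regular_rep_adjoint:
  assumes a: "a \<in> carrier S"
  shows "is_adjoint \<L> (regular_rep S a) (regular_rep S (a\<^sup>\<star>))"
  unfolding is_adjoint_def
proof (intro ballI)
  fix x y assume x: "x \<in> carrier \<L>" and y: "y \<in> carrier \<L>"
  have "ip \<L> (regular_rep S a x) y = (\<Sum>\<^sub>\<infinity>b\<in>sdom a. x b * cnj (y (a \<cdot> b)))"
    using infsum_regular_rep(1)[OF a x, of "\<lambda>c z. z * cnj (y c)"] by simp
  also have "\<dots> = (\<Sum>\<^sub>\<infinity>b\<in>carrier S. x b * cnj (regular_rep S (a\<^sup>\<star>) y b))"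
    by (rule infsum_cong_neutral)
      (use sdom_subset a in \<open>auto simp: regular_rep_apply[OF _ y]\<close>)
  finally show "ip \<L> (regular_rep S a x) y
      = ip \<L> x (regular_rep S (a\<^sup>\<star>) y)"
    by simp
qed

lemma regular_rep_mul:
  assumes a: "a \<in> carrier S" and b: "b \<in> carrier S"
  shows "regular_rep S (a \<cdot> b) = compose (carrier \<L>) (regular_rep S a) (regular_rep S b)"
proof (rule extensionalityI)
  fix x assume x: "x \<in> carrier \<L>"
  have "regular_rep S (a \<cdot> b) x c = regular_rep S a (regular_rep S b x) c" for c
  proof (cases "c \<in> carrier S")
    case True
    then show ?thesis
      using a b sdom_mul[of "b\<^sup>\<star>" "a\<^sup>\<star>" c]
      by (auto simp: regular_rep_apply x regular_rep_closed adj_mul prod_assoc simp del: ell2_simps)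
  next
    case False
    then have "c \<notin> sdom d" for d using sdom_subset by blast
    then show ?thesis
      using a b by (simp add: regular_rep_apply x regular_rep_closed del: ell2_simps)
  qed
  then show "regular_rep S (a \<cdot> b) x
      = compose (carrier \<L>) (regular_rep S a) (regular_rep S b) x"
    using x by (auto simp: compose_eq simp del: ell2_simps)
qed (auto simp: regular_rep_def)

lemma representation_regular: "representation S \<L> (regular_rep S)"
proof -
  interpret hilbert_space \<L> by (rule hilbert_space_ell2)
  have "partial_isometry \<L> (regular_rep S a)" if a: "a \<in> carrier S" for a
  proof (rule partial_isometryI)
    fix x assume x: "x \<in> carrier \<L>"
    have "regular_rep S a (regular_rep S (a\<^sup>\<star>) (regular_rep S a x)) = regular_rep S (a \<cdot> (a\<^sup>\<star> \<cdot> a)) x"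
      using a x by (simp add: regular_rep_mul compose_eq regular_rep_closed del: ell2_simps)
    then show "regular_rep S a (regular_rep S (a\<^sup>\<star>) (regular_rep S a x)) = regular_rep S a x"
      using a by (simp add: mul_adj_mul)
  qed (use a in \<open>auto intro: regular_rep_bounded regular_rep_adjoint\<close>)
  then show ?thesis
    unfolding representation_def
    by (auto intro: hilbert_space_ell2 regular_rep_mul regular_rep_adjoint)
qed

end

section \<open>The semigroup algebra\<close>

lemma semigroup_algebra_simps [simp]:
  "f \<in> carrier (semigroup_algebra S) \<longleftrightarrow> finite (supp f) \<and> supp f \<subseteq> carrier S"
  "\<zero>\<^bsub>semigroup_algebra S\<^esub> = (\<lambda>s. 0)"
  "f \<oplus>\<^bsub>semigroup_algebra S\<^esub> g = (\<lambda>s. f s + g s)"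
  "c \<odot>\<^bsub>semigroup_algebra S\<^esub> f = (\<lambda>s. c * f s)"
  by (simp_all add: semigroup_algebra_def)

lemma supp_add: "supp (\<lambda>s. f s + g s) \<subseteq> supp f \<union> supp g"
  and supp_scale: "supp (\<lambda>s. c * f s) \<subseteq> supp f"
  and supp_uminus: "supp (\<lambda>s. - f s) = supp f"
  by (auto simp: supp_def)

lemma semigroup_algebra_add_closed:
  "f \<in> carrier (semigroup_algebra S) \<Longrightarrow> g \<in> carrier (semigroup_algebra S) \<Longrightarrow>
    (\<lambda>s. f s + g s) \<in> carrier (semigroup_algebra S)"
  using supp_add[of f g] by (auto intro: finite_subset)

lemma semigroup_algebra_scale_closed:
  "f \<in> carrier (semigroup_algebra S) \<Longrightarrow> (\<lambda>s. c * f s) \<in> carrier (semigroup_algebra S)"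
  using supp_scale[of c f] by (auto intro: finite_subset)

lemma abelian_group_semigroup_algebra: "abelian_group (semigroup_algebra S)"
proof (rule abelian_groupI)
  fix f assume f: "f \<in> carrier (semigroup_algebra S)"
  then have "(\<lambda>s. - f s) \<in> carrier (semigroup_algebra S)"
    by (simp add: supp_uminus)
  then show "\<exists>g\<in>carrier (semigroup_algebra S).
      g \<oplus>\<^bsub>semigroup_algebra S\<^esub> f = \<zero>\<^bsub>semigroup_algebra S\<^esub>"
    by (intro bexI[of _ "\<lambda>s. - f s"]) auto
next
  fix f g assume "f \<in> carrier (semigroup_algebra S)" "g \<in> carrier (semigroup_algebra S)"
  then show "f \<oplus>\<^bsub>semigroup_algebra S\<^esub> g \<in> carrier (semigroup_algebra S)"
    unfolding semigroup_algebra_simps(3) by (rule semigroup_algebra_add_closed)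
qed (auto simp: supp_def algebra_simps)

lemma semigroup_algebra_minus:
  assumes "f \<in> carrier (semigroup_algebra S)" "g \<in> carrier (semigroup_algebra S)"
  shows "f \<ominus>\<^bsub>semigroup_algebra S\<^esub> g = (\<lambda>s. f s - g s)"
proof -
  interpret abelian_group "semigroup_algebra S" by (rule abelian_group_semigroup_algebra)
  have "\<ominus>\<^bsub>semigroup_algebra S\<^esub> g = (\<lambda>s. - g s)"
    using assms by (intro minus_equality) (auto simp: supp_uminus)
  then show ?thesis by (simp add: a_minus_def)
qed

definition conv :: "'s inv_semigroup \<Rightarrow> ('s \<Rightarrow> complex) \<Rightarrow> ('s \<Rightarrow> complex) \<Rightarrow> 's \<Rightarrow> complex" where
  "conv S f g = f \<otimes>\<^bsub>semigroup_algebra S\<^esub> g"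

lemma conv_apply:
  "conv S f g u = (\<Sum>p\<in>{p \<in> supp f \<times> supp g. sprod S (fst p) (snd p) = u}. f (fst p) * g (snd p))"
  unfolding conv_def semigroup_algebra_def
  by (simp, rule sum.cong) auto

lemma star_apply:
  "star (semigroup_algebra S) f u = (\<Sum>s\<in>{s \<in> supp f. sadj S s = u}. cnj (f s))"
  by (simp add: semigroup_algebra_def)

lemma supp_conv: "supp (conv S f g) \<subseteq> (\<lambda>p. sprod S (fst p) (snd p)) ` (supp f \<times> supp g)"
proof
  fix u assume "u \<in> supp (conv S f g)"
  then have "{p \<in> supp f \<times> supp g. sprod S (fst p) (snd p) = u} \<noteq> {}"
    by (auto simp: supp_def[of "conv S f g"] conv_apply simp del: Collect_empty_eq)
  then show "u \<in> (\<lambda>p. sprod S (fst p) (snd p)) ` (supp f \<times> supp g)" by blast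
qed

lemma supp_star: "supp (star (semigroup_algebra S) f) \<subseteq> sadj S ` supp f"
proof
  fix u assume "u \<in> supp (star (semigroup_algebra S) f)"
  then have "{s \<in> supp f. sadj S s = u} \<noteq> {}"
    by (auto simp: supp_def[of "star (semigroup_algebra S) f"] star_apply simp del: Collect_empty_eq)
  then show "u \<in> sadj S ` supp f" by blast
qed

context inverse_semigroup
begin

lemma conv_closed:
  assumes "f \<in> carrier \<A>" "g \<in> carrier \<A>"
  shows "conv S f g \<in> carrier \<A>"
proof -
  have "finite ((\<lambda>p. fst p \<cdot> snd p) ` (supp f \<times> supp g))"
    and "(\<lambda>p. fst p \<cdot> snd p) ` (supp f \<times> supp g) \<subseteq> carrier S"
    using assms by (auto intro!: prod_closed)
  then show ?thesis
    using supp_conv[of S f g] by (auto intro: finite_subset)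
qed

lemma star_closed:
  assumes "f \<in> carrier \<A>"
  shows "star \<A> f \<in> carrier \<A>"
proof -
  have "finite (sadj S ` supp f)" "sadj S ` supp f \<subseteq> carrier S"
    using assms by auto
  then show ?thesis
    using supp_star[of S f] by (auto intro: finite_subset)
qed

end

section \<open>Extending representations to the semigroup algebra\<close>

locale semigroup_rep = inverse_semigroup S + hilbert_space H
  for S :: "'s inv_semigroup" and H :: "'h hilbert" (structure) +
  fixes \<pi> :: "'s \<Rightarrow> 'h \<Rightarrow> 'h"
  assumes rep: "representation S H \<pi>"
begin

abbreviation \<Phi> :: "('s \<Rightarrow> complex) \<Rightarrow> 'h \<Rightarrow> 'h" where "\<Phi> \<equiv> extend_rep H \<pi>"

lemma rep_bounded: "s \<in> carrier S \<Longrightarrow> \<pi> s \<in> bounded_ops H"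
  using rep by (auto simp: representation_def partial_isometry_def)

lemma rep_closed [simp, intro]: "s \<in> carrier S \<Longrightarrow> x \<in> carrier H \<Longrightarrow> \<pi> s x \<in> carrier H"
  using rep_bounded op_closed by blast

lemma rep_mul:
  "s \<in> carrier S \<Longrightarrow> t \<in> carrier S \<Longrightarrow> x \<in> carrier H \<Longrightarrow> \<pi> (s \<cdot> t) x = \<pi> s (\<pi> t x)"
  using rep by (simp add: representation_def compose_eq)

lemma rep_adj:
  "s \<in> carrier S \<Longrightarrow> x \<in> carrier H \<Longrightarrow> y \<in> carrier H \<Longrightarrow> ip H (\<pi> s x) y = ip H x (\<pi> (s\<^sup>\<star>) y)"
  using rep by (simp add: representation_def is_adjoint_def)

lemma ip_rep_rep:
  assumes "s \<in> carrier S" "t \<in> carrier S" "x \<in> carrier H" "y \<in> carrier H"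
  shows "ip H (\<pi> s x) (\<pi> t y) = ip H (\<pi> (t\<^sup>\<star> \<cdot> s) x) y"
  using assms rep_adj[of "t\<^sup>\<star>" "\<pi> s x" y] by (simp add: rep_mul)

lemma hnorm_idem_le:
  assumes e: "e \<in> carrier S" "e \<cdot> e = e" and x: "x \<in> carrier H"
  shows "hnorm H (\<pi> e x) \<le> hnorm H x"
proof -
  have "(hnorm H (\<pi> e x))\<^sup>2 = Re (ip H (\<pi> e x) x)"
    using e x by (simp add: hnorm_sq ip_rep_rep adj_idem)
  also have "\<dots> \<le> hnorm H (\<pi> e x) * hnorm H x"
    using cauchy_schwarz[of "\<pi> e x" x] complex_Re_le_cmod order_trans e x by blast
  finally show ?thesis
    using e x by (simp add: power2_eq_square) (metis hnorm_nonneg mult_le_cancel_left rep_closed leD linorder_neqE_linordered_idom less_le_trans order_le_less)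
qed

text \<open>Here |\<pi>(s)x|^2 is the inner product of x with its image under the idempotent
  \<open>s\<^sup>\<star> \<cdot> s\<close>. Idempotents are self-adjoint, which is why
  \<open>hnorm_idem_le\<close> gives contractivity for them first.\<close>

lemma hnorm_rep_le:
  assumes s: "s \<in> carrier S" and x: "x \<in> carrier H"
  shows "hnorm H (\<pi> s x) \<le> hnorm H x"
proof -
  have "(hnorm H (\<pi> s x))\<^sup>2 = Re (ip H (\<pi> (s\<^sup>\<star> \<cdot> s) x) x)"
    using s x by (simp add: hnorm_sq ip_rep_rep)
  also have "\<dots> \<le> hnorm H (\<pi> (s\<^sup>\<star> \<cdot> s) x) * hnorm H x"
    using cauchy_schwarz[of "\<pi> (s\<^sup>\<star> \<cdot> s) x" x] complex_Re_le_cmod order_trans s x by blast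
  also have "\<dots> \<le> hnorm H x * hnorm H x"
    using s x by (intro mult_right_mono hnorm_idem_le) (auto simp: prod_assoc mul_adj_mul)
  finally show ?thesis
    using x by (intro power2_le_imp_le[of "hnorm H (\<pi> s x)"]) (auto simp: power2_eq_square)
qed

text \<open>A larger index set than the support lets elements with different supports be compared
  over a common one.\<close>

lemma extend_rep_apply:
  assumes "finite B" "supp f \<subseteq> B" "B \<subseteq> carrier S" "x \<in> carrier H"
  shows "\<Phi> f x = (\<Oplus>s\<in>B. f s \<odot> \<pi> s x)"
proof -
  have "(\<Oplus>s\<in>supp f. f s \<odot> \<pi> s x) = (\<Oplus>s\<in>B. f s \<odot> \<pi> s x)"
    using assms by (intro M.add.finprod_mono_neutral_cong_left) (auto simp: supp_def)
  then show ?thesis using assms by (simp add: extend_rep_def)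
qed

lemma extend_rep_closed [simp, intro]:
  assumes "f \<in> carrier \<A>" "x \<in> carrier H"
  shows "\<Phi> f x \<in> carrier H"
  using assms by (auto simp: extend_rep_def intro!: M.finsum_closed)

text \<open>The vector identities for \<Phi> below are tested against an arbitrary vector, where
  this formula turns them into identities between finite sums of complex numbers.\<close>

lemma ip_extend_rep:
  assumes "finite B" "supp f \<subseteq> B" "B \<subseteq> carrier S" "x \<in> carrier H" "y \<in> carrier H"
  shows "ip H (\<Phi> f x) y = (\<Sum>s\<in>B. f s * ip H (\<pi> s x) y)"
  using assms by (subst extend_rep_apply[of B], auto, subst ip_finsum_left) auto

lemma extend_rep_bounded:
  assumes f: "f \<in> carrier \<A>"
  shows "\<Phi> f \<in> bounded_ops H" "op_norm H (\<Phi> f) \<le> (\<Sum>s\<in>supp f. cmod (f s))"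
proof -
  have *: "finite (supp f)" "supp f \<subseteq> carrier S" using f by auto
  have le: "hnorm H (\<Phi> f x) \<le> (\<Sum>s\<in>supp f. cmod (f s)) * hnorm H x" if x: "x \<in> carrier H" for x
  proof (cases "hnorm H (\<Phi> f x) = 0")
    case True
    then show ?thesis using x by (simp add: sum_nonneg)
  next
    case False
    have "(hnorm H (\<Phi> f x))\<^sup>2 = Re (\<Sum>s\<in>supp f. f s * ip H (\<pi> s x) (\<Phi> f x))"
      using f x * by (simp add: hnorm_sq ip_extend_rep[of "supp f"] del: semigroup_algebra_simps)
    also have "\<dots> \<le> cmod (\<Sum>s\<in>supp f. f s * ip H (\<pi> s x) (\<Phi> f x))"
      by (rule complex_Re_le_cmod)
    also have "\<dots> \<le> (\<Sum>s\<in>supp f. cmod (f s) * (hnorm H x * hnorm H (\<Phi> f x)))"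
    proof (rule sum_norm_le)
      fix s assume s: "s \<in> supp f"
      have "cmod (ip H (\<pi> s x) (\<Phi> f x)) \<le> hnorm H (\<pi> s x) * hnorm H (\<Phi> f x)"
        by (rule cauchy_schwarz) (use s f x * in auto)
      also have "\<dots> \<le> hnorm H x * hnorm H (\<Phi> f x)"
        by (rule mult_right_mono[OF hnorm_rep_le]) (use s f x * in auto)
      finally show "cmod (f s * ip H (\<pi> s x) (\<Phi> f x)) \<le> cmod (f s) * (hnorm H x * hnorm H (\<Phi> f x))"
        by (simp add: norm_mult mult_left_mono)
    qed
    also have "\<dots> = (\<Sum>s\<in>supp f. cmod (f s)) * hnorm H x * hnorm H (\<Phi> f x)"
      by (simp add: sum_distrib_right mult.assoc)
    finally have "hnorm H (\<Phi> f x) * hnorm H (\<Phi> f x)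
        \<le> (\<Sum>s\<in>supp f. cmod (f s)) * hnorm H x * hnorm H (\<Phi> f x)"
      by (simp add: power2_eq_square)
    moreover have "0 < hnorm H (\<Phi> f x)"
      using False hnorm_nonneg[OF extend_rep_closed[OF f x]] by linarith
    ultimately show ?thesis by simp
  qed
  show "\<Phi> f \<in> bounded_ops H"
  proof (rule bounded_opsI[OF _ _ _ le])
    fix x y assume xy: "x \<in> carrier H" "y \<in> carrier H"
    show "\<Phi> f (x \<oplus> y) = \<Phi> f x \<oplus> \<Phi> f y"
    proof (rule ip_eqI)
      fix z assume z: "z \<in> carrier H"
      have "ip H (\<Phi> f (x \<oplus> y)) z = (\<Sum>s\<in>supp f. f s * (ip H (\<pi> s x) z + ip H (\<pi> s y) z))"
        using xy z * by (subst ip_extend_rep[OF *(1) order_refl *(2)])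
          (auto intro!: sum.cong simp: op_add[OF rep_bounded] ip_add subset_iff)
      also have "\<dots> = ip H (\<Phi> f x \<oplus> \<Phi> f y) z"
        using xy z f * by (simp add: ip_add ip_extend_rep[OF *(1) order_refl *(2)] distrib_left sum.distrib
            del: semigroup_algebra_simps)
      finally show "ip H (\<Phi> f (x \<oplus> y)) z = ip H (\<Phi> f x \<oplus> \<Phi> f y) z" .
    qed (use xy f in auto)
  next
    fix c x assume x: "x \<in> carrier H"
    show "\<Phi> f (c \<odot> x) = c \<odot> \<Phi> f x"
    proof (rule ip_eqI)
      fix z assume z: "z \<in> carrier H"
      have "ip H (\<Phi> f (c \<odot> x)) z = (\<Sum>s\<in>supp f. f s * (c * ip H (\<pi> s x) z))"
        using x z * by (subst ip_extend_rep[OF *(1) order_refl *(2)])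
          (auto intro!: sum.cong simp: op_scale[OF rep_bounded] ip_scale subset_iff)
      also have "\<dots> = ip H (c \<odot> \<Phi> f x) z"
        using x z f * by (simp add: ip_scale ip_extend_rep[OF *(1) order_refl *(2)] sum_distrib_left mult.left_commute
            del: semigroup_algebra_simps)
      finally show "ip H (\<Phi> f (c \<odot> x)) z = ip H (c \<odot> \<Phi> f x) z" .
    qed (use x f in auto)
  next
    show "\<Phi> f \<in> extensional (carrier H)"
      unfolding extend_rep_def by (rule restrict_extensional)
  qed (rule extend_rep_closed[OF f])
  show "op_norm H (\<Phi> f) \<le> (\<Sum>s\<in>supp f. cmod (f s))"
    by (rule op_norm_le[OF _ le]) (auto simp: sum_nonneg)
qed

lemma extend_rep_add:
  assumes f: "f \<in> carrier \<A>" and g: "g \<in> carrier \<A>"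
    and x: "x \<in> carrier H"
  shows "\<Phi> (\<lambda>s. f s + g s) x = \<Phi> f x \<oplus> \<Phi> g x"
proof (rule ip_eqI)
  show "\<Phi> (\<lambda>s. f s + g s) x \<in> carrier H"
    by (rule extend_rep_closed[OF semigroup_algebra_add_closed[OF f g] x])
  fix z assume z: "z \<in> carrier H"
  have "ip H (\<Phi> (\<lambda>s. f s + g s) x) z = (\<Sum>s\<in>supp f \<union> supp g. (f s + g s) * ip H (\<pi> s x) z)"
    using f g x z supp_add[of f g] by (intro ip_extend_rep) auto
  also have "\<dots> = ip H (\<Phi> f x) z + ip H (\<Phi> g x) z"
    using f g x z by (simp add: ip_extend_rep[of "supp f \<union> supp g"] distrib_right sum.distrib)
  finally show "ip H (\<Phi> (\<lambda>s. f s + g s) x) z = ip H (\<Phi> f x \<oplus> \<Phi> g x) z"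
    using extend_rep_closed[OF f x] extend_rep_closed[OF g x] z by (simp add: ip_add)
qed (use f g x extend_rep_closed in blast)+

lemma extend_rep_scale:
  assumes f: "f \<in> carrier \<A>" and x: "x \<in> carrier H"
  shows "\<Phi> (\<lambda>s. c * f s) x = c \<odot> \<Phi> f x"
proof (rule ip_eqI)
  show "\<Phi> (\<lambda>s. c * f s) x \<in> carrier H"
    by (rule extend_rep_closed[OF semigroup_algebra_scale_closed[OF f] x])
  fix z assume z: "z \<in> carrier H"
  have "ip H (\<Phi> (\<lambda>s. c * f s) x) z = (\<Sum>s\<in>supp f. (c * f s) * ip H (\<pi> s x) z)"
    using f x z supp_scale[of c f] by (intro ip_extend_rep) auto
  also have "\<dots> = c * ip H (\<Phi> f x) z"
    using f x z by (simp add: ip_extend_rep[of "supp f"] sum_distrib_left mult.assoc)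
  finally show "ip H (\<Phi> (\<lambda>s. c * f s) x) z = ip H (c \<odot> \<Phi> f x) z"
    using extend_rep_closed[OF f x] z by (simp add: ip_scale)
qed (use f x extend_rep_closed in blast)+

lemma extend_rep_diff:
  assumes f: "f \<in> carrier \<A>" and g: "g \<in> carrier \<A>"
    and x: "x \<in> carrier H"
  shows "\<Phi> (f \<ominus>\<^bsub>\<A>\<^esub> g) x = \<Phi> f x \<ominus> \<Phi> g x"
  using extend_rep_add[OF f semigroup_algebra_scale_closed[OF g, of "-1"] x] extend_rep_scale[OF g x, of "-1"]
    extend_rep_closed[OF f x] extend_rep_closed[OF g x] semigroup_algebra_minus[OF f g]
  by (simp add: diff_eq)

lemma extend_rep_mult:
  assumes f: "f \<in> carrier \<A>" and g: "g \<in> carrier \<A>"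
    and x: "x \<in> carrier H"
  shows "\<Phi> (conv S f g) x = \<Phi> f (\<Phi> g x)"
proof (rule ip_eqI)
  show "\<Phi> (conv S f g) x \<in> carrier H"
    by (rule extend_rep_closed[OF conv_closed[OF f g] x])
  show "\<Phi> f (\<Phi> g x) \<in> carrier H"
    by (intro extend_rep_closed f g x)
  fix z assume z: "z \<in> carrier H"
  let ?P = "supp f \<times> supp g" and ?m = "\<lambda>p. fst p \<cdot> snd p"
  have P: "finite ?P" "finite (?m ` ?P)" "?m ` ?P \<subseteq> carrier S" using f g by (auto intro!: prod_closed)
  have "ip H (\<Phi> (conv S f g) x) z = (\<Sum>u\<in>?m ` ?P. conv S f g u * ip H (\<pi> u x) z)"
    using P x z supp_conv[of S f g] by (intro ip_extend_rep) auto
  also have "\<dots> = (\<Sum>u\<in>?m ` ?P. \<Sum>p\<in>{p \<in> ?P. ?m p = u}. f (fst p) * g (snd p) * ip H (\<pi> (?m p) x) z)"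
    by (simp add: conv_apply sum_distrib_right)
  \<comment> \<open>Every pair is counted at exactly one u, its product.\<close>
  also have "\<dots> = (\<Sum>p\<in>?P. f (fst p) * g (snd p) * ip H (\<pi> (?m p) x) z)"
    by (rule sum.group) (use P in auto)
  also have "\<dots> = (\<Sum>s\<in>supp f. \<Sum>t\<in>supp g. f s * g t * ip H (\<pi> (s \<cdot> t) x) z)"
    by (subst sum.cartesian_product) (auto intro!: sum.cong)
  also have "\<dots> = (\<Sum>s\<in>supp f. f s * ip H (\<pi> s (\<Phi> g x)) z)"
  proof (rule sum.cong[OF refl])
    fix s assume "s \<in> supp f"
    then have s: "s \<in> carrier S" using f by auto
    have "ip H (\<pi> s (\<Phi> g x)) z = ip H (\<Phi> g x) (\<pi> (s\<^sup>\<star>) z)"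
      using s z extend_rep_closed[OF g x] by (simp add: rep_adj)
    also have "\<dots> = (\<Sum>t\<in>supp g. g t * ip H (\<pi> t x) (\<pi> (s\<^sup>\<star>) z))"
      using g s x z by (intro ip_extend_rep) auto
    also have "\<dots> = (\<Sum>t\<in>supp g. g t * ip H (\<pi> (s \<cdot> t) x) z)"
      using g s x z by (intro sum.cong refl) (auto simp: ip_rep_rep subset_iff)
    finally show "(\<Sum>t\<in>supp g. f s * g t * ip H (\<pi> (s \<cdot> t) x) z) = f s * ip H (\<pi> s (\<Phi> g x)) z"
      by (simp add: sum_distrib_left mult.assoc)
  qed
  also have "\<dots> = ip H (\<Phi> f (\<Phi> g x)) z"
    by (rule ip_extend_rep[symmetric]) (use f g x z in auto)
  finally show "ip H (\<Phi> (conv S f g) x) z = ip H (\<Phi> f (\<Phi> g x)) z" .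
qed

lemma extend_rep_adjoint:
  assumes f: "f \<in> carrier \<A>"
  shows "is_adjoint H (\<Phi> f) (\<Phi> (star \<A> f))"
  unfolding is_adjoint_def
proof (intro ballI)
  fix x y assume x: "x \<in> carrier H" and y: "y \<in> carrier H"
  let ?f' = "star \<A> f"
  have "ip H (\<Phi> ?f' y) x = (\<Sum>u\<in>sadj S ` supp f. ?f' u * ip H (\<pi> u y) x)"
    using f x y supp_star[of S f] by (intro ip_extend_rep) auto
  also have "\<dots> = (\<Sum>u\<in>sadj S ` supp f. \<Sum>s\<in>{s \<in> supp f. s\<^sup>\<star> = u}. cnj (f s) * ip H (\<pi> (s\<^sup>\<star>) y) x)"
    by (simp add: star_apply sum_distrib_right)
  also have "\<dots> = (\<Sum>s\<in>supp f. cnj (f s) * ip H (\<pi> (s\<^sup>\<star>) y) x)"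
    by (rule sum.group) (use f in auto)
  finally have "ip H (\<Phi> ?f' y) x = (\<Sum>s\<in>supp f. cnj (f s) * ip H (\<pi> (s\<^sup>\<star>) y) x)" .
  then have "ip H x (\<Phi> ?f' y) = (\<Sum>s\<in>supp f. f s * cnj (ip H (\<pi> (s\<^sup>\<star>) y) x))"
    using ip_commute[OF extend_rep_closed[OF star_closed[OF f] y] x] by simp
  also have "\<dots> = (\<Sum>s\<in>supp f. f s * ip H (\<pi> s x) y)"
  proof (rule sum.cong[OF refl])
    fix s assume "s \<in> supp f"
    then have s: "s \<in> carrier S" using f by auto
    show "f s * cnj (ip H (\<pi> (s\<^sup>\<star>) y) x) = f s * ip H (\<pi> s x) y"
      using s x y rep_adj[of s x y] ip_commute[of "\<pi> (s\<^sup>\<star>) y" x] by simp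
  qed
  also have "\<dots> = ip H (\<Phi> f x) y"
    using f x y by (intro ip_extend_rep[symmetric]) auto
  finally show "ip H (\<Phi> f x) y = ip H x (\<Phi> ?f' y)" by simp
qed

text \<open>The norm of \<Phi>(f)x depends on \<pi> and x only through the function s \<mapsto>
  <\<pi>(s)x, x> on the finitely many products t*s. Representations can thus be compared through
  these functions, and pointwise convergence of them is enough.\<close>

lemma hnorm_extend_rep_sq:
  assumes "finite B" "supp f \<subseteq> B" "B \<subseteq> carrier S" "x \<in> carrier H"
  shows "complex_of_real ((hnorm H (\<Phi> f x))\<^sup>2)
    = (\<Sum>s\<in>B. \<Sum>t\<in>B. f s * cnj (f t) * ip H (\<pi> (t\<^sup>\<star> \<cdot> s) x) x)"
proof -
  have "f \<in> carrier \<A>" using assms by (auto intro: finite_subset)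
  then have "complex_of_real ((hnorm H (\<Phi> f x))\<^sup>2) = ip H (\<Phi> f x) (\<Phi> f x)"
    using assms by (simp add: ip_self del: of_real_power semigroup_algebra_simps)
  also have "\<dots> = (\<Sum>s\<in>B. \<Sum>t\<in>B. f s * cnj (f t) * ip H (\<pi> s x) (\<pi> t x))"
    using assms by (subst (1 2) extend_rep_apply[of B], auto, subst ip_finsum) auto
  also have "\<dots> = (\<Sum>s\<in>B. \<Sum>t\<in>B. f s * cnj (f t) * ip H (\<pi> (t\<^sup>\<star> \<cdot> s) x) x)"
    using assms by (intro sum.cong refl) (auto simp: ip_rep_rep subset_iff)
  finally show ?thesis .
qed

end

lemma (in inverse_semigroup) semigroup_repI:
  "representation S H \<pi> \<Longrightarrow> semigroup_rep S H \<pi>"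
  by (intro semigroup_rep.intro semigroup_rep_axioms.intro inverse_semigroup_axioms)
    (auto simp: representation_def)

section \<open>Transport of Hilbert spaces along an injection\<close>

text \<open>In \<open>full_norm\<close> the Hilbert spaces live in a sum type. The copy of the
  square summable functions under \<open>Inl\<close> makes the regular representation one of those
  over which the supremum is taken.\<close>

definition transport_hilbert :: "('a \<Rightarrow> 'b) \<Rightarrow> ('b \<Rightarrow> 'a) \<Rightarrow> 'a hilbert \<Rightarrow> 'b hilbert" where
  "transport_hilbert i j H = \<lparr>carrier = i ` carrier H,
     mult = undefined,
     one = undefined,
     zero = i \<zero>\<^bsub>H\<^esub>,
     add = (\<lambda>x y. i (j x \<oplus>\<^bsub>H\<^esub> j y)),
     smult = (\<lambda>c x. i (c \<odot>\<^bsub>H\<^esub> j x)),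
     ip = (\<lambda>x y. ip H (j x) (j y))\<rparr>"

locale hilbert_transport = hilbert_space H for H :: "'a hilbert" (structure) +
  fixes i :: "'a \<Rightarrow> 'b" and j :: "'b \<Rightarrow> 'a"
  assumes j_i [simp]: "j (i x) = x"
begin

abbreviation K :: "'b hilbert" where "K \<equiv> transport_hilbert i j H"

lemma transport_simps [simp]:
  "carrier K = i ` carrier H"
  "\<zero>\<^bsub>K\<^esub> = i \<zero>"
  "x \<oplus>\<^bsub>K\<^esub> y = i (j x \<oplus> j y)"
  "c \<odot>\<^bsub>K\<^esub> x = i (c \<odot> j x)"
  "ip K x y = ip H (j x) (j y)"
  by (simp_all add: transport_hilbert_def)

lemma i_eq_iff [simp]: "i x = i y \<longleftrightarrow> x = y"
  by (metis j_i)

lemma hnorm_transport [simp]: "hnorm K x = hnorm H (j x)"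
  by (simp add: hnorm_def)

lemma abelian_group_transport: "abelian_group K"
proof (rule abelian_groupI)
  fix x assume "x \<in> carrier K"
  then show "\<exists>y\<in>carrier K. y \<oplus>\<^bsub>K\<^esub> x = \<zero>\<^bsub>K\<^esub>"
    by (auto intro!: bexI[of _ "\<ominus> _"] M.l_neg)
qed (auto simp: M.a_ac)

lemma minus_transport:
  assumes "x \<in> carrier H" "y \<in> carrier H"
  shows "i x \<ominus>\<^bsub>K\<^esub> i y = i (x \<ominus> y)"
proof -
  interpret K: abelian_group K by (rule abelian_group_transport)
  have "\<ominus>\<^bsub>K\<^esub> i y = i (\<ominus> y)"
    using assms by (intro K.minus_equality) (auto simp: M.l_neg)
  then show ?thesis by (simp add: a_minus_def)
qed

lemma hilbert_space_transport: "hilbert_space K"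
proof -
  interpret K: module complex_ring K
    by (rule moduleI[OF cring_complex_ring abelian_group_transport])
      (auto simp: complex_ring_def scale_add_left scale_add_right scale_scale)
  show ?thesis
  proof
    fix X :: "nat \<Rightarrow> 'b"
    assume X: "\<And>n. X n \<in> carrier K"
      and cauchy: "\<forall>e>0. \<exists>N. \<forall>m\<ge>N. \<forall>n\<ge>N. hnorm K (X m \<ominus>\<^bsub>K\<^esub> X n) < e"
    have jX: "j (X n) \<in> carrier H" "X n = i (j (X n))" for n
      using X[of n] by auto
    have "X m \<ominus>\<^bsub>K\<^esub> X n = i (j (X m) \<ominus> j (X n))" for m n
      using minus_transport[OF jX(1) jX(1)] jX(2) by metis
    then obtain l where l: "l \<in> carrier H" "(\<lambda>n. hnorm H (j (X n) \<ominus> l)) \<longlonglongrightarrow> 0"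
      using complete[of "\<lambda>n. j (X n)"] jX cauchy by auto
    have "X n \<ominus>\<^bsub>K\<^esub> i l = i (j (X n) \<ominus> l)" for n
      using minus_transport[OF jX(1) l(1)] jX(2) by metis
    then show "\<exists>l\<in>carrier K. (\<lambda>n. hnorm K (X n \<ominus>\<^bsub>K\<^esub> l)) \<longlonglongrightarrow> 0"
      using l by (intro bexI[of _ "i l"]) auto
  next
    fix x y assume "x \<in> carrier K" "y \<in> carrier K"
    then show "ip K y x = cnj (ip K x y)"
      by (auto intro: ip_commute)
  qed (auto simp: ip_add ip_scale ip_nonneg intro: ip_definite)
qed

definition transport_op :: "('a \<Rightarrow> 'a) \<Rightarrow> 'b \<Rightarrow> 'b" where
  "transport_op T = (\<lambda>y\<in>i ` carrier H. i (T (j y)))"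

lemma transport_op_apply [simp]: "x \<in> carrier H \<Longrightarrow> transport_op T (i x) = i (T x)"
  by (simp add: transport_op_def)

lemma bounded_ops_transport:
  assumes T: "T \<in> bounded_ops H"
  shows "transport_op T \<in> bounded_ops K"
proof -
  interpret K: hilbert_space K by (rule hilbert_space_transport)
  show ?thesis
    by (rule K.bounded_opsI[where K = "op_norm H T"])
      (auto simp: op_closed[OF T] op_add[OF T] op_scale[OF T] hnorm_op_le[OF T] transport_op_def)
qed

lemma op_norm_transport:
  assumes "\<And>x. x \<in> carrier H \<Longrightarrow> U (i x) = i (T x)"
  shows "op_norm K U = op_norm H T"
proof -
  have "{hnorm K (U y) |y. y \<in> carrier K \<and> hnorm K y \<le> 1} = {hnorm H (T x) |x. x \<in> carrier H \<and> hnorm H x \<le> 1}"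
    using assms by force
  then show ?thesis by (simp add: op_norm_def)
qed

lemma representation_transport:
  assumes rep: "representation S H \<pi>"
  shows "representation S K (\<lambda>s. transport_op (\<pi> s))"
proof -
  have b: "\<pi> s \<in> bounded_ops H" if "s \<in> carrier S" for s
    using rep that by (simp add: representation_def partial_isometry_def)
  have pi: "partial_isometry K (transport_op (\<pi> s))" if s: "s \<in> carrier S" for s
    unfolding partial_isometry_def
  proof (intro conjI ballI impI)
    show "transport_op (\<pi> s) \<in> bounded_ops K"
      using b s by (intro bounded_ops_transport)
    fix y assume "y \<in> carrier K" and orth: "\<forall>z\<in>carrier K. transport_op (\<pi> s) z = \<zero>\<^bsub>K\<^esub> \<longrightarrow> ip K y z = 0"
    then obtain x where x: "x \<in> carrier H" "y = i x" by auto
    then have "\<forall>z\<in>carrier H. \<pi> s z = \<zero> \<longrightarrow> ip H x z = 0"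
      using orth by auto
    then show "hnorm K (transport_op (\<pi> s) y) = hnorm K y"
      using rep s x by (simp add: representation_def partial_isometry_def)
  qed
  have mult: "transport_op (\<pi> (sprod S s t)) = compose (carrier K) (transport_op (\<pi> s)) (transport_op (\<pi> t))"
    if st: "s \<in> carrier S" "t \<in> carrier S" for s t
  proof (rule extensionalityI)
    fix y assume "y \<in> carrier K"
    then obtain x where x: "x \<in> carrier H" "y = i x" by auto
    have "\<pi> (sprod S s t) x = \<pi> s (\<pi> t x)"
      using rep st x by (simp add: representation_def compose_eq)
    then show "transport_op (\<pi> (sprod S s t)) y = compose (carrier K) (transport_op (\<pi> s)) (transport_op (\<pi> t)) y"
      using x op_closed[OF b[OF st(2)] x(1)] by (simp add: compose_eq)
  qed (auto simp: transport_op_def)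
  have "is_adjoint K (transport_op (\<pi> s)) (transport_op (\<pi> (sadj S s)))" if "s \<in> carrier S" for s
    using rep that by (auto simp: representation_def is_adjoint_def)
  then show ?thesis
    using hilbert_space_transport pi mult unfolding representation_def by blast
qed

lemma extend_rep_transport:
  assumes "finite (supp f)" "\<And>s. s \<in> supp f \<Longrightarrow> \<pi> s x \<in> carrier H" and x: "x \<in> carrier H"
  shows "extend_rep K (\<lambda>s. transport_op (\<pi> s)) f (i x) = i (extend_rep H \<pi> f x)"
proof -
  interpret K: abelian_group K by (rule abelian_group_transport)
  have "(\<Oplus>\<^bsub>K\<^esub>s\<in>A. f s \<odot>\<^bsub>K\<^esub> transport_op (\<pi> s) (i x)) = i (\<Oplus>s\<in>A. f s \<odot> \<pi> s x)"
    if "finite A" "A \<subseteq> supp f" for A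
    using that
  proof (induction A rule: finite_induct)
    case (insert a A)
    have "(\<Oplus>\<^bsub>K\<^esub>s\<in>insert a A. f s \<odot>\<^bsub>K\<^esub> transport_op (\<pi> s) (i x))
        = (f a \<odot>\<^bsub>K\<^esub> transport_op (\<pi> a) (i x)) \<oplus>\<^bsub>K\<^esub> (\<Oplus>\<^bsub>K\<^esub>s\<in>A. f s \<odot>\<^bsub>K\<^esub> transport_op (\<pi> s) (i x))"
      using insert assms by (intro K.finsum_insert) auto
    moreover have "(\<Oplus>s\<in>insert a A. f s \<odot> \<pi> s x) = (f a \<odot> \<pi> a x) \<oplus> (\<Oplus>s\<in>A. f s \<odot> \<pi> s x)"
      using insert assms by (intro M.finsum_insert) auto
    ultimately show ?case
      using insert x by simp
  qed simp
  from this[OF assms(1) order_refl] show ?thesis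
    using x by (simp add: extend_rep_def)
qed

end

text \<open>Domination makes the norm under \<Lambda> an upper bound of the set, and the transported
  copy of \<Lambda> attains it.\<close>

lemma (in inverse_semigroup) full_norm_eq_regular:
  assumes dominated: "\<And>(H :: (('s \<Rightarrow> complex) + 'h) hilbert) \<pi> x. representation S H \<pi> \<Longrightarrow> x \<in> carrier H \<Longrightarrow>
      hnorm H (extend_rep H \<pi> f x)
        \<le> op_norm \<L> (extend_rep \<L> (regular_rep S) f) * hnorm H x"
    and f: "f \<in> carrier \<A>"
  shows "full_norm TYPE('h) S f = op_norm \<L> (extend_rep \<L> (regular_rep S) f)"
proof -
  interpret L: semigroup_rep S \<L> "regular_rep S"
    by (rule semigroup_repI[OF representation_regular])
  interpret T: hilbert_transport \<L> "Inl :: _ \<Rightarrow> ('s \<Rightarrow> complex) + 'h" projl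
    by unfold_locales simp
  let ?c = "op_norm \<L> (L.\<Phi> f)"
  have "representation S T.K (\<lambda>s. T.transport_op (regular_rep S s))"
    by (rule T.representation_transport[OF representation_regular])
  moreover have "op_norm T.K (extend_rep T.K (\<lambda>s. T.transport_op (regular_rep S s)) f) = ?c"
  proof (rule T.op_norm_transport)
    fix x assume "x \<in> carrier \<L>"
    then show "extend_rep T.K (\<lambda>s. T.transport_op (regular_rep S s)) f (Inl x) = Inl (L.\<Phi> f x)"
      using f by (intro T.extend_rep_transport L.rep_closed) auto
  qed
  ultimately have "?c \<in> {op_norm H (extend_rep H \<pi> f) |(H :: (('s \<Rightarrow> complex) + 'h) hilbert) \<pi>.
       representation S H \<pi>}"
    by (metis (mono_tags, lifting) mem_Collect_eq)
  moreover have "r \<le> ?c" if r_mem: "r \<in> {op_norm H (extend_rep H \<pi> f) |(H :: (('s \<Rightarrow> complex) + 'h) hilbert) \<pi>.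
       representation S H \<pi>}" for r
  proof -
    obtain H :: "(('s \<Rightarrow> complex) + 'h) hilbert" and \<pi> where
      r: "r = op_norm H (extend_rep H \<pi> f)" and rep: "representation S H \<pi>"
      using r_mem by blast
    interpret H: hilbert_space H using rep by (simp add: representation_def)
    show ?thesis
      unfolding r using dominated[OF rep] L.extend_rep_bounded(1)[OF f]
      by (intro H.op_norm_le L.op_norm_nonneg) auto
  qed
  ultimately show ?thesis
    unfolding full_norm_def by (rule cSup_eq_maximum)
qed

section \<open>The completion as an algebra of operators\<close>

context semigroup_rep
begin

text \<open>Replaces the classes of the completion by their limits: once the seminorm agrees with
  the operator norm under \<Phi>, the class of F consists of the sequences with the same limit T
  (\<open>null_equiv_class\<close>).\<close>

definition converges :: "(nat \<Rightarrow> 's \<Rightarrow> complex) \<Rightarrow> ('h \<Rightarrow> 'h) \<Rightarrow> bool" where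
  "converges F T \<longleftrightarrow> (\<forall>n. F n \<in> carrier \<A>) \<and> T \<in> bounded_ops H \<and>
     (\<lambda>n. op_dist (\<Phi> (F n)) T) \<longlonglongrightarrow> 0"

lemma convergesD:
  assumes "converges F T"
  shows "F n \<in> carrier \<A>" "T \<in> bounded_ops H" "\<Phi> (F n) \<in> bounded_ops H"
    "(\<lambda>n. op_dist (\<Phi> (F n)) T) \<longlonglongrightarrow> 0"
  using assms extend_rep_bounded(1) unfolding converges_def by blast+

lemma op_norm_extend_rep_diff:
  assumes "f \<in> carrier \<A>" "g \<in> carrier \<A>"
  shows "op_norm H (\<Phi> (f \<ominus>\<^bsub>\<A>\<^esub> g)) = op_dist (\<Phi> f) (\<Phi> g)"
  by (rule op_norm_cong) (rule extend_rep_diff[OF assms])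

lemma convergesI:
  assumes "\<And>n. F n \<in> carrier \<A>" "T \<in> bounded_ops H" "r \<longlonglongrightarrow> 0"
    "\<And>n. 0 \<le> r n" "\<And>n x. x \<in> carrier H \<Longrightarrow> hnorm H (\<Phi> (F n) x \<ominus> T x) \<le> r n * hnorm H x"
  shows "converges F T"
  unfolding converges_def
proof (intro conjI allI assms(1,2))
  show "(\<lambda>n. op_dist (\<Phi> (F n)) T) \<longlonglongrightarrow> 0"
  proof (rule tendsto_sandwich[OF _ _ tendsto_const assms(3)])
    show "\<forall>\<^sub>F n in sequentially. 0 \<le> op_dist (\<Phi> (F n)) T"
      using assms(1,2) by (intro always_eventually allI op_norm_diff_nonneg extend_rep_bounded)
    show "\<forall>\<^sub>F n in sequentially. op_dist (\<Phi> (F n)) T \<le> r n"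
      using assms(4,5) by (intro always_eventually allI op_norm_le)
  qed
qed

lemma converges_le_triangle:
  assumes F: "converges F T" and G: "converges G U"
  shows "op_dist T U \<le> op_dist (\<Phi> (F n)) T
    + op_dist (\<Phi> (F n)) (\<Phi> (G n)) + op_dist (\<Phi> (G n)) U"
  using op_norm_triangle_diff[of T "\<Phi> (F n)" U] op_norm_triangle_diff[of "\<Phi> (F n)" "\<Phi> (G n)" U]
    op_norm_diff_commute[of T "\<Phi> (F n)"] convergesD[OF F] convergesD[OF G] by simp

lemma converges_null_eq:
  assumes F: "converges F T" and G: "converges G U"
    and null: "(\<lambda>n. op_dist (\<Phi> (F n)) (\<Phi> (G n))) \<longlonglongrightarrow> 0"
  shows "T = U"
proof -
  have "op_dist T U \<le> 0"
  proof (rule LIMSEQ_le_const)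
    show "(\<lambda>n. op_dist (\<Phi> (F n)) T + op_dist (\<Phi> (F n)) (\<Phi> (G n))
        + op_dist (\<Phi> (G n)) U) \<longlonglongrightarrow> 0"
      using tendsto_add[OF tendsto_add[OF convergesD(4)[OF F] null] convergesD(4)[OF G]] by simp
  qed (use converges_le_triangle[OF F G] in blast)
  then show ?thesis
    using convergesD[OF F] convergesD[OF G] op_norm_diff_nonneg[of T U]
    by (intro op_norm_diff_eq_zero) auto
qed

lemma converges_eq_null:
  assumes F: "converges F T" and G: "converges G T"
  shows "(\<lambda>n. op_dist (\<Phi> (F n)) (\<Phi> (G n))) \<longlonglongrightarrow> 0"
proof (rule tendsto_sandwich[OF _ _ tendsto_const])
  show "(\<lambda>n. op_dist (\<Phi> (F n)) T + op_dist (\<Phi> (G n)) T) \<longlonglongrightarrow> 0"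
    using tendsto_add[OF convergesD(4)[OF F] convergesD(4)[OF G]] by simp
  have "op_dist (\<Phi> (F n)) (\<Phi> (G n))
    \<le> op_dist (\<Phi> (F n)) T + op_dist (\<Phi> (G n)) T" for n
    using op_norm_triangle_diff[of "\<Phi> (F n)" T "\<Phi> (G n)"] op_norm_diff_commute[of T "\<Phi> (G n)"]
      convergesD[OF F] convergesD[OF G] by simp
  then show "\<forall>\<^sub>F n in sequentially. op_dist (\<Phi> (F n)) (\<Phi> (G n))
    \<le> op_dist (\<Phi> (F n)) T + op_dist (\<Phi> (G n)) T"
    by (intro always_eventually allI)
  show "\<forall>\<^sub>F n in sequentially. 0 \<le> op_dist (\<Phi> (F n)) (\<Phi> (G n))"
    using convergesD[OF F] convergesD[OF G] by (intro always_eventually allI op_norm_diff_nonneg)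
qed

lemma converges_unique: "converges F T \<Longrightarrow> converges F U \<Longrightarrow> T = U"
  using converges_null_eq[of F T F U] converges_eq_null[of F T F] by blast

lemma converges_add:
  assumes F: "converges F T" and G: "converges G U"
  shows "converges (\<lambda>n. F n \<oplus>\<^bsub>\<A>\<^esub> G n) (\<lambda>x\<in>carrier H. T x \<oplus> U x)"
proof (rule convergesI)
  show "F n \<oplus>\<^bsub>\<A>\<^esub> G n \<in> carrier \<A>" for n
    unfolding semigroup_algebra_simps(3)
    by (intro semigroup_algebra_add_closed convergesD[OF F] convergesD[OF G])
  show "(\<lambda>x\<in>carrier H. T x \<oplus> U x) \<in> bounded_ops H"
    by (intro bounded_ops_add convergesD[OF F] convergesD[OF G])
  show "(\<lambda>n. op_dist (\<Phi> (F n)) T + op_dist (\<Phi> (G n)) U) \<longlonglongrightarrow> 0"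
    using tendsto_add[OF convergesD(4)[OF F] convergesD(4)[OF G]] by simp
  show "0 \<le> op_dist (\<Phi> (F n)) T + op_dist (\<Phi> (G n)) U" for n
    by (intro add_nonneg_nonneg op_norm_diff_nonneg convergesD[OF F] convergesD[OF G])
  fix n x assume x: "x \<in> carrier H"
  have cl: "\<Phi> (F n) x \<in> carrier H" "\<Phi> (G n) x \<in> carrier H" "T x \<in> carrier H" "U x \<in> carrier H"
    using convergesD[OF F] convergesD[OF G] x op_closed by blast+
  have "\<Phi> (F n \<oplus>\<^bsub>\<A>\<^esub> G n) x \<ominus> (\<lambda>x\<in>carrier H. T x \<oplus> U x) x
      = (\<Phi> (F n) x \<ominus> T x) \<oplus> (\<Phi> (G n) x \<ominus> U x)"
    using x cl extend_rep_add[OF convergesD(1)[OF F] convergesD(1)[OF G] x]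
    by (simp add: M.minus_eq M.minus_add M.a_ac)
  also have "hnorm H \<dots> \<le> hnorm H (\<Phi> (F n) x \<ominus> T x) + hnorm H (\<Phi> (G n) x \<ominus> U x)"
    using cl by (intro hnorm_triangle diff_closed)
  also have "\<dots> \<le> op_dist (\<Phi> (F n)) T * hnorm H x + op_dist (\<Phi> (G n)) U * hnorm H x"
    by (intro add_mono hnorm_diff_op_le x convergesD[OF F] convergesD[OF G])
  finally show "hnorm H (\<Phi> (F n \<oplus>\<^bsub>\<A>\<^esub> G n) x \<ominus> (\<lambda>x\<in>carrier H. T x \<oplus> U x) x)
      \<le> (op_dist (\<Phi> (F n)) T + op_dist (\<Phi> (G n)) U) * hnorm H x"
    by (simp only: distrib_right)
qed

lemma converges_scale:
  assumes F: "converges F T"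
  shows "converges (\<lambda>n. c \<odot>\<^bsub>\<A>\<^esub> F n) (\<lambda>x\<in>carrier H. c \<odot> T x)"
proof (rule convergesI)
  show "c \<odot>\<^bsub>\<A>\<^esub> F n \<in> carrier \<A>" for n
    unfolding semigroup_algebra_simps(4)
    by (intro semigroup_algebra_scale_closed convergesD[OF F])
  show "(\<lambda>x\<in>carrier H. c \<odot> T x) \<in> bounded_ops H"
    by (intro bounded_ops_scale convergesD[OF F])
  show "(\<lambda>n. cmod c * op_dist (\<Phi> (F n)) T) \<longlonglongrightarrow> 0"
    using tendsto_mult_right_zero[OF convergesD(4)[OF F]] .
  show "0 \<le> cmod c * op_dist (\<Phi> (F n)) T" for n
    by (intro mult_nonneg_nonneg op_norm_diff_nonneg convergesD[OF F]) auto
  fix n x assume x: "x \<in> carrier H"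
  have cl: "\<Phi> (F n) x \<in> carrier H" "T x \<in> carrier H"
    using convergesD[OF F] x op_closed by blast+
  have "\<Phi> (c \<odot>\<^bsub>\<A>\<^esub> F n) x \<ominus> (\<lambda>x\<in>carrier H. c \<odot> T x) x = c \<odot> (\<Phi> (F n) x \<ominus> T x)"
    using x cl extend_rep_scale[OF convergesD(1)[OF F] x]
    by (simp add: diff_eq scale_add_right scale_scale mult.commute)
  also have "hnorm H \<dots> = cmod c * hnorm H (\<Phi> (F n) x \<ominus> T x)"
    using cl by (intro hnorm_scale diff_closed)
  also have "\<dots> \<le> cmod c * (op_dist (\<Phi> (F n)) T * hnorm H x)"
    by (intro mult_left_mono hnorm_diff_op_le x convergesD[OF F]) auto
  finally show "hnorm H (\<Phi> (c \<odot>\<^bsub>\<A>\<^esub> F n) x \<ominus> (\<lambda>x\<in>carrier H. c \<odot> T x) x)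
      \<le> cmod c * op_dist (\<Phi> (F n)) T * hnorm H x"
    by (simp only: mult.assoc)
qed

lemma converges_mult:
  assumes F: "converges F T" and G: "converges G U"
  shows "converges (\<lambda>n. F n \<otimes>\<^bsub>\<A>\<^esub> G n) (compose (carrier H) T U)"
proof (rule convergesI)
  define a where "a n = op_dist (\<Phi> (F n)) T" for n
  define b where "b n = op_dist (\<Phi> (G n)) U" for n
  have a: "a \<longlonglongrightarrow> 0" "\<And>n. 0 \<le> a n" and b: "b \<longlonglongrightarrow> 0" "\<And>n. 0 \<le> b n"
    unfolding a_def b_def using convergesD[OF F] convergesD[OF G] by (auto intro: op_norm_diff_nonneg)
  have T: "0 \<le> op_norm H T" and U: "0 \<le> op_norm H U"
    by (intro op_norm_nonneg convergesD[OF F] convergesD[OF G])+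
  show "F n \<otimes>\<^bsub>\<A>\<^esub> G n \<in> carrier \<A>" for n
    unfolding conv_def[symmetric] by (intro conv_closed convergesD[OF F] convergesD[OF G])
  show "compose (carrier H) T U \<in> bounded_ops H"
    by (intro bounded_ops_compose convergesD[OF F] convergesD[OF G])
  \<comment> \<open>The error bound comes from FG - TU = (F - T)G + T(G - U), where the norm of G is
    at most that of U plus \<open>b n\<close>.\<close>
  show "(\<lambda>n. a n * op_norm H U + a n * b n + op_norm H T * b n) \<longlonglongrightarrow> 0"
    by (intro tendsto_add_zero tendsto_mult_left_zero tendsto_mult_right_zero tendsto_mult_zero a b)
  show "0 \<le> a n * op_norm H U + a n * b n + op_norm H T * b n" for n
    by (intro add_nonneg_nonneg mult_nonneg_nonneg a b T U)
  fix n x assume x: "x \<in> carrier H"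
  have cl: "\<Phi> (G n) x \<in> carrier H" "U x \<in> carrier H"
    using convergesD[OF G] x op_closed by blast+
  have cl2: "\<Phi> (F n) y \<in> carrier H" "T y \<in> carrier H" if "y \<in> carrier H" for y
    using convergesD[OF F] that op_closed by blast+
  have Gx: "hnorm H (\<Phi> (G n) x \<ominus> U x) \<le> b n * hnorm H x"
    unfolding b_def by (intro hnorm_diff_op_le x convergesD[OF G])
  have "hnorm H (\<Phi> (G n) x) \<le> hnorm H (\<Phi> (G n) x \<ominus> U x) + hnorm H (U x)"
    using cl by (intro hnorm_le_diff)
  also have "\<dots> \<le> b n * hnorm H x + op_norm H U * hnorm H x"
    by (intro add_mono Gx hnorm_op_le x convergesD[OF G])
  finally have Gx': "hnorm H (\<Phi> (G n) x) \<le> b n * hnorm H x + op_norm H U * hnorm H x" .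
  have "\<Phi> (F n \<otimes>\<^bsub>\<A>\<^esub> G n) x \<ominus> compose (carrier H) T U x = \<Phi> (F n) (\<Phi> (G n) x) \<ominus> T (U x)"
    using extend_rep_mult[OF convergesD(1)[OF F] convergesD(1)[OF G] x] x
    by (simp add: compose_eq conv_def)
  also have "hnorm H \<dots> \<le> hnorm H (\<Phi> (F n) (\<Phi> (G n) x) \<ominus> T (\<Phi> (G n) x)) + hnorm H (T (\<Phi> (G n) x) \<ominus> T (U x))"
    using cl cl2 by (intro hnorm_triangle_diff) auto
  also have "\<dots> \<le> a n * hnorm H (\<Phi> (G n) x) + op_norm H T * hnorm H (\<Phi> (G n) x \<ominus> U x)"
    using hnorm_diff_op_le[OF convergesD(3,2)[OF F] cl(1), of n] 
      hnorm_op_le[OF convergesD(2)[OF F] diff_closed[OF cl]] op_diff[OF convergesD(2)[OF F] cl]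
    unfolding a_def by (intro add_mono) simp_all
  also have "\<dots> \<le> a n * (b n * hnorm H x + op_norm H U * hnorm H x) + op_norm H T * (b n * hnorm H x)"
    by (intro add_mono mult_left_mono Gx Gx' a T)
  finally show "hnorm H (\<Phi> (F n \<otimes>\<^bsub>\<A>\<^esub> G n) x \<ominus> compose (carrier H) T U x)
      \<le> (a n * op_norm H U + a n * b n + op_norm H T * b n) * hnorm H x"
    by (simp add: algebra_simps)
qed

text \<open>The difference of the images of the stars is adjoint to the difference of the
  images.\<close>

lemma op_norm_star_diff_le:
  assumes f: "f \<in> carrier \<A>" and g: "g \<in> carrier \<A>"
  shows "op_dist (\<Phi> (star \<A> f)) (\<Phi> (star \<A> g))
    \<le> op_dist (\<Phi> f) (\<Phi> g)"
proof (rule op_norm_le)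
  let ?D = "\<lambda>x\<in>carrier H. \<Phi> f x \<ominus> \<Phi> g x"
  let ?E = "\<lambda>x. \<Phi> (star \<A> f) x \<ominus> \<Phi> (star \<A> g) x"
  have cl: "\<Phi> f x \<in> carrier H" "\<Phi> g x \<in> carrier H" "\<Phi> (star \<A> f) x \<in> carrier H"
    "\<Phi> (star \<A> g) x \<in> carrier H" if "x \<in> carrier H" for x
    using that f g by (simp_all add: star_closed del: semigroup_algebra_simps)
  show "0 \<le> op_dist (\<Phi> f) (\<Phi> g)"
    using f g by (intro op_norm_diff_nonneg extend_rep_bounded)
  fix x assume x: "x \<in> carrier H"
  have "is_adjoint H ?D ?E"
    using extend_rep_adjoint[OF f] extend_rep_adjoint[OF g] cl
    by (simp add: is_adjoint_def ip_diff_left ip_diff_right)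
  then have "hnorm H (?E x) \<le> op_norm H ?D * hnorm H x"
    using f g x cl by (intro hnorm_adjoint_le[of ?D] bounded_ops_diff extend_rep_bounded diff_closed)
  also have "op_norm H ?D = op_dist (\<Phi> f) (\<Phi> g)"
    by (rule op_norm_cong) simp
  finally show "hnorm H (?E x) \<le> op_dist (\<Phi> f) (\<Phi> g) * hnorm H x" .
qed

lemma converges_cauchy:
  assumes F: "converges F T"
  shows "\<forall>e>0. \<exists>M. \<forall>m\<ge>M. \<forall>n\<ge>M. op_dist (\<Phi> (F m)) (\<Phi> (F n)) < e"
proof (intro allI impI)
  fix e :: real assume "0 < e"
  then obtain M where M: "\<And>n. n \<ge> M \<Longrightarrow> \<bar>op_dist (\<Phi> (F n)) T\<bar> < e / 2"
    using LIMSEQ_D[OF convergesD(4)[OF F], of "e / 2"] by auto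
  have "op_dist (\<Phi> (F m)) (\<Phi> (F n)) < e" if "m \<ge> M" "n \<ge> M" for m n
    using op_norm_triangle_diff[of "\<Phi> (F m)" T "\<Phi> (F n)"] op_norm_diff_commute[of T "\<Phi> (F n)"]
      convergesD[OF F] M[OF that(1)] M[OF that(2)] by simp
  then show "\<exists>M. \<forall>m\<ge>M. \<forall>n\<ge>M. op_dist (\<Phi> (F m)) (\<Phi> (F n)) < e" by blast
qed

lemma converges_ex:
  assumes "\<And>n. F n \<in> carrier \<A>"
    and "\<forall>e>0. \<exists>M. \<forall>m\<ge>M. \<forall>n\<ge>M. op_dist (\<Phi> (F m)) (\<Phi> (F n)) < e"
  shows "\<exists>T. converges F T"
  using bounded_ops_complete[of "\<lambda>n. \<Phi> (F n)"] assms extend_rep_bounded(1) unfolding converges_def by blast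

lemma tendsto_ip_converges:
  assumes F: "converges F T" and x: "x \<in> carrier H" and y: "y \<in> carrier H"
  shows "(\<lambda>n. ip H (\<Phi> (F n) x) y) \<longlonglongrightarrow> ip H (T x) y"
proof (rule Lim_transform2[OF tendsto_const])
  have cl: "\<Phi> (F n) x \<in> carrier H" "T x \<in> carrier H" for n
    using convergesD[OF F] x op_closed by blast+
  have "norm (ip H (T x) y - ip H (\<Phi> (F n) x) y)
      \<le> norm (op_dist (\<Phi> (F n)) T) * (hnorm H x * hnorm H y)" for n
  proof -
    have "cmod (ip H (T x) y - ip H (\<Phi> (F n) x) y) = cmod (ip H (\<Phi> (F n) x \<ominus> T x) y)"
      using cl y by (simp add: ip_diff_left norm_minus_commute)
    also have "\<dots> \<le> hnorm H (\<Phi> (F n) x \<ominus> T x) * hnorm H y"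
      using cl y by (intro cauchy_schwarz) auto
    also have "\<dots> \<le> op_dist (\<Phi> (F n)) T * hnorm H x * hnorm H y"
      using convergesD[OF F] x y by (intro mult_right_mono hnorm_diff_op_le) auto
    finally show ?thesis
      using op_norm_diff_nonneg[OF convergesD(3,2)[OF F], of n] by (simp add: mult.assoc)
  qed
  then show "(\<lambda>n. ip H (T x) y - ip H (\<Phi> (F n) x) y) \<longlonglongrightarrow> 0"
    by (intro tendsto_0_le[where K = "hnorm H x * hnorm H y", OF convergesD(4)[OF F]] always_eventually allI)
qed

text \<open>This constructs the adjoint of T. The images of the \<open>star \<A> (F n)\<close> are
  Cauchy by \<open>op_norm_star_diff_le\<close>, and the adjoint relation passes to the limit inside
  inner products.\<close>

lemma converges_star:
  assumes F: "converges F T"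
  shows "\<exists>U. converges (\<lambda>n. star \<A> (F n)) U \<and> is_adjoint H T U"
proof -
  have "\<forall>e>0. \<exists>M. \<forall>m\<ge>M. \<forall>n\<ge>M. op_dist (\<Phi> (star \<A> (F m))) (\<Phi> (star \<A> (F n))) < e"
    using converges_cauchy[OF F] op_norm_star_diff_le[OF convergesD(1)[OF F] convergesD(1)[OF F]]
    by (meson le_less_trans)
  then obtain U where U: "converges (\<lambda>n. star \<A> (F n)) U"
    using converges_ex[of "\<lambda>n. star \<A> (F n)"] star_closed[OF convergesD(1)[OF F]] by blast
  have "ip H (T x) y = ip H x (U y)" if x: "x \<in> carrier H" and y: "y \<in> carrier H" for x y
  proof (rule LIMSEQ_unique[OF tendsto_ip_converges[OF F x y]])
    have "(\<lambda>n. cnj (ip H (\<Phi> (star \<A> (F n)) y) x)) \<longlonglongrightarrow> cnj (ip H (U y) x)"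
      by (intro tendsto_cnj tendsto_ip_converges[OF U y x])
    moreover have "cnj (ip H (U y) x) = ip H x (U y)"
      using ip_commute[of "U y" x] x op_closed[OF convergesD(2)[OF U] y] by simp
    moreover have "cnj (ip H (\<Phi> (star \<A> (F n)) y) x) = ip H (\<Phi> (F n) x) y" for n
      using x y op_closed[OF convergesD(3)[OF U] y] extend_rep_adjoint[OF convergesD(1)[OF F]]
        ip_commute[of "\<Phi> (star \<A> (F n)) y" x] by (simp add: is_adjoint_def)
    ultimately show "(\<lambda>n. ip H (\<Phi> (F n) x) y) \<longlonglongrightarrow> ip H x (U y)" by simp
  qed
  then show ?thesis using U unfolding is_adjoint_def by blast
qed

lemma star_op_algebra:
  assumes "T \<in> bounded_ops H" "U \<in> bounded_ops H" "is_adjoint H T U"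
  shows "star (op_algebra H) T = U"
  unfolding op_algebra_def using assms by (auto intro!: the_equality intro: adjoint_unique)

section \<open>The completion in a seminorm that agrees with the operator norm under \<Phi>\<close>

context
  fixes N :: "('s \<Rightarrow> complex) \<Rightarrow> real"
  assumes N: "\<And>f. f \<in> carrier \<A> \<Longrightarrow> N f = op_norm H (\<Phi> f)"
begin

lemma N_diff:
  assumes "f \<in> carrier \<A>" "g \<in> carrier \<A>"
  shows "N (f \<ominus>\<^bsub>\<A>\<^esub> g) = op_dist (\<Phi> f) (\<Phi> g)"
proof -
  interpret A: abelian_group "\<A>" by (rule abelian_group_semigroup_algebra)
  show ?thesis
    using N[OF A.minus_closed[OF assms]] op_norm_extend_rep_diff[OF assms] by simp
qed

lemma cauchy_seqs_iff: "F \<in> cauchy_seqs \<A> N \<longleftrightarrow> (\<exists>T. converges F T)"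
proof
  assume "F \<in> cauchy_seqs \<A> N"
  then have F: "\<And>n. F n \<in> carrier \<A>"
    "\<forall>e>0. \<exists>M. \<forall>m\<ge>M. \<forall>n\<ge>M. N (F m \<ominus>\<^bsub>\<A>\<^esub> F n) < e"
    unfolding cauchy_seqs_def by blast+
  show "\<exists>T. converges F T"
    by (rule converges_ex[OF F(1)]) (use F(2) in \<open>simp only: N_diff[OF F(1) F(1)]\<close>)
next
  assume "\<exists>T. converges F T"
  then obtain T where T: "converges F T" by blast
  show "F \<in> cauchy_seqs \<A> N"
    unfolding cauchy_seqs_def mem_Collect_eq
    using convergesD(1)[OF T] converges_cauchy[OF T]
    by (simp only: N_diff[OF convergesD(1)[OF T] convergesD(1)[OF T]]) blast
qed

lemma null_equiv_class:
  assumes F: "converges F T"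
  shows "null_equiv \<A> N `` {F} = {G. converges G T}"
proof -
  have "(F, G) \<in> null_equiv \<A> N \<longleftrightarrow> converges G T" for G
  proof
    assume "(F, G) \<in> null_equiv \<A> N"
    then obtain U where G: "converges G U" and
      null: "(\<lambda>n. N (F n \<ominus>\<^bsub>\<A>\<^esub> G n)) \<longlonglongrightarrow> 0"
      by (auto simp: null_equiv_def cauchy_seqs_iff)
    have "T = U"
      by (rule converges_null_eq[OF F G]) (use null in \<open>simp only: N_diff[OF convergesD(1)[OF F] convergesD(1)[OF G]]\<close>)
    then show "converges G T" using G by simp
  next
    assume G: "converges G T"
    then show "(F, G) \<in> null_equiv \<A> N"
      using F converges_eq_null[OF F G]
      by (auto simp: null_equiv_def cauchy_seqs_iff N_diff[OF convergesD(1)[OF F] convergesD(1)[OF G]]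
          simp del: semigroup_algebra_simps)
  qed
  then show ?thesis by blast
qed

lemma completion_carrier:
  "carrier (completion \<A> N) = (\<lambda>T. {F. converges F T}) ` {T. \<exists>F. converges F T}"
proof -
  have "carrier (completion \<A> N)
      = (\<Union>F\<in>{F. \<exists>T. converges F T}. {null_equiv \<A> N `` {F}})"
    unfolding completion_def quotient_def using cauchy_seqs_iff by auto
  also have "\<dots> = (\<lambda>T. {F. converges F T}) ` {T. \<exists>F. converges F T}"
    using null_equiv_class by (auto simp: image_iff)
  finally show ?thesis .
qed

lemma completion_ops:
  assumes F: "converges F T" and G: "converges G U"
  shows "{F. converges F T} \<oplus>\<^bsub>completion \<A> N\<^esub> {F. converges F U}
      = {F. converges F (\<lambda>x\<in>carrier H. T x \<oplus> U x)}"
    and "{F. converges F T} \<otimes>\<^bsub>completion \<A> N\<^esub> {F. converges F U}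
      = {F. converges F (compose (carrier H) T U)}"
    and "c \<odot>\<^bsub>completion \<A> N\<^esub> {F. converges F T}
      = {F. converges F (\<lambda>x\<in>carrier H. c \<odot> T x)}"
    and "is_adjoint H T V \<Longrightarrow> V \<in> bounded_ops H \<Longrightarrow>
      star (completion \<A> N) {F. converges F T} = {F. converges F V}"
proof -
  show "{F. converges F T} \<oplus>\<^bsub>completion \<A> N\<^esub> {F. converges F U}
      = {F. converges F (\<lambda>x\<in>carrier H. T x \<oplus> U x)}"
    using F G null_equiv_class[OF converges_add]
    by (simp add: completion_def del: semigroup_algebra_simps) blast
  show "{F. converges F T} \<otimes>\<^bsub>completion \<A> N\<^esub> {F. converges F U}
      = {F. converges F (compose (carrier H) T U)}"
    using F G null_equiv_class[OF converges_mult]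
    by (simp add: completion_def del: semigroup_algebra_simps) blast
  show "c \<odot>\<^bsub>completion \<A> N\<^esub> {F. converges F T}
      = {F. converges F (\<lambda>x\<in>carrier H. c \<odot> T x)}"
    using F null_equiv_class[OF converges_scale]
    by (simp add: completion_def del: semigroup_algebra_simps) blast
  assume V: "is_adjoint H T V" "V \<in> bounded_ops H"
  have "converges (\<lambda>n. star \<A> (F n)) V" if F: "converges F T" for F
    using converges_star[OF F] adjoint_unique[OF _ V(1) _ V(2) convergesD(2)[OF F]] convergesD(2) by metis
  then have "null_equiv \<A> N `` {\<lambda>n. star \<A> (F n)} = {F. converges F V}"
    if "converges F T" for F
    using that null_equiv_class by blast
  then show "star (completion \<A> N) {F. converges F T} = {F. converges F V}"
    using F by (simp add: completion_def del: semigroup_algebra_simps) blast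
qed

text \<open>A class is determined by its limit operator, which gives injectivity; the termwise
  operations become those of the limits. Only the values of h on classes are prescribed, as this is
  all that evaluating the definite description \<open>regular_hom\<close> provides.\<close>

lemma star_isomorphism_completion:
  assumes h: "\<And>F T. converges F T \<Longrightarrow> h {F. converges F T} = T"
  shows "star_isomorphism h (completion \<A> N)
    ((op_algebra H)\<lparr>carrier := h ` carrier (completion \<A> N)\<rparr>)"
  unfolding star_isomorphism_def
proof (intro conjI ballI allI)
  let ?C = "completion \<A> N" and ?B = "(op_algebra H)\<lparr>carrier := h ` carrier (completion \<A> N)\<rparr>"
  have C: "\<exists>T F. converges F T \<and> X = {F. converges F T}" if "X \<in> carrier ?C" for X
    using that unfolding completion_carrier by blast
  have "inj_on h (carrier ?C)"
  proof (rule inj_onI)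
    fix X Y assume "X \<in> carrier ?C" "Y \<in> carrier ?C" "h X = h Y"
    then show "X = Y" using C h by metis
  qed
  then show "bij_betw h (carrier ?C) (carrier ?B)"
    by (simp add: bij_betw_def)
  fix X assume "X \<in> carrier ?C"
  then obtain T F where F: "converges F T" and X: "X = {F. converges F T}"
    using C by blast
  show "h (c \<odot>\<^bsub>?C\<^esub> X) = c \<odot>\<^bsub>?B\<^esub> h X" for c
    unfolding X completion_ops(3)[OF F F] h[OF F] h[OF converges_scale[OF F]]
    by (simp add: op_algebra_def)
  obtain U where U: "converges (\<lambda>n. star \<A> (F n)) U" "is_adjoint H T U"
    using converges_star[OF F] by blast
  show "h (star ?C X) = star ?B (h X)"
    unfolding X completion_ops(4)[OF F F U(2) convergesD(2)[OF U(1)]] h[OF F] h[OF U(1)]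
    using star_op_algebra[OF convergesD(2)[OF F] convergesD(2)[OF U(1)] U(2)] by simp
  fix Y assume "Y \<in> carrier ?C"
  then obtain V G where G: "converges G V" and Y: "Y = {F. converges F V}"
    using C by blast
  show "h (X \<oplus>\<^bsub>?C\<^esub> Y) = h X \<oplus>\<^bsub>?B\<^esub> h Y"
    unfolding X Y completion_ops(1)[OF F G] h[OF F] h[OF G] h[OF converges_add[OF F G]]
    by (simp add: op_algebra_def)
  show "h (X \<otimes>\<^bsub>?C\<^esub> Y) = h X \<otimes>\<^bsub>?B\<^esub> h Y"
    unfolding X Y completion_ops(2)[OF F G] h[OF F] h[OF G] h[OF converges_mult[OF F G]]
    by (simp add: op_algebra_def)
qed

end

end

text \<open>Under the domination hypothesis the full seminorm of f is the norm of \<Lambda>(f), so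
  the classes of Cauchy sequences correspond one to one to their limits in operator norm.\<close>

theorem (in inverse_semigroup) weak_containmentI:
  assumes "\<And>(H :: (('s \<Rightarrow> complex) + 'h) hilbert) \<pi> f x. representation S H \<pi> \<Longrightarrow>
      f \<in> carrier \<A> \<Longrightarrow> x \<in> carrier H \<Longrightarrow>
      hnorm H (extend_rep H \<pi> f x)
        \<le> op_norm \<L> (extend_rep \<L> (regular_rep S) f) * hnorm H x"
  shows "weak_containment TYPE('h) S"
proof -
  interpret L: semigroup_rep S \<L> "regular_rep S"
    by (rule semigroup_repI[OF representation_regular])
  have N: "full_norm TYPE('h) S f = op_norm \<L> (L.\<Phi> f)"
    if "f \<in> carrier \<A>" for f
    using assms that by (intro full_norm_eq_regular)
  have h: "regular_hom S {F. L.converges F T} = T" if F: "L.converges F T" for F T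
    unfolding regular_hom_def Let_def
  proof (rule the_equality)
    show "T \<in> bounded_ops \<L> \<and> (\<forall>F\<in>{F. L.converges F T}.
        (\<lambda>n. op_norm \<L> (\<lambda>x. L.\<Phi> (F n) x \<ominus>\<^bsub>\<L>\<^esub> T x)) \<longlonglongrightarrow> 0)"
      using F L.convergesD(2,4) by blast
    fix U assume "U \<in> bounded_ops \<L> \<and> (\<forall>F\<in>{F. L.converges F T}.
        (\<lambda>n. op_norm \<L> (\<lambda>x. L.\<Phi> (F n) x \<ominus>\<^bsub>\<L>\<^esub> U x)) \<longlonglongrightarrow> 0)"
    then have "L.converges F U"
      using F unfolding L.converges_def by blast
    then show "U = T"
      using L.converges_unique F by blast
  qed
  show ?thesis
    unfolding weak_containment_def reduced_algebra_def full_algebra_def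
    by (intro conjI inverse_semigroup_axioms L.star_isomorphism_completion) (erule N, erule h)
qed

section \<open>Graph inverse semigroups\<close>

text \<open>Paths are pairs; these rules would break a quantified path into an edge list and a
  vertex.\<close>

declare split_paired_Ex [simp del] split_paired_All [simp del]

lemma src_simps [simp]: "src (p, v) = v" "src (concat_path \<mu> \<nu>) = src \<nu>"
  by (simp_all add: src_def concat_path_def)

lemma fst_concat_path [simp]: "fst (concat_path \<mu> \<nu>) = fst \<mu> @ fst \<nu>"
  by (simp add: concat_path_def)

lemma path_eqI: "fst \<mu> = fst \<nu> \<Longrightarrow> src \<mu> = src \<nu> \<Longrightarrow> \<mu> = \<nu>"
  by (simp add: src_def prod_eq_iff)

lemma concat_path_assoc: "concat_path (concat_path \<mu> \<nu>) \<gamma> = concat_path \<mu> (concat_path \<nu> \<gamma>)"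
  by (rule path_eqI) simp_all

definition vpath :: "'v \<Rightarrow> ('v, 'e) gpath" where
  "vpath v = ([], v)"

lemma vpath_simps [simp]: "fst (vpath v) = []" "src (vpath v) = v"
  by (simp_all add: vpath_def src_def)

lemma concat_vpath [simp]:
  "concat_path (vpath v) \<mu> = \<mu>"
  "src \<mu> = v \<Longrightarrow> concat_path \<mu> (vpath v) = \<mu>"
  by (auto intro: path_eqI)

lemma graph_inverse_semigroup_simps [simp]:
  "sprod (graph_inverse_semigroup G) = graph_prod G"
  "sadj (graph_inverse_semigroup G) = graph_adj"
  "Zero \<in> carrier (graph_inverse_semigroup G)"
  "Elem \<mu> \<nu> \<in> carrier (graph_inverse_semigroup G)
    \<longleftrightarrow> \<mu> \<in> paths G \<and> \<nu> \<in> paths G \<and> src \<mu> = src \<nu>"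
  by (simp_all add: graph_inverse_semigroup_def)

lemma graph_prod_Zero [simp]: "graph_prod G x Zero = Zero"
  by (cases x) simp_all

lemma factors_unique: "factors G \<nu> \<alpha> \<gamma> \<Longrightarrow> factors G \<nu> \<alpha> \<gamma>' \<Longrightarrow> \<gamma> = \<gamma>'"
  by (auto simp: factors_def concat_path_def src_def intro: prod_eqI)

lemma the_factors: "factors G \<nu> \<alpha> \<gamma> \<Longrightarrow> (THE \<gamma>. factors G \<nu> \<alpha> \<gamma>) = \<gamma>"
  using factors_unique by (metis the_equality)

lemma graph_prod_factors_left:
  assumes "factors G \<nu> \<alpha> \<gamma>"
  shows "graph_prod G (Elem \<mu> \<nu>) (Elem \<alpha> \<beta>) = Elem \<mu> (concat_path \<beta> \<gamma>)"
  unfolding graph_prod.simps if_P[OF exI[of "factors G \<nu> \<alpha>", OF assms]] the_factors[OF assms] ..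

lemma graph_prod_factors_right:
  assumes "\<nexists>\<gamma>. factors G \<nu> \<alpha> \<gamma>" "factors G \<alpha> \<nu> \<gamma>"
  shows "graph_prod G (Elem \<mu> \<nu>) (Elem \<alpha> \<beta>) = Elem (concat_path \<mu> \<gamma>) \<beta>"
  unfolding graph_prod.simps if_not_P[OF assms(1)] if_P[OF exI[of "factors G \<alpha> \<nu>", OF assms(2)]]
    the_factors[OF assms(2)] ..

context wf_digraph
begin

lemma rng_simps [simp]: "rng G ([], v) = v" "rng G (vpath v) = v" "rng G (e # p, v) = head G e"
  by (simp_all add: rng_def vpath_def awalk_verts_conv)

lemma rng_append: "rng G (p @ q, v) = rng G (p, rng G (q, v))"
  by (cases p) simp_all

lemma rng_concat [simp]: "src \<mu> = rng G \<nu> \<Longrightarrow> rng G (concat_path \<mu> \<nu>) = rng G \<mu>"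
  by (cases \<mu>; cases \<nu>) (simp add: concat_path_def rng_append)

lemma vpath_in_paths [simp]: "vpath v \<in> paths G \<longleftrightarrow> v \<in> verts G" "([], v) \<in> paths G \<longleftrightarrow> v \<in> verts G"
  by (simp_all add: paths_def rng_def vpath_def awalk_simps)

lemma Cons_in_paths [simp]:
  "(e # p, v) \<in> paths G \<longleftrightarrow> (p, v) \<in> paths G \<and> e \<in> arcs G \<and> tail G e = rng G (p, v)"
  using head_in_verts by (auto simp: paths_def awalk_append_iff awalk_simps rng_def awalk_verts_conv)

lemma src_in_verts: "\<mu> \<in> paths G \<Longrightarrow> src \<mu> \<in> verts G"
  by (auto simp: paths_def)

lemma rng_in_verts: "\<mu> \<in> paths G \<Longrightarrow> rng G \<mu> \<in> verts G"
  by (auto simp: paths_def awalk_last_in_verts)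

lemma append_in_paths: "(p @ q, v) \<in> paths G \<longleftrightarrow> (q, v) \<in> paths G \<and> (p, rng G (q, v)) \<in> paths G"
  by (induction p) (auto simp: rng_append dest: rng_in_verts)

lemma concat_in_paths:
  "src \<mu> = rng G \<nu> \<Longrightarrow> concat_path \<mu> \<nu> \<in> paths G \<longleftrightarrow> \<mu> \<in> paths G \<and> \<nu> \<in> paths G"
  by (cases \<mu>; cases \<nu>) (auto simp: concat_path_def append_in_paths)

section \<open>Products evaluated by comparing prefixes\<close>

lemma graph_prod_concat_left:
  assumes "\<gamma> \<in> paths G" "src \<alpha> = rng G \<gamma>"
  shows "graph_prod G (Elem \<mu> (concat_path \<alpha> \<gamma>)) (Elem \<alpha> \<beta>) = Elem \<mu> (concat_path \<beta> \<gamma>)"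
proof -
  have "factors G (concat_path \<alpha> \<gamma>) \<alpha> \<gamma>"
    using assms by (simp add: factors_def)
  then show ?thesis by (rule graph_prod_factors_left)
qed

text \<open>The product tests the opposite factorization first. If that succeeds as well, both
  quotient paths have no edges, so appending them changes nothing and the two clauses give the same
  element.\<close>

lemma graph_prod_concat_right:
  assumes \<gamma>: "\<gamma> \<in> paths G" "src \<nu> = rng G \<gamma>" and "src \<mu> = src \<nu>" "src \<beta> = src \<gamma>"
  shows "graph_prod G (Elem \<mu> \<nu>) (Elem (concat_path \<nu> \<gamma>) \<beta>) = Elem (concat_path \<mu> \<gamma>) \<beta>"
proof (cases "\<exists>\<gamma>'. factors G \<nu> (concat_path \<nu> \<gamma>) \<gamma>'")
  case True
  then obtain \<gamma>' where \<gamma>': "factors G \<nu> (concat_path \<nu> \<gamma>) \<gamma>'" by blast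
  then have "fst \<nu> = fst \<nu> @ fst \<gamma> @ fst \<gamma>'" "src \<gamma> = rng G \<gamma>'" "src \<nu> = src \<gamma>'"
    unfolding factors_def by (metis append.assoc fst_concat_path, simp, metis src_simps(2))
  then have 1: "fst \<gamma> = []" "fst \<gamma>' = []" "src \<gamma> = src \<gamma>'" "src \<nu> = src \<gamma>'"
    by (auto simp: rng_def awalk_verts_conv)
  then have "concat_path \<beta> \<gamma>' = \<beta>" "concat_path \<mu> \<gamma> = \<mu>"
    using assms by (auto intro: path_eqI)
  then show ?thesis using graph_prod_factors_left[OF \<gamma>'] by simp
next
  case False
  have "factors G (concat_path \<nu> \<gamma>) \<nu> \<gamma>"
    using \<gamma> by (simp add: factors_def)
  with False show ?thesis by (rule graph_prod_factors_right)
qed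

lemma graph_prod_Zero_iff:
  "graph_prod G (Elem \<mu> \<nu>) (Elem \<alpha> \<beta>) = Zero
    \<longleftrightarrow> (\<forall>\<gamma>. \<not> factors G \<nu> \<alpha> \<gamma>) \<and> (\<forall>\<gamma>. \<not> factors G \<alpha> \<nu> \<gamma>)"
  by auto

lemma graph_prod_cases:
  assumes s: "Elem \<mu> \<nu> \<in> carrier (graph_inverse_semigroup G)"
    and t: "Elem \<alpha> \<beta> \<in> carrier (graph_inverse_semigroup G)"
  obtains \<gamma> where "\<gamma> \<in> paths G" "src \<alpha> = rng G \<gamma>" "\<nu> = concat_path \<alpha> \<gamma>"
      "graph_prod G (Elem \<mu> \<nu>) (Elem \<alpha> \<beta>) = Elem \<mu> (concat_path \<beta> \<gamma>)"
  | \<gamma> where "\<gamma> \<in> paths G" "src \<nu> = rng G \<gamma>" "\<alpha> = concat_path \<nu> \<gamma>"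
      "graph_prod G (Elem \<mu> \<nu>) (Elem \<alpha> \<beta>) = Elem (concat_path \<mu> \<gamma>) \<beta>"
  | "graph_prod G (Elem \<mu> \<nu>) (Elem \<alpha> \<beta>) = Zero"
      "\<And>\<gamma>. \<not> factors G \<nu> \<alpha> \<gamma>" "\<And>\<gamma>. \<not> factors G \<alpha> \<nu> \<gamma>"
proof (cases "graph_prod G (Elem \<mu> \<nu>) (Elem \<alpha> \<beta>) = Zero")
  case True
  then show ?thesis using that(3) graph_prod_Zero_iff by blast
next
  case False
  then consider \<gamma> where "factors G \<nu> \<alpha> \<gamma>" | \<gamma> where "factors G \<alpha> \<nu> \<gamma>"
    using graph_prod_Zero_iff by blast
  then show ?thesis
  proof cases
    case 1
    then have "\<gamma> \<in> paths G" "src \<alpha> = rng G \<gamma>" "\<nu> = concat_path \<alpha> \<gamma>"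
      by (simp_all add: factors_def)
    then show ?thesis using that(1) graph_prod_concat_left by metis
  next
    case 2
    then have *: "\<gamma> \<in> paths G" "src \<nu> = rng G \<gamma>" "\<alpha> = concat_path \<nu> \<gamma>"
      by (simp_all add: factors_def)
    moreover have "src \<mu> = src \<nu>" "src \<beta> = src \<gamma>"
      using s t * by simp_all
    ultimately show ?thesis using that(2) graph_prod_concat_right by metis
  qed
qed

text \<open>
  The element \<open>(\<mu>, \<nu>)\<close> acts on the path space by the partial injection \<open>\<nu>\<gamma> \<mapsto> \<mu>\<gamma>\<close>.  This
  action is faithful, so the axioms can be checked on relations.
\<close>

fun path_rel :: "('a, 'b) graph_elem \<Rightarrow> ('a, 'b) gpath rel" where
  "path_rel (Elem \<mu> \<nu>) = {(concat_path \<nu> \<gamma>, concat_path \<mu> \<gamma>) |\<gamma>. \<gamma> \<in> paths G \<and> rng G \<gamma> = src \<nu>}"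
| "path_rel Zero = {}"

lemma path_rel_iff:
  "(x, y) \<in> path_rel (Elem \<mu> \<nu>) \<longleftrightarrow>
    (\<exists>\<gamma>. \<gamma> \<in> paths G \<and> rng G \<gamma> = src \<nu> \<and> x = concat_path \<nu> \<gamma> \<and> y = concat_path \<mu> \<gamma>)"
  by auto

text \<open>The pair (\<nu>, \<mu>) itself belongs to the relation of (\<mu>, \<nu>), through the
  extension of length zero. If the relations of (\<mu>, \<nu>) and (\<alpha>, \<beta>) agree, then
  \<nu> and \<beta> extend each other, so the extending path is a vertex.\<close>

lemma path_rel_inj:
  assumes s: "s \<in> carrier (graph_inverse_semigroup G)" and t: "t \<in> carrier (graph_inverse_semigroup G)"
    and eq: "path_rel s = path_rel t"
  shows "s = t"
proof -
  have base: "(\<nu>, \<mu>) \<in> path_rel (Elem \<mu> \<nu>)" if "Elem \<mu> \<nu> \<in> carrier (graph_inverse_semigroup G)" for \<mu> \<nu>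
  proof -
    have "src \<nu> \<in> verts G" "src \<mu> = src \<nu>"
      using that src_in_verts[of \<nu>] by simp_all
    then show ?thesis
      by (auto intro!: exI[of _ "vpath (src \<nu>)"])
  qed
  show ?thesis
  proof (cases s)
    case Zero
    then have "path_rel t = {}" using eq by simp
    then have "t \<noteq> Elem \<alpha> \<beta>" for \<alpha> \<beta>
      using base[of \<alpha> \<beta>] t by blast
    then show ?thesis using Zero by (metis graph_elem.exhaust)
  next
    case (Elem \<mu> \<nu>)
    then have mem: "(\<nu>, \<mu>) \<in> path_rel t"
      using base[of \<mu> \<nu>] s eq by blast
    then obtain \<alpha> \<beta> where t': "t = Elem \<alpha> \<beta>" by (cases t) auto
    have mem': "(\<beta>, \<alpha>) \<in> path_rel s"
      using base[of \<alpha> \<beta>] t t' eq by blast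
    obtain \<gamma> where \<gamma>: "\<nu> = concat_path \<beta> \<gamma>" "\<mu> = concat_path \<alpha> \<gamma>" "rng G \<gamma> = src \<beta>"
      using mem unfolding t' path_rel_iff by blast
    obtain \<gamma>' where "\<beta> = concat_path \<nu> \<gamma>'"
      using mem' unfolding Elem path_rel_iff by blast
    then have "fst \<beta> = fst \<beta> @ fst \<gamma> @ fst \<gamma>'"
      using \<gamma>(1) by (metis append.assoc fst_concat_path)
    then have "\<gamma> = vpath (src \<gamma>)" by (intro path_eqI) simp_all
    then have "src \<gamma> = src \<beta>" using \<gamma>(3) rng_simps(2) by metis
    then have "\<nu> = \<beta>" "\<mu> = \<alpha>"
      using \<gamma>(1,2) \<open>\<gamma> = vpath (src \<gamma>)\<close> t t' concat_vpath(2) by (metis, metis graph_inverse_semigroup_simps(4))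
    then show ?thesis using Elem t' by simp
  qed
qed

lemma path_rel_prod:
  assumes s: "s \<in> carrier (graph_inverse_semigroup G)" and t: "t \<in> carrier (graph_inverse_semigroup G)"
  shows "path_rel (graph_prod G s t) = path_rel t O path_rel s"
proof (cases "s = Zero \<or> t = Zero")
  case True
  then show ?thesis by auto
next
  case False
  then obtain \<mu> \<nu> \<alpha> \<beta> where st: "s = Elem \<mu> \<nu>" "t = Elem \<alpha> \<beta>"
    by (meson graph_elem.exhaust)
  have src: "src \<mu> = src \<nu>" "src \<alpha> = src \<beta>"
    using s t st by simp_all
  show ?thesis
    using s t unfolding st
  proof (cases rule: graph_prod_cases)
    case (1 \<gamma>)
    have "(x, y) \<in> path_rel t O path_rel s \<longleftrightarrow> (\<exists>\<delta>. \<delta> \<in> paths G \<and> rng G \<delta> = src \<gamma> \<and>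
        x = concat_path \<beta> (concat_path \<gamma> \<delta>) \<and> y = concat_path \<mu> \<delta>)" for x y
    proof
      assume "(x, y) \<in> path_rel t O path_rel s"
      then obtain \<delta> \<epsilon> where *: "\<delta> \<in> paths G" "rng G \<delta> = src \<beta>" "x = concat_path \<beta> \<delta>"
        "\<epsilon> \<in> paths G" "rng G \<epsilon> = src \<nu>" "y = concat_path \<mu> \<epsilon>" "concat_path \<alpha> \<delta> = concat_path \<nu> \<epsilon>"
        unfolding st by auto
      have "\<delta> = concat_path \<gamma> \<epsilon>"
        using *(7) unfolding 1(3) concat_path_assoc by (auto simp: concat_path_def src_def prod_eq_iff)
      then show "\<exists>\<delta>. \<delta> \<in> paths G \<and> rng G \<delta> = src \<gamma> \<and>
          x = concat_path \<beta> (concat_path \<gamma> \<delta>) \<and> y = concat_path \<mu> \<delta>"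
        using *(3-6) 1(3) by (intro exI[of _ \<epsilon>]) simp
    next
      assume "\<exists>\<delta>. \<delta> \<in> paths G \<and> rng G \<delta> = src \<gamma> \<and>
          x = concat_path \<beta> (concat_path \<gamma> \<delta>) \<and> y = concat_path \<mu> \<delta>"
      then obtain \<delta> where *: "\<delta> \<in> paths G" "rng G \<delta> = src \<gamma>"
          "x = concat_path \<beta> (concat_path \<gamma> \<delta>)" "y = concat_path \<mu> \<delta>" by blast
      have "concat_path \<gamma> \<delta> \<in> paths G" "rng G (concat_path \<gamma> \<delta>) = src \<beta>"
        using * 1 src by (auto simp: concat_in_paths)
      then have "(x, concat_path \<alpha> (concat_path \<gamma> \<delta>)) \<in> path_rel t"
        unfolding st *(3) by auto
      moreover have "(concat_path \<alpha> (concat_path \<gamma> \<delta>), y) \<in> path_rel s"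
        unfolding st *(4) 1(3) concat_path_assoc[symmetric] using * 1 by auto
      ultimately show "(x, y) \<in> path_rel t O path_rel s" by blast
    qed
    note rel = this
    show "path_rel (graph_prod G (Elem \<mu> \<nu>) (Elem \<alpha> \<beta>)) = path_rel (Elem \<alpha> \<beta>) O path_rel (Elem \<mu> \<nu>)"
    proof (rule Set.set_eqI)
      fix p
      have "p \<in> path_rel (Elem \<mu> (concat_path \<beta> \<gamma>)) \<longleftrightarrow> (\<exists>\<delta>. \<delta> \<in> paths G \<and> rng G \<delta> = src \<gamma> \<and>
          fst p = concat_path \<beta> (concat_path \<gamma> \<delta>) \<and> snd p = concat_path \<mu> \<delta>)"
        using 1 src by (auto simp: concat_path_assoc prod_eq_iff[of p])
      then show "p \<in> path_rel (graph_prod G (Elem \<mu> \<nu>) (Elem \<alpha> \<beta>))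
          \<longleftrightarrow> p \<in> path_rel (Elem \<alpha> \<beta>) O path_rel (Elem \<mu> \<nu>)"
        using rel[of "fst p" "snd p"] unfolding 1(4) st prod.collapse by (rule trans[OF _ sym])
    qed
  next
    case (2 \<gamma>)
    have "(x, y) \<in> path_rel t O path_rel s \<longleftrightarrow> (\<exists>\<delta>. \<delta> \<in> paths G \<and> rng G \<delta> = src \<gamma> \<and>
        x = concat_path \<beta> \<delta> \<and> y = concat_path \<mu> (concat_path \<gamma> \<delta>))" for x y
    proof
      assume "(x, y) \<in> path_rel t O path_rel s"
      then obtain \<delta> \<epsilon> where *: "\<delta> \<in> paths G" "rng G \<delta> = src \<beta>" "x = concat_path \<beta> \<delta>"
        "\<epsilon> \<in> paths G" "rng G \<epsilon> = src \<nu>" "y = concat_path \<mu> \<epsilon>" "concat_path \<alpha> \<delta> = concat_path \<nu> \<epsilon>"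
        unfolding st by auto
      have "\<epsilon> = concat_path \<gamma> \<delta>"
        using *(7) unfolding 2(3) concat_path_assoc by (auto simp: concat_path_def src_def prod_eq_iff)
      then show "\<exists>\<delta>. \<delta> \<in> paths G \<and> rng G \<delta> = src \<gamma> \<and>
          x = concat_path \<beta> \<delta> \<and> y = concat_path \<mu> (concat_path \<gamma> \<delta>)"
        using * 2 src by auto
    next
      assume "\<exists>\<delta>. \<delta> \<in> paths G \<and> rng G \<delta> = src \<gamma> \<and>
          x = concat_path \<beta> \<delta> \<and> y = concat_path \<mu> (concat_path \<gamma> \<delta>)"
      then obtain \<delta> where *: "\<delta> \<in> paths G" "rng G \<delta> = src \<gamma>"
          "x = concat_path \<beta> \<delta>" "y = concat_path \<mu> (concat_path \<gamma> \<delta>)" by blast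
      have "concat_path \<gamma> \<delta> \<in> paths G" "rng G (concat_path \<gamma> \<delta>) = src \<nu>"
        using * 2 src by (auto simp: concat_in_paths)
      then have "(concat_path \<nu> (concat_path \<gamma> \<delta>), y) \<in> path_rel s"
        unfolding st *(4) by auto
      moreover have "(x, concat_path \<nu> (concat_path \<gamma> \<delta>)) \<in> path_rel t"
        using * 2 src unfolding st *(3) 2(3) concat_path_assoc[symmetric] by auto
      ultimately show "(x, y) \<in> path_rel t O path_rel s" by blast
    qed
    note rel = this
    show "path_rel (graph_prod G (Elem \<mu> \<nu>) (Elem \<alpha> \<beta>)) = path_rel (Elem \<alpha> \<beta>) O path_rel (Elem \<mu> \<nu>)"
    proof (rule Set.set_eqI)
      fix p
      have "p \<in> path_rel (Elem (concat_path \<mu> \<gamma>) \<beta>) \<longleftrightarrow> (\<exists>\<delta>. \<delta> \<in> paths G \<and> rng G \<delta> = src \<gamma> \<and>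
          fst p = concat_path \<beta> \<delta> \<and> snd p = concat_path \<mu> (concat_path \<gamma> \<delta>))"
        using 2 src by (auto simp: concat_path_assoc prod_eq_iff[of p])
      then show "p \<in> path_rel (graph_prod G (Elem \<mu> \<nu>) (Elem \<alpha> \<beta>))
          \<longleftrightarrow> p \<in> path_rel (Elem \<alpha> \<beta>) O path_rel (Elem \<mu> \<nu>)"
        using rel[of "fst p" "snd p"] unfolding 2(4) st prod.collapse by (rule trans[OF _ sym])
    qed
  next
    case 3
    \<comment> \<open>Of two paths with a common extension one is a prefix of the other, and then
      the product is not zero.\<close>
    have no: False if *: "\<delta> \<in> paths G" "rng G \<delta> = src \<alpha>" "\<epsilon> \<in> paths G" "rng G \<epsilon> = src \<nu>"
      "concat_path \<alpha> \<delta> = concat_path \<nu> \<epsilon>" for \<delta> \<epsilon>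
    proof -
      have eq: "fst \<alpha> @ fst \<delta> = fst \<nu> @ fst \<epsilon>" "src \<delta> = src \<epsilon>"
        using *(5) by (metis fst_concat_path, metis src_simps(2))
      then consider d where "fst \<alpha> = fst \<nu> @ d" "fst \<epsilon> = d @ fst \<delta>" | d where "fst \<nu> = fst \<alpha> @ d" "fst \<delta> = d @ fst \<epsilon>"
        using append_eq_append_conv2[of "fst \<alpha>" "fst \<delta>" "fst \<nu>" "fst \<epsilon>"] by metis
      then show False
      proof cases
        case 1
        have \<epsilon>: "\<epsilon> = concat_path (d, src \<alpha>) \<delta>"
          using 1 eq by (intro path_eqI) simp_all
        then have "(d, src \<alpha>) \<in> paths G" "rng G (d, src \<alpha>) = src \<nu>"
          using * concat_in_paths[of "(d, src \<alpha>)" \<delta>] rng_concat[of "(d, src \<alpha>)" \<delta>] by auto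
        then have "factors G \<alpha> \<nu> (d, src \<alpha>)"
          using 1 by (auto simp: factors_def intro: path_eqI)
        then show False using 3 by blast
      next
        case 2
        have \<delta>: "\<delta> = concat_path (d, src \<nu>) \<epsilon>"
          using 2 eq by (intro path_eqI) simp_all
        then have "(d, src \<nu>) \<in> paths G" "rng G (d, src \<nu>) = src \<alpha>"
          using * concat_in_paths[of "(d, src \<nu>)" \<epsilon>] rng_concat[of "(d, src \<nu>)" \<epsilon>] by auto
        then have "factors G \<nu> \<alpha> (d, src \<nu>)"
          using 2 by (auto simp: factors_def intro: path_eqI)
        then show False using 3 by blast
      qed
    qed
    have "(x, y) \<notin> path_rel (Elem \<alpha> \<beta>) O path_rel (Elem \<mu> \<nu>)" for x y
    proof
      assume "(x, y) \<in> path_rel (Elem \<alpha> \<beta>) O path_rel (Elem \<mu> \<nu>)"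
      then obtain w where "(x, w) \<in> path_rel (Elem \<alpha> \<beta>)" "(w, y) \<in> path_rel (Elem \<mu> \<nu>)"
        by blast
      then show False using no src unfolding path_rel_iff by metis
    qed
    then have "p \<notin> path_rel (Elem \<alpha> \<beta>) O path_rel (Elem \<mu> \<nu>)" for p
      by (metis prod.collapse)
    then have "path_rel (Elem \<alpha> \<beta>) O path_rel (Elem \<mu> \<nu>) = {}"
      by blast
    then show "path_rel (graph_prod G (Elem \<mu> \<nu>) (Elem \<alpha> \<beta>)) = path_rel (Elem \<alpha> \<beta>) O path_rel (Elem \<mu> \<nu>)"
      unfolding 3(1) by simp
  qed
qed

section \<open>The inverse semigroup axioms, read off from partial injections\<close>

lemma path_rel_adj:
  "s \<in> carrier (graph_inverse_semigroup G) \<Longrightarrow> path_rel (graph_adj s) = (path_rel s)\<inverse>"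
  by (cases s) auto

lemma path_rel_single_valued:
  assumes "(x, y) \<in> path_rel s" "(x, z) \<in> path_rel s"
  shows "y = z"
  using assms by (cases s) (auto simp: concat_path_def src_def prod_eq_iff)

lemma path_rel_injective:
  assumes "(x, z) \<in> path_rel s" "(y, z) \<in> path_rel s"
  shows "x = y"
  using assms by (cases s) (auto simp: concat_path_def src_def prod_eq_iff)

lemma graph_prod_closed:
  assumes s: "s \<in> carrier (graph_inverse_semigroup G)" and t: "t \<in> carrier (graph_inverse_semigroup G)"
  shows "graph_prod G s t \<in> carrier (graph_inverse_semigroup G)"
proof (cases "s = Zero \<or> t = Zero")
  case True
  then show ?thesis by auto
next
  case False
  then obtain \<mu> \<nu> \<alpha> \<beta> where st: "s = Elem \<mu> \<nu>" "t = Elem \<alpha> \<beta>"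
    by (meson graph_elem.exhaust)
  show ?thesis
    using s t unfolding st
  proof (cases rule: graph_prod_cases)
    case (1 \<gamma>)
    then show "graph_prod G (Elem \<mu> \<nu>) (Elem \<alpha> \<beta>) \<in> carrier (graph_inverse_semigroup G)"
      unfolding 1(4) using s t st by (auto simp: concat_in_paths)
  next
    case (2 \<gamma>)
    then show "graph_prod G (Elem \<mu> \<nu>) (Elem \<alpha> \<beta>) \<in> carrier (graph_inverse_semigroup G)"
      unfolding 2(4) using s t st by (auto simp: concat_in_paths)
  next
    case 3
    then show "graph_prod G (Elem \<mu> \<nu>) (Elem \<alpha> \<beta>) \<in> carrier (graph_inverse_semigroup G)"
      unfolding 3(1) by simp
  qed
qed

lemma graph_adj_closed:
  "s \<in> carrier (graph_inverse_semigroup G) \<Longrightarrow> graph_adj s \<in> carrier (graph_inverse_semigroup G)"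
  by (cases s) auto

lemma path_rel_triple:
  assumes "s \<in> carrier (graph_inverse_semigroup G)" "t \<in> carrier (graph_inverse_semigroup G)"
  shows "path_rel (graph_prod G (graph_prod G s t) s) = path_rel s O path_rel t O path_rel s"
  using assms by (simp add: path_rel_prod graph_prod_closed O_assoc)

text \<open>As the relation of s is a partial injection, a path from x to y through the triple
  composition has to go to y, back to x by t, and to y again. Used for both equations of an inverse,
  this shows that the relation of t is exactly the converse.\<close>

lemma path_rel_triple_subset:
  assumes "path_rel s O path_rel t O path_rel s = path_rel s"
  shows "(path_rel s)\<inverse> \<subseteq> path_rel t"
proof
  fix p assume "p \<in> (path_rel s)\<inverse>"
  then obtain x y where p: "p = (y, x)" "(x, y) \<in> path_rel s" by auto
  then obtain a b where ab: "(x, a) \<in> path_rel s" "(a, b) \<in> path_rel t" "(b, y) \<in> path_rel s"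
    using assms by blast
  then have "a = y" "b = x"
    using p path_rel_single_valued path_rel_injective by blast+
  then show "p \<in> path_rel t" using ab p by simp
qed

lemma inverse_semigroup_graph: "inverse_semigroup (graph_inverse_semigroup G)"
proof
  fix s t u
  assume s: "s \<in> carrier (graph_inverse_semigroup G)" and t: "t \<in> carrier (graph_inverse_semigroup G)"
    and u: "u \<in> carrier (graph_inverse_semigroup G)"
  have "graph_prod G (graph_prod G s t) u = graph_prod G s (graph_prod G t u)"
    by (rule path_rel_inj) (use s t u in \<open>auto simp: path_rel_prod graph_prod_closed simp del: graph_prod.simps\<close>)
  then show "sprod (graph_inverse_semigroup G) (sprod (graph_inverse_semigroup G) s t) u
      = sprod (graph_inverse_semigroup G) s (sprod (graph_inverse_semigroup G) t u)" by simp
next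
  fix s assume s: "s \<in> carrier (graph_inverse_semigroup G)"
  have inv: "path_rel r O (path_rel r)\<inverse> O path_rel r = path_rel r" for r
  proof (intro equalityI subrelI)
    fix x y assume "(x, y) \<in> path_rel r O (path_rel r)\<inverse> O path_rel r"
    then obtain a b where "(x, a) \<in> path_rel r" "(b, a) \<in> path_rel r" "(b, y) \<in> path_rel r"
      by blast
    then show "(x, y) \<in> path_rel r"
      using path_rel_injective by metis
  qed blast
  have "graph_prod G (graph_prod G s (graph_adj s)) s = s"
  proof (rule path_rel_inj)
    show "path_rel (graph_prod G (graph_prod G s (graph_adj s)) s) = path_rel s"
      unfolding path_rel_triple[OF s graph_adj_closed[OF s]] path_rel_adj[OF s] by (rule inv)
  qed (use s in \<open>auto intro!: graph_prod_closed graph_adj_closed\<close>)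
  then show "sprod (graph_inverse_semigroup G) (sprod (graph_inverse_semigroup G) s (sadj (graph_inverse_semigroup G) s)) s = s"
    by simp
  have "graph_prod G (graph_prod G (graph_adj s) s) (graph_adj s) = graph_adj s"
  proof (rule path_rel_inj)
    show "path_rel (graph_prod G (graph_prod G (graph_adj s) s) (graph_adj s)) = path_rel (graph_adj s)"
      using inv[of "graph_adj s"]
      unfolding path_rel_triple[OF graph_adj_closed[OF s] s] path_rel_adj[OF s] converse_converse .
  qed (use s in \<open>auto intro!: graph_prod_closed graph_adj_closed\<close>)
  then show "sprod (graph_inverse_semigroup G) (sprod (graph_inverse_semigroup G) (sadj (graph_inverse_semigroup G) s) s)
      (sadj (graph_inverse_semigroup G) s) = sadj (graph_inverse_semigroup G) s"
    by simp
next
  fix s t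
  assume s: "s \<in> carrier (graph_inverse_semigroup G)" and t: "t \<in> carrier (graph_inverse_semigroup G)"
    and "sprod (graph_inverse_semigroup G) (sprod (graph_inverse_semigroup G) s t) s = s"
    and "sprod (graph_inverse_semigroup G) (sprod (graph_inverse_semigroup G) t s) t = t"
  then have "path_rel s O path_rel t O path_rel s = path_rel s" "path_rel t O path_rel s O path_rel t = path_rel t"
    using path_rel_triple[OF s t] path_rel_triple[OF t s] by simp_all
  note this[THEN path_rel_triple_subset]
  then have "path_rel t = (path_rel s)\<inverse>"
    by fast
  then have "path_rel t = path_rel (graph_adj s)"
    by (simp only: path_rel_adj[OF s])
  then have "t = graph_adj s"
    by (rule path_rel_inj[OF t graph_adj_closed[OF s]])
  then show "t = sadj (graph_inverse_semigroup G) s" by simp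
qed (auto intro: graph_prod_closed graph_adj_closed)

end

section \<open>Positive semidefinite kernels\<close>

definition psd :: "'i set \<Rightarrow> ('i \<Rightarrow> 'i \<Rightarrow> complex) \<Rightarrow> bool" where
  "psd D K \<longleftrightarrow> (\<forall>i\<in>D. \<forall>j\<in>D. K j i = cnj (K i j)) \<and>
     (\<forall>c. 0 \<le> Re (\<Sum>i\<in>D. \<Sum>j\<in>D. c i * cnj (c j) * K i j))"

lemma psd_hermitian: "psd D K \<Longrightarrow> i \<in> D \<Longrightarrow> j \<in> D \<Longrightarrow> K j i = cnj (K i j)"
  unfolding psd_def by blast

lemma psd_nonneg: "psd D K \<Longrightarrow> 0 \<le> Re (\<Sum>i\<in>D. \<Sum>j\<in>D. c i * cnj (c j) * K i j)"
  unfolding psd_def by blast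

lemma psd_add:
  assumes "psd D K" "psd D L"
  shows "psd D (\<lambda>i j. K i j + L i j)"
  unfolding psd_def
proof (intro conjI allI)
  show "\<forall>i\<in>D. \<forall>j\<in>D. K j i + L j i = cnj (K i j + L i j)"
  proof (intro ballI)
    fix i j assume "i \<in> D" "j \<in> D"
    then have "K j i = cnj (K i j)" "L j i = cnj (L i j)"
      using assms by (auto intro: psd_hermitian)
    then show "K j i + L j i = cnj (K i j + L i j)"
      by (simp only: complex_cnj_add)
  qed
  show "0 \<le> Re (\<Sum>i\<in>D. \<Sum>j\<in>D. c i * cnj (c j) * (K i j + L i j))" for c
    using psd_nonneg[OF assms(1), of c] psd_nonneg[OF assms(2), of c]
    by (simp only: distrib_left sum.distrib plus_complex.sel)
qed

lemma psd_sum: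
  assumes "\<And>m. m \<in> M \<Longrightarrow> psd D (K m)"
  shows "psd D (\<lambda>i j. \<Sum>m\<in>M. K m i j)"
proof (cases "finite M")
  case True
  then show ?thesis using assms
  proof (induction M rule: finite_induct)
    case empty
    then show ?case by (simp add: psd_def)
  next
    case (insert m M)
    then show ?case using psd_add[of D "K m" "\<lambda>i j. \<Sum>m\<in>M. K m i j"] by simp
  qed
qed (simp add: psd_def)

lemma psd_scale:
  assumes "psd D K" "0 \<le> r"
  shows "psd D (\<lambda>i j. complex_of_real r * K i j)"
  unfolding psd_def
proof (intro conjI allI)
  show "\<forall>i\<in>D. \<forall>j\<in>D. complex_of_real r * K j i = cnj (complex_of_real r * K i j)"
    by (metis assms(1) complex_cnj_complex_of_real complex_cnj_mult psd_hermitian)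
  fix c
  have "(\<Sum>i\<in>D. \<Sum>j\<in>D. c i * cnj (c j) * (complex_of_real r * K i j))
      = complex_of_real r * (\<Sum>i\<in>D. \<Sum>j\<in>D. c i * cnj (c j) * K i j)"
    by (simp add: sum_distrib_left mult.left_commute)
  then show "0 \<le> Re (\<Sum>i\<in>D. \<Sum>j\<in>D. c i * cnj (c j) * (complex_of_real r * K i j))"
    using psd_nonneg[OF assms(1), of c] assms(2) by simp
qed

text \<open>Restricting the kernel has the same effect on the form as setting c to 0 off P.\<close>

lemma psd_restrict:
  assumes "psd D K"
  shows "psd D (\<lambda>i j. if P i \<and> P j then K i j else 0)"
  unfolding psd_def
proof (intro conjI allI)
  show "\<forall>i\<in>D. \<forall>j\<in>D. (if P j \<and> P i then K j i else 0) = cnj (if P i \<and> P j then K i j else 0)"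
    by (metis assms complex_cnj_zero psd_hermitian)
  fix c
  have "(\<Sum>i\<in>D. \<Sum>j\<in>D. c i * cnj (c j) * (if P i \<and> P j then K i j else 0))
      = (\<Sum>i\<in>D. \<Sum>j\<in>D. (if P i then c i else 0) * cnj (if P j then c j else 0) * K i j)"
    by (intro sum.cong refl) auto
  then show "0 \<le> Re (\<Sum>i\<in>D. \<Sum>j\<in>D. c i * cnj (c j) * (if P i \<and> P j then K i j else 0))"
    using psd_nonneg[OF assms, of "\<lambda>i. if P i then c i else 0"] by simp
qed

lemma psd_insert_form:
  assumes "finite D" "a \<notin> D"
  shows "(\<Sum>i\<in>insert a D. \<Sum>j\<in>insert a D. c i * cnj (c j) * K i j)
    = c a * cnj (c a) * K a a + c a * (\<Sum>j\<in>D. cnj (c j) * K a j) + (\<Sum>i\<in>D. c i * K i a) * cnj (c a)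
      + (\<Sum>i\<in>D. \<Sum>j\<in>D. c i * cnj (c j) * K i j)"
  using assms by (simp add: sum.distrib sum_distrib_left sum_distrib_right algebra_simps)

lemma psd_diag_zero:
  assumes psd: "psd D K" "finite D" and ij: "i \<in> D" "j \<in> D" "K i i = 0"
  shows "K i j = 0"
proof (cases "i = j")
  case False
  define k where "k = K i j"
  have "0 \<le> Re (K j j) - 2 * t * (cmod k)\<^sup>2" for t :: real
  proof -
    \<comment> \<open>Since the diagonal entry at i is 0, these coefficients leave the entry at j
      and cross terms that are linear in t.\<close>
    define c where "c = (\<lambda>m. if m = i then - complex_of_real t * cnj k else if m = j then 1 else 0)"
    have "(\<Sum>m\<in>D. \<Sum>n\<in>D. c m * cnj (c n) * K m n)
        = (\<Sum>m\<in>{i, j}. \<Sum>n\<in>{i, j}. c m * cnj (c n) * K m n)"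
      using ij \<open>finite D\<close>
      by (intro sum.mono_neutral_cong_right ballI) 
        (auto simp: c_def intro!: sum.mono_neutral_cong_right sum.neutral)
    also have "\<dots> = K j j - 2 * complex_of_real t * (k * cnj k)"
      using False ij(3) psd_hermitian[OF psd(1) ij(1,2)] by (simp add: c_def k_def algebra_simps)
    also have "k * cnj k = complex_of_real ((cmod k)\<^sup>2)"
      by (simp add: complex_norm_square del: of_real_power)
    finally have "Re (\<Sum>m\<in>D. \<Sum>n\<in>D. c m * cnj (c n) * K m n) = Re (K j j) - 2 * t * (cmod k)\<^sup>2"
      by simp
    then show ?thesis using psd_nonneg[OF psd(1), of c] by simp
  qed
  \<comment> \<open>For nonzero k this t would make the nonnegative quantity equal to -1.\<close>
  from this[of "(Re (K j j) + 1) / (2 * (cmod k)\<^sup>2)"] have "(cmod k)\<^sup>2 = 0"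
    by (auto simp: divide_simps split: if_splits)
  then show ?thesis by (simp add: k_def)
qed (use ij in simp)

text \<open>
  The Cholesky decomposition, by induction on the size of the index set: the Schur complement of
  the entry at \<open>a\<close> is again positive semidefinite.
\<close>

lemma psd_decomposition:
  assumes "finite D" "psd D K"
  shows "\<exists>(n::nat) v. \<forall>i\<in>D. \<forall>j\<in>D. K i j = (\<Sum>m<n. v m i * cnj (v m j))"
  using assms
proof (induction D arbitrary: K rule: finite_induct)
  case (insert a D)
  note psd = insert.prems
  define r where "r = Re (K a a)"
  have Kaa: "K a a = complex_of_real r"
    using psd_hermitian[OF psd, of a a] by (simp add: r_def complex_eq_iff)
  have r: "0 \<le> r"
  proof -
    define c where "c = (\<lambda>i. if i = a then 1 else 0 :: complex)"
    have "(\<Sum>i\<in>D. c i * K i a) = 0" "(\<Sum>i\<in>D. cnj (c i) * K a i) = 0"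
      "(\<Sum>i\<in>D. \<Sum>j\<in>D. c i * cnj (c j) * K i j) = 0"
      using insert.hyps by (auto simp: c_def intro!: sum.neutral)
    then show ?thesis
      using psd_nonneg[OF psd, of c] unfolding psd_insert_form[OF insert.hyps]
      by (simp add: c_def r_def)
  qed
  have herm: "K j i = cnj (K i j)" if "i \<in> insert a D" "j \<in> insert a D" for i j
    using psd_hermitian[OF psd that] .
  have zero: "K i a = 0" "K a i = 0" if "r = 0" "i \<in> D" for i
  proof -
    show "K a i = 0"
      by (rule psd_diag_zero[OF psd]) (use that insert.hyps Kaa in auto)
    then show "K i a = 0" using herm[of a i] that by simp
  qed
  \<comment> \<open>For r = 0 the quotient is 0 by convention and L = K. This is the right value,
    since row and column a then vanish by \<open>zero\<close>.\<close>
  define L where "L = (\<lambda>i j. K i j - K i a * K a j / complex_of_real r)"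
  have "psd D L"
    unfolding psd_def
  proof (intro conjI allI ballI)
    fix i j assume "i \<in> D" "j \<in> D"
    then show "L j i = cnj (L i j)"
      using herm[of i j] herm[of i a] herm[of a j] by (simp add: L_def)
  next
    fix c :: "'a \<Rightarrow> complex"
    define A where "A = (\<Sum>i\<in>D. c i * K i a)"
    have A': "(\<Sum>j\<in>D. cnj (c j) * K a j) = cnj A"
      unfolding A_def cnj_sum using herm[of _ a] by (intro sum.cong refl) auto
    have "(\<Sum>i\<in>D. \<Sum>j\<in>D. c i * cnj (c j) * L i j)
        = (\<Sum>i\<in>D. \<Sum>j\<in>D. c i * cnj (c j) * K i j)
          - (\<Sum>i\<in>D. \<Sum>j\<in>D. (c i * K i a) * (cnj (c j) * K a j)) / complex_of_real r"
      by (simp add: L_def right_diff_distrib sum_subtractf sum_divide_distrib mult_ac)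
    also have "(\<Sum>i\<in>D. \<Sum>j\<in>D. (c i * K i a) * (cnj (c j) * K a j)) = A * cnj A"
      unfolding A'[symmetric] by (simp add: A_def sum_product)
    finally have L: "(\<Sum>i\<in>D. \<Sum>j\<in>D. c i * cnj (c j) * L i j)
        = (\<Sum>i\<in>D. \<Sum>j\<in>D. c i * cnj (c j) * K i j) - A * cnj A / complex_of_real r" .
    \<comment> \<open>The coefficient at a completes the square: it minimises the form of K with the
      others fixed at c, and the minimum is the form of L.\<close>
    define d where "d = c(a := - A / complex_of_real r)"
    have d: "d i = c i" if "i \<in> D" for i
      using that insert.hyps by (auto simp: d_def)
    have "(\<Sum>i\<in>insert a D. \<Sum>j\<in>insert a D. d i * cnj (d j) * K i j)
        = d a * cnj (d a) * K a a + d a * cnj A + A * cnj (d a) + (\<Sum>i\<in>D. \<Sum>j\<in>D. c i * cnj (c j) * K i j)"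
      unfolding psd_insert_form[OF insert.hyps] A'[symmetric] unfolding A_def by (simp add: d cong: sum.cong)
    also have "d a * cnj (d a) * K a a + d a * cnj A + A * cnj (d a) = - (A * cnj A / complex_of_real r)"
      by (cases "r = 0") (simp_all add: d_def Kaa field_simps)
    finally have "(\<Sum>i\<in>insert a D. \<Sum>j\<in>insert a D. d i * cnj (d j) * K i j)
        = (\<Sum>i\<in>D. \<Sum>j\<in>D. c i * cnj (c j) * L i j)"
      unfolding L by simp
    then show "0 \<le> Re (\<Sum>i\<in>D. \<Sum>j\<in>D. c i * cnj (c j) * L i j)"
      using psd_nonneg[OF psd, of d] by simp
  qed
  then obtain n :: nat and v where v: "\<And>i j. i \<in> D \<Longrightarrow> j \<in> D \<Longrightarrow> L i j = (\<Sum>m<n. v m i * cnj (v m j))"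
    using insert.IH by blast
  \<comment> \<open>The new vector, of index n, is column a divided by the square root of r; the old
    vectors are extended by 0 at a.\<close>
  define w where "w = (\<lambda>m i. if m = n then (if i = a then complex_of_real (sqrt r) else K i a / complex_of_real (sqrt r))
    else if i = a then 0 else v m i)"
  have "K i j = (\<Sum>m<Suc n. w m i * cnj (w m j))" if ij: "i \<in> insert a D" "j \<in> insert a D" for i j
  proof -
    have rr: "complex_of_real (sqrt r) * complex_of_real (sqrt r) = complex_of_real r"
      using r by (simp flip: of_real_mult)
    have lt: "(\<Sum>m<n. w m i * cnj (w m j)) = (if i = a \<or> j = a then 0 else \<Sum>m<n. v m i * cnj (v m j))"
      by (auto simp: w_def intro!: sum.cong sum.neutral)
    consider "i = a" "j = a" | "i = a" "j \<in> D" "j \<noteq> a" | "i \<in> D" "i \<noteq> a" "j = a"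
      | "i \<in> D" "j \<in> D" "i \<noteq> a" "j \<noteq> a"
      using ij insert.hyps by blast
    then show ?thesis
    proof cases
      case 1
      then show ?thesis using lt rr by (simp add: w_def Kaa)
    next
      case 2
      then show ?thesis using lt herm[of j a] zero[of j] r by (cases "r = 0") (simp_all add: w_def)
    next
      case 3
      then show ?thesis using lt zero[of i] r by (cases "r = 0") (simp_all add: w_def)
    next
      case 4
      have "w n i * cnj (w n j) = K i a * K a j / complex_of_real r"
        using 4 herm[of j a] rr by (simp add: w_def)
      moreover have "K i j = L i j + K i a * K a j / complex_of_real r"
        by (simp add: L_def)
      ultimately show ?thesis using lt v[OF 4(1,2)] 4 by simp
    qed
  qed
  then show ?case by blast
qed simp

lemma (in hilbert_space) psd_gram:
  assumes "finite D" "\<And>i. i \<in> D \<Longrightarrow> w i \<in> carrier H"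
  shows "psd D (\<lambda>i j. ip H (w i) (w j))"
  unfolding psd_def
proof (intro conjI allI)
  show "\<forall>i\<in>D. \<forall>j\<in>D. ip H (w j) (w i) = cnj (ip H (w i) (w j))"
    using assms by (auto intro: ip_commute)
  show "0 \<le> Re (\<Sum>i\<in>D. \<Sum>j\<in>D. c i * cnj (c j) * ip H (w i) (w j))" for c
    using assms ip_finsum[of D w c] ip_nonneg[of "\<Oplus>i\<in>D. c i \<odot> w i"]
    by (auto intro: M.finsum_closed)
qed

section \<open>Representations of inverse semigroups with zero\<close>

context semigroup_rep
begin

text \<open>One projection is peeled off at a time. With E the image of h under
  \<open>(t i)\<^sup>\<star> \<cdot> t i\<close>, passing to h - E lowers the squared norm by
  |\<pi>(t i)h|^2. The other summands do not change: \<open>t j \<cdot> (t i)\<^sup>\<star>\<close>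
  is the zero z, and \<pi>(z) annihilates h.\<close>

lemma bessel:
  assumes z: "z \<in> carrier S" "\<And>s. s \<in> carrier S \<Longrightarrow> z \<cdot> s = z"
    and I: "finite I" "\<And>i. i \<in> I \<Longrightarrow> t i \<in> carrier S"
      "\<And>i j. i \<in> I \<Longrightarrow> j \<in> I \<Longrightarrow> i \<noteq> j \<Longrightarrow> t i \<cdot> (t j)\<^sup>\<star> = z"
    and h: "h \<in> carrier H" "\<pi> z h = \<zero>"
  shows "(\<Sum>i\<in>I. (hnorm H (\<pi> (t i) h))\<^sup>2) \<le> (hnorm H h)\<^sup>2"
  using I h
proof (induction I arbitrary: h rule: finite_induct)
  case (insert i I)
  define E where "E = \<pi> ((t i)\<^sup>\<star> \<cdot> t i) h"
  have ti: "t i \<in> carrier S" using insert by blast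
  have E: "E \<in> carrier H" using ti insert.prems by (auto simp: E_def)
  have E_ip: "ip H E E = ip H E h"
    unfolding E_def using ti insert.prems
    by (subst ip_rep_rep) (auto simp: adj_mul prod_assoc mul_adj_mul mul_adj_mul')
  have E_t: "ip H E h = ip H (\<pi> (t i) h) (\<pi> (t i) h)"
    unfolding E_def using ti insert.prems by (simp add: ip_rep_rep)
  have "(hnorm H (h \<ominus> E))\<^sup>2 = (hnorm H h)\<^sup>2 - (hnorm H (\<pi> (t i) h))\<^sup>2"
  proof -
    have "ip H h E = cnj (ip H E h)"
      using E insert.prems by (intro ip_commute)
    then have "Re (ip H (h \<ominus> E) (h \<ominus> E)) = Re (ip H h h) - Re (ip H E h)"
      using E insert.prems E_ip by (simp add: ip_simps)
    then show ?thesis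
      using E E_t ti insert.prems by (simp add: hnorm_sq)
  qed
  moreover have "(\<Sum>j\<in>I. (hnorm H (\<pi> (t j) (h \<ominus> E)))\<^sup>2) \<le> (hnorm H (h \<ominus> E))\<^sup>2"
  proof (rule insert.IH)
    have "\<pi> z E = \<zero>"
      unfolding E_def using z ti insert.prems by (simp flip: rep_mul)
    then show "\<pi> z (h \<ominus> E) = \<zero>"
      using z E insert.prems by (simp add: op_diff[OF rep_bounded])
  qed (use insert.prems E in auto)
  moreover have "\<pi> (t j) (h \<ominus> E) = \<pi> (t j) h" if j: "j \<in> I" for j
  proof -
    have tj: "t j \<in> carrier S" "t j \<cdot> (t i)\<^sup>\<star> = z"
      using insert j by auto
    have "\<pi> (t j) E = \<pi> (t j \<cdot> (t i)\<^sup>\<star> \<cdot> t i) h"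
      unfolding E_def using tj(1) ti insert.prems by (simp add: prod_assoc rep_mul)
    also have "\<dots> = \<zero>"
      using tj z ti insert.prems by simp
    finally have "\<pi> (t j) (h \<ominus> E) = \<pi> (t j) h \<ominus> \<zero>"
      using tj(1) E insert.prems by (simp add: op_diff[OF rep_bounded])
    then show ?thesis
      using tj(1) insert.prems by (simp add: diff_eq)
  qed
  ultimately show ?case
    using insert.hyps by simp
qed simp

text \<open>The form at c is the defect in Bessel's inequality for the combination h of the
  \<open>w m\<close> with coefficients c.\<close>

lemma psd_gram_bessel:
  assumes z: "z \<in> carrier S" "\<And>s. s \<in> carrier S \<Longrightarrow> z \<cdot> s = z"
    and I: "finite I" "\<And>i. i \<in> I \<Longrightarrow> t i \<in> carrier S"
      "\<And>i j. i \<in> I \<Longrightarrow> j \<in> I \<Longrightarrow> i \<noteq> j \<Longrightarrow> t i \<cdot> (t j)\<^sup>\<star> = z"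
    and D: "finite D" "\<And>m. m \<in> D \<Longrightarrow> w m \<in> carrier H" "\<And>m. m \<in> D \<Longrightarrow> \<pi> z (w m) = \<zero>"
  shows "psd D (\<lambda>m n. ip H (w m) (w n) - (\<Sum>i\<in>I. ip H (\<pi> (t i) (w m)) (\<pi> (t i) (w n))))"
  unfolding psd_def
proof (intro conjI allI ballI)
  fix m n assume "m \<in> D" "n \<in> D"
  then show "ip H (w n) (w m) - (\<Sum>i\<in>I. ip H (\<pi> (t i) (w n)) (\<pi> (t i) (w m)))
    = cnj (ip H (w m) (w n) - (\<Sum>i\<in>I. ip H (\<pi> (t i) (w m)) (\<pi> (t i) (w n))))"
    unfolding complex_cnj_diff cnj_sum using D I by (intro arg_cong2[where f = "(-)"] sum.cong refl ip_commute) auto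
next
  fix c
  define h where "h = (\<Oplus>m\<in>D. c m \<odot> w m)"
  have h: "h \<in> carrier H" unfolding h_def using D by (auto intro: M.finsum_closed)
  have ops: "\<pi> s h = (\<Oplus>m\<in>D. c m \<odot> \<pi> s (w m))" if "s \<in> carrier S" for s
    unfolding h_def using D that by (intro op_finsum rep_bounded) auto
  have "\<pi> z h = (\<Oplus>m\<in>D. \<zero>)"
    unfolding ops[OF z(1)] using D by (intro M.finsum_cong') auto
  then have zh: "\<pi> z h = \<zero>" by simp
  have "(hnorm H (\<pi> (t i) h))\<^sup>2 = Re (\<Sum>m\<in>D. \<Sum>n\<in>D. c m * cnj (c n) * ip H (\<pi> (t i) (w m)) (\<pi> (t i) (w n)))"
    if "i \<in> I" for i
    using that h I D ip_finsum[of D "\<lambda>m. \<pi> (t i) (w m)" c] by (simp add: hnorm_sq) (simp add: ops Pi_def)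
  then have "(\<Sum>i\<in>I. (hnorm H (\<pi> (t i) h))\<^sup>2)
      = Re (\<Sum>i\<in>I. \<Sum>m\<in>D. \<Sum>n\<in>D. c m * cnj (c n) * ip H (\<pi> (t i) (w m)) (\<pi> (t i) (w n)))"
    by simp
  also have "(\<Sum>i\<in>I. \<Sum>m\<in>D. \<Sum>n\<in>D. c m * cnj (c n) * ip H (\<pi> (t i) (w m)) (\<pi> (t i) (w n)))
      = (\<Sum>m\<in>D. \<Sum>n\<in>D. \<Sum>i\<in>I. c m * cnj (c n) * ip H (\<pi> (t i) (w m)) (\<pi> (t i) (w n)))"
    by (subst sum.swap, intro sum.cong refl, subst sum.swap, rule refl)
  finally have sum: "(\<Sum>i\<in>I. (hnorm H (\<pi> (t i) h))\<^sup>2)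
      = Re (\<Sum>m\<in>D. \<Sum>n\<in>D. \<Sum>i\<in>I. c m * cnj (c n) * ip H (\<pi> (t i) (w m)) (\<pi> (t i) (w n)))" .
  have "(hnorm H h)\<^sup>2 = Re (\<Sum>m\<in>D. \<Sum>n\<in>D. c m * cnj (c n) * ip H (w m) (w n))"
    using D ip_finsum[of D w c] h by (simp add: hnorm_sq) (simp add: h_def Pi_def)
  then have "Re (\<Sum>m\<in>D. \<Sum>n\<in>D. c m * cnj (c n)
        * (ip H (w m) (w n) - (\<Sum>i\<in>I. ip H (\<pi> (t i) (w m)) (\<pi> (t i) (w n)))))
      = (hnorm H h)\<^sup>2 - (\<Sum>i\<in>I. (hnorm H (\<pi> (t i) h))\<^sup>2)"
    unfolding sum by (simp only: right_diff_distrib sum_subtractf sum_distrib_left minus_complex.sel)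
  then show "0 \<le> Re (\<Sum>m\<in>D. \<Sum>n\<in>D. c m * cnj (c n)
        * (ip H (w m) (w n) - (\<Sum>i\<in>I. ip H (\<pi> (t i) (w m)) (\<pi> (t i) (w n)))))"
    using bessel[OF z I h zh] by simp
qed

lemma extend_rep_fixed:
  assumes f: "f \<in> carrier (semigroup_algebra S)" and y: "y \<in> carrier H"
    and fixed: "\<And>s. s \<in> carrier S \<Longrightarrow> \<pi> s y = y"
  shows "\<Phi> f y = (\<Sum>s\<in>supp f. f s) \<odot> y"
proof (rule ip_eqI)
  fix w assume w: "w \<in> carrier H"
  have "ip H (\<Phi> f y) w = (\<Sum>s\<in>supp f. f s * ip H (\<pi> s y) w)"
    using f y w by (intro ip_extend_rep) auto
  also have "\<dots> = (\<Sum>s\<in>supp f. f s * ip H y w)"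
    using f fixed by (intro sum.cong refl) auto
  finally show "ip H (\<Phi> f y) w = ip H ((\<Sum>s\<in>supp f. f s) \<odot> y) w"
    using y w by (simp add: ip_scale sum_distrib_right)
qed (use extend_rep_closed[OF f y] y in auto)

text \<open>
  A zero \<open>z\<close> of the semigroup is represented by a central projection, on whose range the
  representation is trivial.
\<close>

lemma dominated_split_zero:
  assumes z: "z \<in> carrier S" "\<And>s. s \<in> carrier S \<Longrightarrow> z \<cdot> s = z" "\<And>s. s \<in> carrier S \<Longrightarrow> s \<cdot> z = z"
    and f: "f \<in> carrier (semigroup_algebra S)" and x: "x \<in> carrier H"
    and C: "cmod (\<Sum>s\<in>supp f. f s) \<le> C"
    and dominated: "\<And>y. y \<in> carrier H \<Longrightarrow> \<pi> z y = \<zero> \<Longrightarrow> hnorm H (\<Phi> f y) \<le> C * hnorm H y"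
  shows "hnorm H (\<Phi> f x) \<le> C * hnorm H x"
proof -
  define a where "a = \<pi> z x"
  define b where "b = x \<ominus> a"
  have a: "a \<in> carrier H" and b: "b \<in> carrier H"
    using z x by (auto simp: a_def b_def)
  have C0: "0 \<le> C" using C norm_ge_zero order_trans by blast
  have zz: "\<pi> z a = a" using z x by (simp add: a_def flip: rep_mul)
  have zb: "\<pi> z b = \<zero>"
    using z a x by (simp add: b_def op_diff[OF rep_bounded] zz) (simp add: a_def)
  have adj_z: "z\<^sup>\<star> = z" using z by (intro adj_idem) auto
  have fixed: "\<pi> s a = a" if "s \<in> carrier S" for s
    using z x that by (simp add: a_def flip: rep_mul)
  have orth: "ip H y a = 0" if "y \<in> carrier H" "\<pi> z y = \<zero>" for y
    using that z a x rep_adj[of z y x] by (simp add: a_def adj_z)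
  have pyth: "(hnorm H (c \<odot> a \<oplus> y))\<^sup>2 = (hnorm H (c \<odot> a))\<^sup>2 + (hnorm H y)\<^sup>2"
    if y: "y \<in> carrier H" "\<pi> z y = \<zero>" for y c
  proof -
    have "ip H a y = 0" using orth[OF y] ip_commute[of y a] y a by simp
    then show ?thesis using y a orth[OF y] by (simp add: hnorm_sq ip_simps)
  qed
  have x_eq: "x = a \<oplus> b"
    using a x by (simp add: b_def diff_add_cancel M.a_comm[of a])
  let ?c = "\<Sum>s\<in>supp f. f s"
  have fb: "\<Phi> f b \<in> carrier H" by (rule extend_rep_closed[OF f b])
  \<comment> \<open>The kernel of \<pi>(z) is invariant under \<Phi>(f), so the images of a and b
    stay orthogonal and \<open>pyth\<close> applies to them.\<close>
  have "\<pi> z (\<Phi> f b) = \<zero>"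
  proof (rule ip_eqI)
    fix w assume w: "w \<in> carrier H"
    have "ip H (\<pi> z (\<Phi> f b)) w = ip H (\<Phi> f b) (\<pi> z w)"
      using z w fb by (simp add: rep_adj adj_z)
    also have "\<dots> = (\<Sum>s\<in>supp f. f s * ip H (\<pi> s b) (\<pi> z w))"
      using f z b w by (intro ip_extend_rep) auto
    also have "\<dots> = 0"
      using f z b w zb by (intro sum.neutral) (auto simp: ip_rep_rep adj_z subset_iff)
    finally show "ip H (\<pi> z (\<Phi> f b)) w = ip H \<zero> w" using w by simp
  qed (use z fb in auto)
  moreover have "\<Phi> f x = ?c \<odot> a \<oplus> \<Phi> f b"
    using x_eq op_add[OF extend_rep_bounded(1)[OF f] a b] extend_rep_fixed[OF f a fixed] by simp
  ultimately have "(hnorm H (\<Phi> f x))\<^sup>2 = (hnorm H (?c \<odot> a))\<^sup>2 + (hnorm H (\<Phi> f b))\<^sup>2"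
    using pyth fb by simp
  also have "\<dots> \<le> (C * hnorm H a)\<^sup>2 + (C * hnorm H b)\<^sup>2"
    using C a b dominated[OF b zb] fb
    by (intro add_mono power_mono) (auto simp: hnorm_scale intro!: mult_right_mono)
  also have "\<dots> = C\<^sup>2 * ((hnorm H (1 \<odot> a))\<^sup>2 + (hnorm H b)\<^sup>2)"
    using a by (simp add: power_mult_distrib distrib_left)
  also have "(hnorm H (1 \<odot> a))\<^sup>2 + (hnorm H b)\<^sup>2 = (hnorm H x)\<^sup>2"
    using pyth[OF b zb, of 1] x_eq a by simp
  finally have "(hnorm H (\<Phi> f x))\<^sup>2 \<le> (C * hnorm H x)\<^sup>2"
    by (simp add: power_mult_distrib)
  then show ?thesis
    using C0 x by (intro power2_le_imp_le[of "hnorm H (\<Phi> f x)"]) auto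
qed

end

section \<open>Path vectors in the regular representation\<close>

context wf_digraph
begin

abbreviation S where "S \<equiv> graph_inverse_semigroup G"

definition epath :: "'b \<Rightarrow> ('a, 'b) gpath" where
  "epath e = ([e], tail G e)"

lemma epath_simps [simp]:
  "fst (epath e) = [e]" "src (epath e) = tail G e" "rng G (epath e) = head G e"
  by (simp_all add: epath_def)

lemma epath_in_paths: "e \<in> arcs G \<Longrightarrow> epath e \<in> paths G"
  by (simp add: epath_def tail_in_verts)

text \<open>This product gives the inner products of the vectors \<open>w \<mu>\<close> in
  \<open>ip_w\<close> and, for paths of length zero, the orthogonality of distinct vertex
  projections in \<open>fejer_decomposition\<close>.\<close>

lemma graph_prod_vpath:
  assumes "\<mu> \<in> paths G" "\<nu> \<in> paths G"
  shows "graph_prod G (Elem \<nu> (vpath (src \<nu>))) (Elem (vpath (src \<mu>)) \<mu>)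
    = (if src \<mu> = src \<nu> then Elem \<nu> \<mu> else Zero)"
proof (cases "src \<mu> = src \<nu>")
  case True
  then show ?thesis
    using graph_prod_concat_left[of "vpath (src \<mu>)" "vpath (src \<mu>)" \<nu> \<mu>] src_in_verts[OF assms(1)]
    by (simp del: graph_prod.simps)
next
  case False
  have "\<not> factors G (vpath v) (vpath u) \<gamma>" if "u \<noteq> v" for u v \<gamma>
  proof
    assume "factors G (vpath v) (vpath u) \<gamma>"
    then have eq: "vpath v = concat_path (vpath u) \<gamma>" "u = rng G \<gamma>"
      by (simp_all add: factors_def)
    then have "\<gamma> = vpath v" by simp
    then show False using eq(2) that by simp
  qed
  then show ?thesis
    using False graph_prod_Zero_iff by (simp del: graph_prod.simps)
qed

text \<open>The adjoint of an edge lengthens a path at its source end. Through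
  \<open>edge_op_w\<close> this is the passage from \<phi>(\<nu>, \<mu>) to \<phi>(\<nu>e, \<mu>e)
  in k1.\<close>

lemma graph_prod_epath:
  assumes "e \<in> arcs G" "\<mu> \<in> paths G"
  shows "graph_prod G (Elem (vpath (tail G e)) (epath e)) (Elem (vpath (src \<mu>)) \<mu>)
    = (if head G e = src \<mu> then Elem (vpath (tail G e)) (concat_path \<mu> (epath e)) else Zero)"
proof (cases "head G e = src \<mu>")
  case True
  then show ?thesis
    using graph_prod_concat_left[of "epath e" "vpath (src \<mu>)" "vpath (tail G e)" \<mu>] epath_in_paths[OF assms(1)]
    by (simp del: graph_prod.simps)
next
  case False
  have "\<not> factors G (epath e) (vpath (src \<mu>)) \<gamma>" for \<gamma>
  proof
    assume "factors G (epath e) (vpath (src \<mu>)) \<gamma>"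
    then have "epath e = \<gamma>" "src \<mu> = rng G \<gamma>"
      by (simp_all add: factors_def)
    then show False using False by auto
  qed
  moreover have "\<not> factors G (vpath (src \<mu>)) (epath e) \<gamma>" for \<gamma>
    by (auto simp: factors_def vpath_def concat_path_def)
  ultimately show ?thesis
    using False graph_prod_Zero_iff by (simp del: graph_prod.simps)
qed

text \<open>Makes the range projections of distinct edges orthogonal, as Bessel's inequality
  demands.\<close>

lemma graph_prod_epath_orth:
  assumes "e \<noteq> e'"
  shows "graph_prod G (Elem \<mu> (epath e)) (Elem (epath e') \<nu>) = Zero"
  using assms unfolding graph_prod_Zero_iff by (auto simp: factors_def epath_def concat_path_def)

text \<open>
  The vectors \<open>(\<mu>, s(\<mu>))\<close> span an invariant subspace of the regular representation, on which
  \<open>(\<alpha>, \<beta>)\<close> acts as \<open>\<beta>\<gamma> \<mapsto> \<alpha>\<gamma>\<close>.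
\<close>

definition path_vector :: "('a, 'b) gpath set \<Rightarrow> (('a, 'b) gpath \<Rightarrow> complex) \<Rightarrow> ('a, 'b) graph_elem \<Rightarrow> complex" where
  "path_vector D \<xi> s = (case s of Zero \<Rightarrow> 0 | Elem \<mu> \<nu> \<Rightarrow> if \<mu> \<in> D \<and> \<nu> = vpath (src \<mu>) then \<xi> \<mu> else 0)"

abbreviation path_elem :: "('a, 'b) gpath \<Rightarrow> ('a, 'b) graph_elem" where
  "path_elem \<mu> \<equiv> Elem \<mu> (vpath (src \<mu>))"

lemma path_vector_elem: "path_vector D \<xi> (path_elem \<mu>) = (if \<mu> \<in> D then \<xi> \<mu> else 0)"
  by (simp add: path_vector_def)

lemma path_vector_zero: "s \<notin> path_elem ` D \<Longrightarrow> path_vector D \<xi> s = 0"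
  by (auto simp: path_vector_def split: graph_elem.splits)

lemma path_elem_carrier: "\<mu> \<in> paths G \<Longrightarrow> path_elem \<mu> \<in> carrier S"
  by (simp add: src_in_verts)

lemma path_vector_ell2:
  assumes "finite D" "D \<subseteq> paths G"
  shows "path_vector D \<xi> \<in> carrier (ell2 (carrier S))"
proof -
  have sub: "path_elem ` D \<subseteq> carrier S"
    using assms path_elem_carrier by blast
  have "(\<lambda>s. (cmod (path_vector D \<xi> s))\<^sup>2) summable_on path_elem ` D"
    using assms by (intro summable_on_finite) simp
  then have "(\<lambda>s. (cmod (path_vector D \<xi> s))\<^sup>2) summable_on carrier S"
    by (rule summable_on_cong_neutral[THEN iffD1, rotated -1])
      (use sub path_vector_zero in auto)
  moreover have "path_vector D \<xi> s = 0" if "s \<notin> carrier S" for s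
    using sub that by (intro path_vector_zero) blast
  ultimately show ?thesis by simp
qed

lemma ip_path_vector:
  assumes "finite D" "D \<subseteq> paths G"
  shows "ip (ell2 (carrier S)) g (path_vector D \<xi>) = (\<Sum>\<mu>\<in>D. g (path_elem \<mu>) * cnj (\<xi> \<mu>))"
proof -
  have "ip (ell2 (carrier S)) g (path_vector D \<xi>)
      = (\<Sum>\<^sub>\<infinity>s\<in>path_elem ` D. g s * cnj (path_vector D \<xi> s))"
    unfolding ell2_simps
    by (rule infsum_cong_neutral) (use assms path_elem_carrier path_vector_zero in auto)
  also have "\<dots> = (\<Sum>\<mu>\<in>D. g (path_elem \<mu>) * cnj (path_vector D \<xi> (path_elem \<mu>)))"
    using assms by (simp add: sum.reindex inj_on_def)
  finally show ?thesis by (simp add: path_vector_elem)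
qed

lemma hnorm_path_vector:
  assumes "finite D" "D \<subseteq> paths G"
  shows "complex_of_real ((hnorm (ell2 (carrier S)) (path_vector D \<xi>))\<^sup>2) = (\<Sum>\<mu>\<in>D. \<xi> \<mu> * cnj (\<xi> \<mu>))"
proof -
  interpret hilbert_space "ell2 (carrier S)" by (rule hilbert_space_ell2)
  show ?thesis
    using ip_path_vector[OF assms, of "path_vector D \<xi>" \<xi>] ip_self[OF path_vector_ell2[OF assms], of \<xi>]
    by (simp add: path_vector_elem del: ell2_simps of_real_power)
qed

text \<open>The coordinate of \<Lambda>(\<alpha>, \<beta>)\<xi> at \<alpha>\<gamma> is
  \<xi>(\<beta>\<gamma>), and coordinates at paths that do not begin with \<alpha> vanish. Summed
  over the vectors of a decomposition of a kernel k, this gives the sum of all k(\<beta>\<gamma>,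
  \<alpha>\<gamma>).\<close>

lemma ip_regular_path_vector:
  assumes D: "finite D" "D \<subseteq> paths G" and u: "Elem \<alpha> \<beta> \<in> carrier S"
  shows "ip (ell2 (carrier S)) (regular_rep S (Elem \<alpha> \<beta>) (path_vector D \<xi>)) (path_vector D \<xi>)
    = (\<Sum>\<gamma>\<in>{\<gamma> \<in> paths G. rng G \<gamma> = src \<alpha> \<and> concat_path \<alpha> \<gamma> \<in> D \<and> concat_path \<beta> \<gamma> \<in> D}.
        \<xi> (concat_path \<beta> \<gamma>) * cnj (\<xi> (concat_path \<alpha> \<gamma>)))" (is "?lhs = sum ?h ?\<Gamma>")
proof -
  interpret S: inverse_semigroup S by (rule inverse_semigroup_graph)
  have src: "src \<alpha> = src \<beta>" and \<alpha>\<beta>: "\<alpha> \<in> paths G" "\<beta> \<in> paths G" using u by simp_all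
  have adj: "sadj S (Elem \<alpha> \<beta>) = Elem \<beta> \<alpha>" by simp
  let ?R = "regular_rep S (Elem \<alpha> \<beta>) (path_vector D \<xi>)"
  have R_apply: "?R c = (if c \<in> S.sdom (Elem \<beta> \<alpha>) then path_vector D \<xi> (graph_prod G (Elem \<beta> \<alpha>) c) else 0)" for c
    using S.regular_rep_apply[OF u path_vector_ell2[OF D, of \<xi>], of c] by (simp del: graph_prod.simps ell2_simps)
  have prod: "graph_prod G (Elem \<beta> \<alpha>) (path_elem (concat_path \<alpha> \<gamma>)) = path_elem (concat_path \<beta> \<gamma>)"
    "graph_prod G (Elem \<alpha> \<beta>) (path_elem (concat_path \<beta> \<gamma>)) = path_elem (concat_path \<alpha> \<gamma>)"
    if "\<gamma> \<in> paths G" "rng G \<gamma> = src \<alpha>" for \<gamma>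
    unfolding src_simps(2)
    by (rule graph_prod_concat_right; use that src in simp)+
  have R_concat: "?R (path_elem (concat_path \<alpha> \<gamma>))
      = (if concat_path \<beta> \<gamma> \<in> D then \<xi> (concat_path \<beta> \<gamma>) else 0)"
    if \<gamma>: "\<gamma> \<in> paths G" "rng G \<gamma> = src \<alpha>" for \<gamma>
  proof -
    have "path_elem (concat_path \<alpha> \<gamma>) \<in> S.sdom (Elem \<beta> \<alpha>)"
      unfolding S.sdom_def using \<gamma> \<alpha>\<beta> src_in_verts[OF \<gamma>(1)] prod[OF \<gamma>]
      by (simp add: concat_in_paths del: graph_prod.simps)
    then show ?thesis
      unfolding R_apply prod(1)[OF \<gamma>] by (simp only: path_vector_elem if_True)
  qed
  have R_zero: "?R (path_elem \<mu>) = 0"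
    if \<mu>: "\<mu> \<in> paths G" "\<And>\<gamma>. \<gamma> \<in> paths G \<Longrightarrow> rng G \<gamma> = src \<alpha> \<Longrightarrow> \<mu> \<noteq> concat_path \<alpha> \<gamma>" for \<mu>
  proof (rule ccontr)
    assume "?R (path_elem \<mu>) \<noteq> 0"
    then have "path_elem \<mu> \<in> S.sdom (Elem \<beta> \<alpha>)"
      unfolding R_apply by (meson)
    then have dom: "graph_prod G (Elem \<alpha> \<beta>) (graph_prod G (Elem \<beta> \<alpha>) (path_elem \<mu>)) = path_elem \<mu>"
      unfolding S.sdom_def by (simp del: graph_prod.simps)
    have u': "Elem \<beta> \<alpha> \<in> carrier S" using u by simp
    show False
      using u' path_elem_carrier[OF \<mu>(1)]
    proof (cases rule: graph_prod_cases)
      case (1 \<gamma>)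
      \<comment> \<open>Here \<alpha> = \<mu>\<gamma>, and the two products send
        \<open>path_elem \<mu>\<close> to (\<alpha>, \<gamma>); being fixed forces \<mu> = \<alpha>,
        a path that does begin with \<alpha>.\<close>
      have "graph_prod G (Elem \<alpha> \<beta>) (Elem \<beta> \<gamma>) = Elem \<alpha> (concat_path \<gamma> (vpath (src \<beta>)))"
        using graph_prod_concat_left[of "vpath (src \<beta>)" \<beta> \<alpha> \<gamma>] src_in_verts[OF \<alpha>\<beta>(2)]
        by (simp del: graph_prod.simps)
      moreover have "concat_path (vpath (src \<mu>)) \<gamma> = \<gamma>" by simp
      ultimately have "\<mu> = \<alpha>" using dom unfolding 1(4) by simp
      then have "\<mu> = concat_path \<alpha> (vpath (src \<alpha>))" by simp
      then show False using \<mu>(2)[of "vpath (src \<alpha>)"] src_in_verts[OF \<alpha>\<beta>(1)] by simp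
    next
      case (2 \<gamma>)
      then show False using \<mu>(2) by metis
    next
      case 3
      then show False using dom by (simp del: graph_prod.simps(1))
    qed
  qed
  have inj: "inj_on (concat_path \<alpha>) ?\<Gamma>"
    by (rule inj_onI) (auto simp: concat_path_def src_def prod_eq_iff)
  have "?lhs = (\<Sum>\<mu>\<in>D. ?R (path_elem \<mu>) * cnj (\<xi> \<mu>))"
    by (rule ip_path_vector[OF D])
  also have "\<dots> = (\<Sum>\<mu>\<in>concat_path \<alpha> ` ?\<Gamma>. ?R (path_elem \<mu>) * cnj (\<xi> \<mu>))"
  proof (rule sum.mono_neutral_right[OF D(1)])
    show "concat_path \<alpha> ` ?\<Gamma> \<subseteq> D" by blast
    show "\<forall>\<mu>\<in>D - concat_path \<alpha> ` ?\<Gamma>. ?R (path_elem \<mu>) * cnj (\<xi> \<mu>) = 0"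
    proof
      fix \<mu> assume \<mu>: "\<mu> \<in> D - concat_path \<alpha> ` ?\<Gamma>"
      show "?R (path_elem \<mu>) * cnj (\<xi> \<mu>) = 0"
      proof (cases "\<exists>\<gamma>. \<gamma> \<in> paths G \<and> rng G \<gamma> = src \<alpha> \<and> \<mu> = concat_path \<alpha> \<gamma>")
        case True
        then obtain \<gamma> where \<gamma>: "\<gamma> \<in> paths G" "rng G \<gamma> = src \<alpha>" "\<mu> = concat_path \<alpha> \<gamma>" by blast
        then have "concat_path \<beta> \<gamma> \<notin> D" using \<mu> by blast
        then show ?thesis unfolding \<gamma>(3) R_concat[OF \<gamma>(1,2)] by simp
      next
        case False
        moreover have "\<mu> \<in> paths G" using \<mu> D by blast
        ultimately show ?thesis using R_zero[of \<mu>] by simp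
      qed
    qed
  qed
  also have "\<dots> = (\<Sum>\<gamma>\<in>?\<Gamma>. ?R (path_elem (concat_path \<alpha> \<gamma>)) * cnj (\<xi> (concat_path \<alpha> \<gamma>)))"
    by (simp add: sum.reindex[OF inj] del: src_simps)
  also have "\<dots> = sum ?h ?\<Gamma>"
    by (intro sum.cong refl) (simp only: mem_Collect_eq R_concat if_True)
  finally show ?thesis .
qed

lemma ip_regular_Zero_path_vector:
  assumes D: "finite D" "D \<subseteq> paths G"
  shows "ip (ell2 (carrier S)) (regular_rep S Zero (path_vector D \<xi>)) (path_vector D \<xi>) = 0"
proof -
  interpret S: inverse_semigroup S by (rule inverse_semigroup_graph)
  have "regular_rep S Zero (path_vector D \<xi>) (path_elem \<mu>) = 0" for \<mu>
    using S.regular_rep_apply[OF _ path_vector_ell2[OF D, of \<xi>], of Zero "path_elem \<mu>"]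
    by (simp add: S.sdom_def del: ell2_simps)
  then show ?thesis unfolding ip_path_vector[OF D] by simp
qed

section \<open>Sums over the paths of a given length into a vertex\<close>

definition layer :: "'b set \<Rightarrow> 'a set \<Rightarrow> 'a \<Rightarrow> nat \<Rightarrow> ('a, 'b) gpath set" where
  "layer F V v l = {\<gamma> \<in> paths G. rng G \<gamma> = v \<and> set (fst \<gamma>) \<subseteq> F \<and> src \<gamma> \<in> V \<and> length (fst \<gamma>) = l}"

lemma finite_paths_bounded:
  assumes "finite F" "finite V"
  shows "finite {\<gamma> \<in> paths G. set (fst \<gamma>) \<subseteq> F \<and> src \<gamma> \<in> V \<and> length (fst \<gamma>) < n}"
proof (rule finite_subset)
  show "finite ({p. set p \<subseteq> F \<and> length p \<le> n} \<times> V)"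
    using assms by (intro finite_cartesian_product finite_lists_length_le)
qed (auto simp: src_def)

lemma finite_layer:
  assumes "finite F" "finite V"
  shows "finite (layer F V v l)"
  using finite_paths_bounded[OF assms, of "Suc l"] by (rule rev_finite_subset) (auto simp: layer_def)

lemma layer_0: "v \<in> V \<Longrightarrow> v \<in> verts G \<Longrightarrow> layer F V v 0 = {vpath v}"
  by (auto simp: layer_def vpath_def src_def)

text \<open>A path of length l + 1 is \<gamma>e in exactly one way, with e the edge at its source.
  The inner sum over F is the one that k1 subtracts.\<close>

lemma sum_layer_Suc:
  fixes \<psi> :: "('a, 'b) gpath \<Rightarrow> complex"
  assumes F: "finite F" "F \<subseteq> arcs G" and V: "finite V" "tail G ` F \<subseteq> V" "head G ` F \<subseteq> V"
  shows "(\<Sum>\<gamma>\<in>layer F V v (Suc l). \<psi> \<gamma>)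
    = (\<Sum>\<gamma>\<in>layer F V v l. \<Sum>e\<in>F. if head G e = src \<gamma> then \<psi> (concat_path \<gamma> (epath e)) else 0)"
proof -
  have "(\<Sum>\<gamma>\<in>layer F V v l. \<Sum>e\<in>F. if head G e = src \<gamma> then \<psi> (concat_path \<gamma> (epath e)) else 0)
      = (\<Sum>\<gamma>\<in>layer F V v l. \<Sum>e\<in>{e \<in> F. head G e = src \<gamma>}. \<psi> (concat_path \<gamma> (epath e)))"
    using F by (simp add: sum.inter_filter)
  also have "\<dots> = (\<Sum>(\<gamma>, e)\<in>Sigma (layer F V v l) (\<lambda>\<gamma>. {e \<in> F. head G e = src \<gamma>}). \<psi> (concat_path \<gamma> (epath e)))"
    using F V finite_layer by (intro sum.Sigma) auto
  \<comment> \<open>The inverse drops the last list entry, which is the edge traversed first. What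
    remains starts at the head of that edge, so the heads of F have to belong to V.\<close>
  also have "\<dots> = (\<Sum>\<gamma>\<in>layer F V v (Suc l). \<psi> \<gamma>)"
  proof (rule sum.reindex_bij_witness[where j = "\<lambda>(\<gamma>, e). concat_path \<gamma> (epath e)"
        and i = "\<lambda>\<gamma>. ((butlast (fst \<gamma>), head G (last (fst \<gamma>))), last (fst \<gamma>))"])
    fix p assume p: "p \<in> Sigma (layer F V v l) (\<lambda>\<gamma>. {e \<in> F. head G e = src \<gamma>})"
    obtain \<gamma> e where [simp]: "p = (\<gamma>, e)" by (cases p)
    have \<gamma>: "\<gamma> \<in> layer F V v l" "e \<in> F" "head G e = src \<gamma>" using p by auto
    show "(\<lambda>\<gamma>. ((butlast (fst \<gamma>), head G (last (fst \<gamma>))), last (fst \<gamma>))) ((\<lambda>(\<gamma>, e). concat_path \<gamma> (epath e)) p) = p"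
      using \<gamma> by (simp add: src_def)
    show "(\<lambda>(\<gamma>, e). concat_path \<gamma> (epath e)) p \<in> layer F V v (Suc l)"
      using \<gamma> F V epath_in_paths by (auto simp: layer_def concat_in_paths)
    show "\<psi> ((\<lambda>(\<gamma>, e). concat_path \<gamma> (epath e)) p) = (case p of (\<gamma>, e) \<Rightarrow> \<psi> (concat_path \<gamma> (epath e)))"
      by simp
  next
    fix \<gamma> assume \<gamma>: "\<gamma> \<in> layer F V v (Suc l)"
    then have "fst \<gamma> \<noteq> []" by (auto simp: layer_def)
    then obtain q e where "fst \<gamma> = q @ [e]" by (metis append_butlast_last_id)
    then obtain u where [simp]: "\<gamma> = (q @ [e], u)" by (metis prod.collapse)
    have *: "u = tail G e" "e \<in> F" "(q, head G e) \<in> layer F V v l"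
      using \<gamma> F V by (auto simp: layer_def append_in_paths rng_append)
    show "(\<lambda>(\<gamma>, e). concat_path \<gamma> (epath e)) ((butlast (fst \<gamma>), head G (last (fst \<gamma>))), last (fst \<gamma>)) = \<gamma>"
      using * by (simp add: concat_path_def)
    show "((butlast (fst \<gamma>), head G (last (fst \<gamma>))), last (fst \<gamma>))
        \<in> Sigma (layer F V v l) (\<lambda>\<gamma>. {e \<in> F. head G e = src \<gamma>})"
      using * by simp
  qed
  finally show ?thesis by simp
qed

end

text \<open>From n to n + 1 the sum gains \<open>\<sigma> n\<close> and one more copy of each
  difference with l < n. The differences add up to \<open>\<sigma> 0 - \<sigma> n\<close>, so the
  net gain is \<open>\<sigma> 0\<close>.\<close>

lemma fejer_telescope:
  fixes \<sigma> :: "nat \<Rightarrow> complex"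
  shows "(\<Sum>l<n. \<sigma> l + of_nat (n - 1 - l) * (\<sigma> l - \<sigma> (Suc l))) = of_nat n * \<sigma> 0"
proof (induction n)
  case (Suc n)
  have "(\<Sum>l<Suc n. \<sigma> l + of_nat (Suc n - 1 - l) * (\<sigma> l - \<sigma> (Suc l)))
      = \<sigma> n + (\<Sum>l<n. (\<sigma> l + of_nat (n - 1 - l) * (\<sigma> l - \<sigma> (Suc l))) + (\<sigma> l - \<sigma> (Suc l)))"
  proof -
    have "of_nat (n - l) = (of_nat (n - 1 - l) + 1 :: complex)" if "l < n" for l
    proof -
      have "n - l = Suc (n - 1 - l)" using that by simp
      then show ?thesis by (metis of_nat_Suc add.commute)
    qed
    then have "(\<Sum>l<n. \<sigma> l + of_nat (n - l) * (\<sigma> l - \<sigma> (Suc l)))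
        = (\<Sum>l<n. (\<sigma> l + of_nat (n - 1 - l) * (\<sigma> l - \<sigma> (Suc l))) + (\<sigma> l - \<sigma> (Suc l)))"
      by (intro sum.cong refl) (simp only: lessThan_iff distrib_right mult_1_left add.assoc)
    then show ?thesis by simp
  qed
  also have "\<dots> = \<sigma> n + (of_nat n * \<sigma> 0 + (\<sigma> 0 - \<sigma> n))"
    unfolding sum.distrib[of _ "\<lambda>l. \<sigma> l - \<sigma> (Suc l)"] Suc.IH sum_lessThan_telescope' ..
  finally show ?case by (simp add: algebra_simps)
qed simp

lemma fejer_weight_tendsto: "(\<lambda>N. complex_of_real (real (N - a) / real N) * c) \<longlonglongrightarrow> c"
proof -
  have "(\<lambda>N. 1 - real a / real N) \<longlonglongrightarrow> 1 - 0"
    by (intro tendsto_diff tendsto_const lim_const_over_n)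
  \<comment> \<open>From N = a + 1 on the truncated subtraction is exact and the denominator is
    nonzero.\<close>
  moreover have "\<forall>\<^sub>F N in sequentially. 1 - real a / real N = real (N - a) / real N"
    using eventually_ge_at_top[of "Suc a"] by eventually_elim (simp add: field_simps of_nat_diff)
  ultimately have "(\<lambda>N. real (N - a) / real N) \<longlonglongrightarrow> 1"
    by (simp add: tendsto_cong)
  then have "(\<lambda>N. complex_of_real (real (N - a) / real N) * c) \<longlonglongrightarrow> complex_of_real 1 * c"
    by (intro tendsto_mult tendsto_of_real tendsto_const)
  then show ?thesis by simp
qed

text \<open>Converts the cut-offs of \<open>fejer\<close> into the weight of the overview: lengths a
  and b survive exactly the levels j from 1 to N - 1 - max a b.\<close>

lemma count_levels:
  "(\<Sum>j\<in>{1..<N}. if a < N - j \<and> b < N - j then (c::complex) else 0) = of_nat (N - 1 - max a b) * c"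
proof -
  have "(\<Sum>j\<in>{1..<N}. if a < N - j \<and> b < N - j then c else 0)
      = (\<Sum>j\<in>{j \<in> {1..<N}. a < N - j \<and> b < N - j}. c)"
    by (rule sum.inter_filter[symmetric]) simp
  also have "{j \<in> {1..<N}. a < N - j \<and> b < N - j} = {1..<N - max a b}"
    by auto
  finally show ?thesis by simp
qed

section \<open>Fejer approximation of representations\<close>

text \<open>A vector killed by \<pi>(0) has \<phi>(0) = 0, in agreement with path vectors, for which
  the coefficient of \<Lambda>(0) is 0 too.\<close>

locale graph_rep = wf_digraph G + semigroup_rep "graph_inverse_semigroup G" H \<pi>
  for G :: "('v, 'e) pre_digraph" and H :: "'h hilbert" (structure) and \<pi> +
  fixes x :: 'h
  assumes x: "x \<in> carrier H" and zero_x: "\<pi> Zero x = \<zero>"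
begin

definition \<phi> :: "('v, 'e) graph_elem \<Rightarrow> complex" where
  "\<phi> s = ip H (\<pi> s x) x"

text \<open>This is the adjoint of the operator of \<mu> applied to x. The Gram kernel of these
  vectors is k0, extended by 0 to paths with different sources.\<close>

definition w :: "('v, 'e) gpath \<Rightarrow> 'h" where
  "w \<mu> = \<pi> (Elem (vpath (src \<mu>)) \<mu>) x"

definition edge_op :: "'e \<Rightarrow> 'h \<Rightarrow> 'h" where
  "edge_op e = \<pi> (Elem (vpath (tail G e)) (epath e))"

lemma \<phi>_Zero: "\<phi> Zero = 0"
  by (simp add: \<phi>_def zero_x x)

lemma elem_carrier: "\<mu> \<in> paths G \<Longrightarrow> Elem (vpath (src \<mu>)) \<mu> \<in> carrier S"
  by (simp add: src_in_verts)

lemma edge_carrier: "e \<in> arcs G \<Longrightarrow> Elem (vpath (tail G e)) (epath e) \<in> carrier S"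
  by (simp add: epath_in_paths)

lemma w_closed [simp]: "\<mu> \<in> paths G \<Longrightarrow> w \<mu> \<in> carrier H"
  unfolding w_def by (intro rep_closed elem_carrier x)

lemma zero_w: "\<mu> \<in> paths G \<Longrightarrow> \<pi> Zero (w \<mu>) = \<zero>"
  using rep_mul[OF _ elem_carrier[of \<mu>] x, of Zero] zero_x by (simp add: w_def)

lemma ip_w:
  assumes "\<mu> \<in> paths G" "\<nu> \<in> paths G" "src \<mu> = src \<nu>"
  shows "ip H (w \<mu>) (w \<nu>) = \<phi> (Elem \<nu> \<mu>)"
  unfolding w_def \<phi>_def
  using ip_rep_rep[OF elem_carrier[OF assms(1)] elem_carrier[OF assms(2)] x x]
    graph_prod_vpath[OF assms(1,2)] assms(3) by (simp del: graph_prod.simps)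

lemma edge_op_w:
  assumes "e \<in> arcs G" "\<mu> \<in> paths G"
  shows "edge_op e (w \<mu>) = (if head G e = src \<mu> then w (concat_path \<mu> (epath e)) else \<zero>)"
proof -
  have "edge_op e (w \<mu>) = \<pi> (graph_prod G (Elem (vpath (tail G e)) (epath e)) (Elem (vpath (src \<mu>)) \<mu>)) x"
    unfolding w_def edge_op_def
    using rep_mul[OF edge_carrier[OF assms(1)] elem_carrier[OF assms(2)] x] by (simp del: graph_prod.simps)
  then show ?thesis
    unfolding graph_prod_epath[OF assms] by (simp add: zero_x w_def)
qed

text \<open>One cut-off of k0 and N - 1 cut-offs of k1, instead of a weight on k1: in this form each
  summand is positive semidefinite by \<open>psd_restrict\<close>.\<close>

definition fejer :: "nat \<Rightarrow> 'e set \<Rightarrow> ('v, 'e) gpath \<Rightarrow> ('v, 'e) gpath \<Rightarrow> complex" where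
  "fejer N F \<mu> \<nu> = complex_of_real (1 / N) *
    ((if length (fst \<mu>) < N \<and> length (fst \<nu>) < N then ip H (w \<mu>) (w \<nu>) else 0) +
     (\<Sum>j\<in>{1..<N}. if length (fst \<mu>) < N - j \<and> length (fst \<nu>) < N - j
        then ip H (w \<mu>) (w \<nu>) - (\<Sum>e\<in>F. ip H (edge_op e (w \<mu>)) (edge_op e (w \<nu>))) else 0))"

lemma psd_fejer:
  assumes F: "finite F" "F \<subseteq> arcs G" and D: "finite D" "D \<subseteq> paths G"
  shows "psd D (fejer N F)"
proof -
  have 0: "psd D (\<lambda>\<mu> \<nu>. ip H (w \<mu>) (w \<nu>))"
    using D by (intro psd_gram) auto
  have 1: "psd D (\<lambda>\<mu> \<nu>. ip H (w \<mu>) (w \<nu>) - (\<Sum>e\<in>F. ip H (edge_op e (w \<mu>)) (edge_op e (w \<nu>))))"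
    unfolding edge_op_def
    by (rule psd_gram_bessel[where z = Zero])
      (use F D edge_carrier in \<open>auto simp: zero_w graph_prod_epath_orth simp del: graph_prod.simps(1) graph_inverse_semigroup_simps(4)\<close>)
  show ?thesis
    unfolding fejer_def[abs_def]
    by (intro psd_scale psd_add psd_sum psd_restrict 0 1) simp
qed

text \<open>Sorted by the length l of \<gamma>, N times the kernel sums to \<open>\<sigma> l\<close>
  plus n - 1 - l times \<open>\<sigma> l - \<sigma> (Suc l)\<close>. By
  \<open>fejer_telescope\<close> the total is n times \<open>\<sigma> 0\<close>.\<close>

lemma sum_fejer:
  assumes F: "finite F" "F \<subseteq> arcs G" and V: "finite V" "tail G ` F \<subseteq> V" "head G ` F \<subseteq> V"
    and u: "Elem \<alpha> \<beta> \<in> carrier S" "src \<alpha> \<in> V"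
  shows "(\<Sum>\<gamma>\<in>{\<gamma> \<in> paths G. rng G \<gamma> = src \<alpha> \<and> set (fst \<gamma>) \<subseteq> F \<and> src \<gamma> \<in> V \<and>
        length (fst \<gamma>) < N - max (length (fst \<alpha>)) (length (fst \<beta>))}.
      fejer N F (concat_path \<beta> \<gamma>) (concat_path \<alpha> \<gamma>))
    = complex_of_real (real (N - max (length (fst \<alpha>)) (length (fst \<beta>))) / real N) * \<phi> (Elem \<alpha> \<beta>)"
    (is "sum ?k ?\<Gamma> = _")
proof -
  define a where "a = max (length (fst \<alpha>)) (length (fst \<beta>))"
  \<comment> \<open>Both \<alpha>\<gamma> and \<beta>\<gamma> are shorter than N exactly when
    \<gamma> is shorter than n.\<close>
  define n where "n = N - a"
  define \<psi> where "\<psi> \<gamma> = \<phi> (Elem (concat_path \<alpha> \<gamma>) (concat_path \<beta> \<gamma>))" for \<gamma>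
  define \<sigma> where "\<sigma> l = (\<Sum>\<gamma>\<in>layer F V (src \<alpha>) l. \<psi> \<gamma>)" for l
  have src: "src \<alpha> = src \<beta>" and \<alpha>\<beta>: "\<alpha> \<in> paths G" "\<beta> \<in> paths G" using u by simp_all
  have k: "?k \<gamma> = complex_of_real (1 / N) * (\<psi> \<gamma> + of_nat (n - 1 - l) *
      (\<psi> \<gamma> - (\<Sum>e\<in>F. if head G e = src \<gamma> then \<psi> (concat_path \<gamma> (epath e)) else 0)))"
    if l: "l < n" and \<gamma>: "\<gamma> \<in> layer F V (src \<alpha>) l" for l \<gamma>
  proof -
    have \<gamma>p: "\<gamma> \<in> paths G" "rng G \<gamma> = src \<alpha>" "length (fst \<gamma>) = l"
      using \<gamma> by (simp_all add: layer_def)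
    have p: "concat_path \<alpha> \<gamma> \<in> paths G" "concat_path \<beta> \<gamma> \<in> paths G"
      using \<gamma>p \<alpha>\<beta> src by (simp_all add: concat_in_paths)
    have len: "length (fst (concat_path \<beta> \<gamma>)) < N" "length (fst (concat_path \<alpha> \<gamma>)) < N"
      "N - 1 - max (length (fst (concat_path \<beta> \<gamma>))) (length (fst (concat_path \<alpha> \<gamma>))) = n - 1 - l"
      using l \<gamma>p(3) by (auto simp: n_def a_def)
    have ip: "ip H (w (concat_path \<beta> \<gamma>)) (w (concat_path \<alpha> \<gamma>)) = \<psi> \<gamma>"
      unfolding \<psi>_def using p by (intro ip_w) simp_all
    have edge: "ip H (edge_op e (w (concat_path \<beta> \<gamma>))) (edge_op e (w (concat_path \<alpha> \<gamma>)))
        = (if head G e = src \<gamma> then \<psi> (concat_path \<gamma> (epath e)) else 0)" if "e \<in> F" for e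
    proof (cases "head G e = src \<gamma>")
      case True
      have e: "e \<in> arcs G" using F that by blast
      have q: "concat_path (concat_path \<alpha> \<gamma>) (epath e) \<in> paths G" "concat_path (concat_path \<beta> \<gamma>) (epath e) \<in> paths G"
        using p True epath_in_paths[OF e] by (simp_all add: concat_in_paths)
      show ?thesis
        using True q ip_w[OF q(2,1)] by (simp add: edge_op_w[OF e] p \<psi>_def concat_path_assoc)
    next
      case False
      then show ?thesis using F that p by (auto simp: edge_op_w)
    qed
    show ?thesis
      unfolding fejer_def ip count_levels len(3) using len(1,2) edge by (simp cong: sum.cong)
  qed
  have "sum ?k ?\<Gamma> = (\<Sum>l<n. \<Sum>\<gamma>\<in>{\<gamma> \<in> ?\<Gamma>. length (fst \<gamma>) = l}. ?k \<gamma>)"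
  proof (rule sum.group[symmetric])
    show "finite ?\<Gamma>"
      by (rule rev_finite_subset[OF finite_paths_bounded[OF F(1) V(1), of n]]) (auto simp: n_def a_def)
  qed (auto simp: n_def a_def)
  also have "\<dots> = (\<Sum>l<n. \<Sum>\<gamma>\<in>layer F V (src \<alpha>) l. ?k \<gamma>)"
    by (intro sum.cong refl) (auto simp: layer_def n_def a_def)
  also have "\<dots> = (\<Sum>l<n. \<Sum>\<gamma>\<in>layer F V (src \<alpha>) l. complex_of_real (1 / N) * (\<psi> \<gamma> + of_nat (n - 1 - l) *
      (\<psi> \<gamma> - (\<Sum>e\<in>F. if head G e = src \<gamma> then \<psi> (concat_path \<gamma> (epath e)) else 0))))"
    by (intro sum.cong refl k) auto
  also have "\<dots> = complex_of_real (1 / N) * (\<Sum>l<n. \<sigma> l + of_nat (n - 1 - l) * (\<sigma> l - \<sigma> (Suc l)))"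
    unfolding \<sigma>_def sum_layer_Suc[OF F V]
    by (simp only: sum_distrib_left sum.distrib sum_subtractf right_diff_distrib distrib_left)
  also have "\<dots> = complex_of_real (1 / N) * (of_nat n * \<sigma> 0)"
    by (simp only: fejer_telescope)
  \<comment> \<open>Layer 0 is a single vertex, since V contains the source of \<alpha>.\<close>
  also have "\<sigma> 0 = \<phi> (Elem \<alpha> \<beta>)"
    using u(2) src_in_verts[OF \<alpha>\<beta>(1)] src by (simp add: \<sigma>_def layer_0 \<psi>_def)
  finally show ?thesis
    by (simp add: n_def a_def)
qed

text \<open>The vectors in the decomposition of the kernel are read as path vectors, so their
  coefficients add up to the sums of \<open>sum_fejer\<close>. Their total mass is the trace of the
  kernel, which \<open>sum_fejer\<close> evaluates through \<alpha> = \<beta> = a for the vertices a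
  in V.\<close>

lemma fejer_decomposition:
  assumes F: "finite F" "F \<subseteq> arcs G" and V: "finite V" "V \<subseteq> verts G" "tail G ` F \<subseteq> V" "head G ` F \<subseteq> V"
    and N: "0 < N"
  obtains m :: nat and \<xi> where
    "\<And>i. \<xi> i \<in> carrier \<L>"
    "(\<Sum>i<m. (hnorm \<L> (\<xi> i))\<^sup>2) \<le> (hnorm H x)\<^sup>2"
    "(\<Sum>i<m. ip \<L> (regular_rep S Zero (\<xi> i)) (\<xi> i)) = 0"
    "\<And>\<alpha> \<beta>. Elem \<alpha> \<beta> \<in> carrier S \<Longrightarrow> set (fst \<alpha>) \<subseteq> F \<Longrightarrow> set (fst \<beta>) \<subseteq> F \<Longrightarrow> src \<alpha> \<in> V \<Longrightarrow>
      (\<Sum>i<m. ip \<L> (regular_rep S (Elem \<alpha> \<beta>) (\<xi> i)) (\<xi> i))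
        = complex_of_real (real (N - max (length (fst \<alpha>)) (length (fst \<beta>))) / real N) * \<phi> (Elem \<alpha> \<beta>)"
proof -
  define D where "D = {\<mu> \<in> paths G. set (fst \<mu>) \<subseteq> F \<and> src \<mu> \<in> V \<and> length (fst \<mu>) < N}"
  have D: "finite D" "D \<subseteq> paths G"
    using finite_paths_bounded[OF F(1) V(1)] by (auto simp: D_def)
  obtain m :: nat and v where v: "\<And>\<mu> \<nu>. \<mu> \<in> D \<Longrightarrow> \<nu> \<in> D \<Longrightarrow> fejer N F \<mu> \<nu> = (\<Sum>i<m. v i \<mu> * cnj (v i \<nu>))"
    using psd_decomposition[OF D(1) psd_fejer[OF F D, of N]] by blast
  define \<xi> where "\<xi> i = path_vector D (v i)" for i
  have sum: "(\<Sum>\<gamma>\<in>{\<gamma> \<in> paths G. rng G \<gamma> = src \<alpha> \<and> concat_path \<alpha> \<gamma> \<in> D \<and> concat_path \<beta> \<gamma> \<in> D}.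
        fejer N F (concat_path \<beta> \<gamma>) (concat_path \<alpha> \<gamma>))
      = complex_of_real (real (N - max (length (fst \<alpha>)) (length (fst \<beta>))) / real N) * \<phi> (Elem \<alpha> \<beta>)"
    if u: "Elem \<alpha> \<beta> \<in> carrier S" "set (fst \<alpha>) \<subseteq> F" "set (fst \<beta>) \<subseteq> F" "src \<alpha> \<in> V" for \<alpha> \<beta>
  proof -
    \<comment> \<open>As \<alpha> and \<beta> have all their edges in F, only edges, source and
      length of \<gamma> decide whether \<alpha>\<gamma> and \<beta>\<gamma> are in D.\<close>
    have "{\<gamma> \<in> paths G. rng G \<gamma> = src \<alpha> \<and> concat_path \<alpha> \<gamma> \<in> D \<and> concat_path \<beta> \<gamma> \<in> D}
        = {\<gamma> \<in> paths G. rng G \<gamma> = src \<alpha> \<and> set (fst \<gamma>) \<subseteq> F \<and> src \<gamma> \<in> V \<and>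
            length (fst \<gamma>) < N - max (length (fst \<alpha>)) (length (fst \<beta>))}"
      using u by (auto simp: D_def concat_in_paths)
    then show ?thesis using sum_fejer[OF F V(1,3,4) u(1,4)] by simp
  qed
  show ?thesis
  proof (rule that)
    show "\<xi> i \<in> carrier \<L>" for i
      unfolding \<xi>_def by (rule path_vector_ell2[OF D])
    show "(\<Sum>i<m. ip \<L> (regular_rep S Zero (\<xi> i)) (\<xi> i)) = 0"
      unfolding \<xi>_def ip_regular_Zero_path_vector[OF D] by simp
  next
    fix \<alpha> \<beta> assume u: "Elem \<alpha> \<beta> \<in> carrier S" "set (fst \<alpha>) \<subseteq> F" "set (fst \<beta>) \<subseteq> F" "src \<alpha> \<in> V"
    let ?\<Gamma> = "{\<gamma> \<in> paths G. rng G \<gamma> = src \<alpha> \<and> concat_path \<alpha> \<gamma> \<in> D \<and> concat_path \<beta> \<gamma> \<in> D}"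
    have "(\<Sum>i<m. ip \<L> (regular_rep S (Elem \<alpha> \<beta>) (\<xi> i)) (\<xi> i))
        = (\<Sum>\<gamma>\<in>?\<Gamma>. \<Sum>i<m. v i (concat_path \<beta> \<gamma>) * cnj (v i (concat_path \<alpha> \<gamma>)))"
      unfolding \<xi>_def ip_regular_path_vector[OF D u(1)] by (rule sum.swap)
    also have "\<dots> = (\<Sum>\<gamma>\<in>?\<Gamma>. fejer N F (concat_path \<beta> \<gamma>) (concat_path \<alpha> \<gamma>))"
      by (intro sum.cong refl v[symmetric]) auto
    finally show "(\<Sum>i<m. ip \<L> (regular_rep S (Elem \<alpha> \<beta>) (\<xi> i)) (\<xi> i))
        = complex_of_real (real (N - max (length (fst \<alpha>)) (length (fst \<beta>))) / real N) * \<phi> (Elem \<alpha> \<beta>)"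
      using sum[OF u] by simp
  next
    \<comment> \<open>The trace is going to be sorted by range; a path of positive length in F ends
      at the head of an edge of F, hence in V.\<close>
    have rng: "rng G \<mu> \<in> V" if "\<mu> \<in> D" for \<mu>
    proof (cases "fst \<mu>")
      case Nil
      then have "\<mu> = vpath (src \<mu>)" by (intro path_eqI) simp_all
      then show ?thesis using that rng_simps(2)[of "src \<mu>"] by (simp add: D_def)
    next
      case (Cons e p)
      then have "rng G \<mu> = head G e" by (metis prod.collapse rng_simps(3))
      then show ?thesis using that Cons V(4) by (auto simp: D_def)
    qed
    have "complex_of_real (\<Sum>i<m. (hnorm \<L> (\<xi> i))\<^sup>2) = (\<Sum>i<m. \<Sum>\<mu>\<in>D. v i \<mu> * cnj (v i \<mu>))"
      unfolding \<xi>_def of_real_sum hnorm_path_vector[OF D] ..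
    also have "\<dots> = (\<Sum>\<mu>\<in>D. fejer N F \<mu> \<mu>)"
      by (subst sum.swap, intro sum.cong refl v[symmetric])
    \<comment> \<open>Each block is a sum over extensions of the vertex a, with weight N / N =
      1.\<close>
    also have "\<dots> = (\<Sum>a\<in>V. \<Sum>\<mu>\<in>{\<mu> \<in> D. rng G \<mu> = a}. fejer N F \<mu> \<mu>)"
      by (rule sum.group[symmetric]) (use D V rng in auto)
    also have "\<dots> = (\<Sum>a\<in>V. complex_of_real ((hnorm H (\<pi> (Elem (vpath a) (vpath a)) x))\<^sup>2))"
    proof (intro sum.cong refl)
      fix a assume a: "a \<in> V"
      then have va: "Elem (vpath a) (vpath a) \<in> carrier S" using V by auto
      have "{\<mu> \<in> D. rng G \<mu> = a} = {\<gamma> \<in> paths G. rng G \<gamma> = src (vpath a :: ('v, 'e) gpath)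
          \<and> concat_path (vpath a) \<gamma> \<in> D \<and> concat_path (vpath a) \<gamma> \<in> D}"
        using D by auto
      then have "(\<Sum>\<mu>\<in>{\<mu> \<in> D. rng G \<mu> = a}. fejer N F \<mu> \<mu>) = \<phi> (Elem (vpath a) (vpath a))"
        using sum[OF va] a N by simp
      also have "\<dots> = complex_of_real ((hnorm H (w (vpath a)))\<^sup>2)"
        using va ip_w[of "vpath a" "vpath a"] ip_self[of "w (vpath a)"] by (simp del: of_real_power)
      finally show "(\<Sum>\<mu>\<in>{\<mu> \<in> D. rng G \<mu> = a}. fejer N F \<mu> \<mu>)
          = complex_of_real ((hnorm H (\<pi> (Elem (vpath a) (vpath a)) x))\<^sup>2)"
        by (simp add: w_def)
    qed
    finally have "(\<Sum>i<m. (hnorm \<L> (\<xi> i))\<^sup>2) = (\<Sum>a\<in>V. (hnorm H (\<pi> (Elem (vpath a) (vpath a)) x))\<^sup>2)"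
      unfolding of_real_sum[symmetric] of_real_eq_iff .
    \<comment> \<open>Bessel's inequality again, now for the orthogonal projections of the
      vertices.\<close>
    also have "\<dots> \<le> (hnorm H x)\<^sup>2"
    proof (rule bessel[where z = Zero])
      show "sprod S (Elem (vpath a) (vpath a)) (sadj S (Elem (vpath b) (vpath b))) = Zero"
        if "a \<in> V" "b \<in> V" "a \<noteq> b" for a b
        using graph_prod_vpath[of "vpath b" "vpath a"] that V by (auto simp del: graph_prod.simps)
    qed (use V x zero_x in auto)
    finally show "(\<Sum>i<m. (hnorm \<L> (\<xi> i))\<^sup>2) \<le> (hnorm H x)\<^sup>2" .
  qed
qed

text \<open>By \<open>hnorm_extend_rep_sq\<close> the squared norm of \<Phi>(f)x is a finite
  combination of values of \<phi>. With the approximation \<open>q N\<close> in place of \<phi>, the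
  same combination is a sum of squared norms of vectors \<Lambda>(f)\<xi>, hence at most (C|x|)^2
  for every positive N.\<close>

lemma dominated_by_regular:
  assumes f: "f \<in> carrier \<A>"
  shows "hnorm H (\<Phi> f x) \<le> op_norm \<L> (extend_rep \<L> (regular_rep S) f) * hnorm H x"
proof -
  interpret L: semigroup_rep S \<L> "regular_rep S"
    by (rule semigroup_repI[OF representation_regular])
  let ?L = \<L>
  define C where "C = op_norm ?L (L.\<Phi> f)"
  define B where "B = supp f"
  \<comment> \<open>The elements t*s at which \<phi> is evaluated; F and V are made large enough to
    cover all of them in \<open>fejer_decomposition\<close>.\<close>
  define U where "U = (\<lambda>p. graph_prod G (graph_adj (snd p)) (fst p)) ` (B \<times> B)"
  have B: "finite B" "B \<subseteq> carrier S" using f by (simp_all add: B_def)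
  have U: "finite U" "U \<subseteq> carrier S"
    using B by (auto simp: U_def intro!: graph_prod_closed graph_adj_closed simp del: graph_prod.simps)
  have U_mem: "graph_prod G (graph_adj t) s \<in> U" if "s \<in> B" "t \<in> B" for s t
    unfolding U_def using that by (intro image_eqI[of _ _ "(s, t)"]) (simp_all del: graph_prod.simps)
  define edges where "edges u = (case u of Zero \<Rightarrow> {} | Elem \<alpha> \<beta> \<Rightarrow> set (fst \<alpha>) \<union> set (fst \<beta>))"
    for u :: "('v, 'e) graph_elem"
  define source where "source u = (case u of Zero \<Rightarrow> {} | Elem \<alpha> \<beta> \<Rightarrow> {src \<alpha>})"
    for u :: "('v, 'e) graph_elem"
  define F where "F = (\<Union>u\<in>U. edges u)"
  \<comment> \<open>Sources of elements of U are needed for layer 0, ends of F for the passage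
    between layers.\<close>
  define V where "V = (\<Union>u\<in>U. source u) \<union> tail G ` F \<union> head G ` F"
  have "finite (edges u)" "finite (source u)" for u
    by (auto simp: edges_def source_def split: graph_elem.splits)
  then have F: "finite F" and V: "finite V"
    using U by (auto simp: F_def V_def)
  have path_arcs: "set (fst \<mu>) \<subseteq> arcs G" if "\<mu> \<in> paths G" for \<mu>
    using that by (auto simp: paths_def awalk_def)
  have F_arcs: "F \<subseteq> arcs G"
    unfolding F_def
  proof (rule UN_least)
    fix u assume "u \<in> U"
    then have "u \<in> carrier S" using U by blast
    then show "edges u \<subseteq> arcs G"
      using path_arcs by (cases u) (auto simp: edges_def)
  qed
  have V_verts: "V \<subseteq> verts G"
  proof -
    have "source u \<subseteq> verts G" if "u \<in> U" for u
    proof -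
      have "u \<in> carrier S" using U that by blast
      then show ?thesis using src_in_verts by (cases u) (auto simp: source_def)
    qed
    then show ?thesis using F_arcs by (auto simp: V_def)
  qed
  have V_ends: "tail G ` F \<subseteq> V" "head G ` F \<subseteq> V"
    by (auto simp: V_def)
  define q where "q N u = (case u of Zero \<Rightarrow> 0 | Elem \<alpha> \<beta> \<Rightarrow>
    complex_of_real (real (N - max (length (fst \<alpha>)) (length (fst \<beta>))) / real N) * \<phi> u)" for N u
  have q_lim: "(\<lambda>N. q N u) \<longlonglongrightarrow> \<phi> u" for u
    by (cases u) (simp_all add: q_def \<phi>_Zero fejer_weight_tendsto del: of_real_divide)
  let ?Q = "\<lambda>p. \<Sum>s\<in>B. \<Sum>t\<in>B. f s * cnj (f t) * p (sprod S (sadj S t) s)"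
  have bound: "Re (?Q (q N)) \<le> (C * hnorm H x)\<^sup>2" if N: "0 < N" for N
  proof -
    obtain m :: nat and \<xi> where
      \<xi>: "\<And>i. \<xi> i \<in> carrier ?L" and norm: "(\<Sum>i<m. (hnorm ?L (\<xi> i))\<^sup>2) \<le> (hnorm H x)\<^sup>2"
      and zero: "(\<Sum>i<m. ip ?L (regular_rep S Zero (\<xi> i)) (\<xi> i)) = 0"
      and elem: "\<And>\<alpha> \<beta>. Elem \<alpha> \<beta> \<in> carrier S \<Longrightarrow> set (fst \<alpha>) \<subseteq> F \<Longrightarrow> set (fst \<beta>) \<subseteq> F \<Longrightarrow> src \<alpha> \<in> V \<Longrightarrow>
        (\<Sum>i<m. ip ?L (regular_rep S (Elem \<alpha> \<beta>) (\<xi> i)) (\<xi> i))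
          = complex_of_real (real (N - max (length (fst \<alpha>)) (length (fst \<beta>))) / real N) * \<phi> (Elem \<alpha> \<beta>)"
      by (rule fejer_decomposition[OF F F_arcs V V_verts V_ends N]) (rule that)
    have q_eq: "q N u = (\<Sum>i<m. ip ?L (regular_rep S u (\<xi> i)) (\<xi> i))" if u: "u \<in> U" for u
    proof (cases u)
      case Zero
      then show ?thesis using zero by (simp add: q_def)
    next
      case (Elem \<alpha> \<beta>)
      have "edges u \<subseteq> F" "source u \<subseteq> V" using u by (auto simp: F_def V_def)
      then show ?thesis
        using elem[of \<alpha> \<beta>] u U Elem by (auto simp: q_def edges_def source_def)
    qed
    have "?Q (q N) = ?Q (\<lambda>u. \<Sum>i<m. ip ?L (regular_rep S u (\<xi> i)) (\<xi> i))"
      by (intro sum.cong refl arg_cong2[where f = "(*)"] q_eq)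
        (simp only: U_mem graph_inverse_semigroup_simps)
    also have "\<dots> = (\<Sum>i<m. ?Q (\<lambda>u. ip ?L (regular_rep S u (\<xi> i)) (\<xi> i)))"
      unfolding sum_distrib_left
      by (rule trans[OF _ sum.swap]) (rule sum.cong[OF refl], rule sum.swap)
    also have "\<dots> = (\<Sum>i<m. complex_of_real ((hnorm ?L (L.\<Phi> f (\<xi> i)))\<^sup>2))"
      by (intro sum.cong refl L.hnorm_extend_rep_sq[symmetric] B \<xi>) (simp add: B_def)
    finally have "Re (?Q (q N)) = (\<Sum>i<m. (hnorm ?L (L.\<Phi> f (\<xi> i)))\<^sup>2)"
      by (simp only: Re_sum Re_complex_of_real)
    also have "\<dots> \<le> (\<Sum>i<m. C\<^sup>2 * (hnorm ?L (\<xi> i))\<^sup>2)"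
    proof (rule sum_mono)
      fix i
      have "hnorm ?L (L.\<Phi> f (\<xi> i)) \<le> C * hnorm ?L (\<xi> i)"
        unfolding C_def by (rule L.hnorm_op_le[OF L.extend_rep_bounded(1)[OF f] \<xi>])
      then have "(hnorm ?L (L.\<Phi> f (\<xi> i)))\<^sup>2 \<le> (C * hnorm ?L (\<xi> i))\<^sup>2"
        by (rule power_mono) (rule L.hnorm_nonneg[OF L.extend_rep_closed[OF f \<xi>]])
      then show "(hnorm ?L (L.\<Phi> f (\<xi> i)))\<^sup>2 \<le> C\<^sup>2 * (hnorm ?L (\<xi> i))\<^sup>2"
        by (simp only: power_mult_distrib)
    qed
    also have "\<dots> = C\<^sup>2 * (\<Sum>i<m. (hnorm ?L (\<xi> i))\<^sup>2)"
      by (simp only: sum_distrib_left)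
    also have "\<dots> \<le> C\<^sup>2 * (hnorm H x)\<^sup>2"
      using norm by (rule mult_left_mono) simp
    finally show ?thesis by (simp only: power_mult_distrib)
  qed
  have "(\<lambda>N. Re (?Q (q N))) \<longlonglongrightarrow> Re (?Q \<phi>)"
    by (intro tendsto_Re tendsto_sum tendsto_mult tendsto_const q_lim)
  then have "Re (?Q \<phi>) \<le> (C * hnorm H x)\<^sup>2"
    by (rule LIMSEQ_le_const2) (use bound in \<open>auto intro!: exI[of _ 1]\<close>)
  moreover have "complex_of_real ((hnorm H (\<Phi> f x))\<^sup>2) = ?Q \<phi>"
    unfolding \<phi>_def by (rule hnorm_extend_rep_sq[OF B(1) _ B(2) x]) (simp add: B_def)
  ultimately have "(hnorm H (\<Phi> f x))\<^sup>2 \<le> (C * hnorm H x)\<^sup>2"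
    by (metis Re_complex_of_real)
  moreover have "0 \<le> C * hnorm H x"
    unfolding C_def using L.op_norm_nonneg[OF L.extend_rep_bounded(1)[OF f]] x by simp
  ultimately show ?thesis
    unfolding C_def by (rule power2_le_imp_le)
qed

end

text \<open>Every \<Lambda>(s) fixes the unit vector at the zero element, so \<Lambda> contains the
  trivial representation, which sends f to the sum of its coefficients. This handles the range of
  \<pi>(0) in \<open>dominated_split_zero\<close>.\<close>

lemma (in wf_digraph) sum_le_op_norm_regular:
  assumes f: "f \<in> carrier (semigroup_algebra S)"
  shows "cmod (\<Sum>s\<in>supp f. f s) \<le> op_norm (ell2 (carrier S)) (extend_rep (ell2 (carrier S)) (regular_rep S) f)"
proof -
  interpret S: inverse_semigroup S by (rule inverse_semigroup_graph)
  interpret L: semigroup_rep S "ell2 (carrier S)" "regular_rep S"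
    by (rule S.semigroup_repI[OF S.representation_regular])
  have d: "\<delta> Zero \<in> carrier (ell2 (carrier S))"
    by (rule delta_in_ell2) simp
  have "regular_rep S s (\<delta> Zero) = \<delta> Zero" if "s \<in> carrier S" for s
    using regular_rep_delta[of Zero S s] by (simp add: regular_on_basis_def)
  then have "L.\<Phi> f (\<delta> Zero) = (\<Sum>s\<in>supp f. f s) \<odot>\<^bsub>ell2 (carrier S)\<^esub> \<delta> Zero"
    by (rule L.extend_rep_fixed[OF f d])
  moreover have "hnorm (ell2 (carrier S)) (\<delta> Zero) = 1"
  proof -
    have "(\<Sum>\<^sub>\<infinity>s\<in>carrier S. (cmod (\<delta> Zero s))\<^sup>2) = (\<Sum>\<^sub>\<infinity>s\<in>{Zero :: ('a, 'b) graph_elem}. (cmod (\<delta> Zero s))\<^sup>2)"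
      by (rule infsum_cong_neutral) (auto simp: \<delta>_def)
    then show ?thesis by (simp add: ell2_hnorm \<delta>_def)
  qed
  ultimately show ?thesis
    using L.hnorm_op_le[OF L.extend_rep_bounded(1)[OF f] d] L.hnorm_scale[OF d] by simp
qed

theorem theorem4p3:
  fixes G :: "('v, 'e) pre_digraph"
  assumes "wf_digraph G" and "countable (verts G)" and "countable (arcs G)"
  shows "weak_containment TYPE('h) (graph_inverse_semigroup G)"
proof -
  interpret wf_digraph G by fact
  interpret S: inverse_semigroup S by (rule inverse_semigroup_graph)
  show ?thesis
  proof (rule S.weak_containmentI)
    fix H :: "((('v, 'e) graph_elem \<Rightarrow> complex) + 'h) hilbert" and \<pi> f x
    assume rep: "representation S H \<pi>" and f: "f \<in> carrier (semigroup_algebra S)" and x: "x \<in> carrier H"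
    interpret R: semigroup_rep S H \<pi> by (rule S.semigroup_repI[OF rep])
    show "hnorm H (R.\<Phi> f x)
        \<le> op_norm (ell2 (carrier S)) (extend_rep (ell2 (carrier S)) (regular_rep S) f) * hnorm H x"
    proof (rule R.dominated_split_zero[where z = Zero, OF _ _ _ f x sum_le_op_norm_regular[OF f]])
      fix y assume "y \<in> carrier H" "\<pi> Zero y = \<zero>\<^bsub>H\<^esub>"
      then interpret graph_rep G H \<pi> y
        by unfold_locales
      show "hnorm H (R.\<Phi> f y)
          \<le> op_norm (ell2 (carrier S)) (extend_rep (ell2 (carrier S)) (regular_rep S) f) * hnorm H y"
        by (rule dominated_by_regular[OF f])
    qed simp_all
  qed
qed

end
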